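(* Let $G$ be a group such that the graded Lie algebra $\mathrm{gr}_\Gamma(G)$ has trivial center. For a fixed $s\ge1$, the following statements are equivalent: (1) $J\circ\iota_F\colon\mathrm{gr}^s_\Gamma(\mathcal{T}_G)\to\mathrm{Der}^s(\mathrm{gr}_\Gamma(G))$ is injective (respectively, surjective). (2) $\widetilde J\circ\iota_{\widetilde F}\colon\mathrm{gr}^s_\Gamma(\widetilde{\mathcal{T}}_G)\to\widetilde{\mathrm{Der}}^s(\mathrm{gr}_\Gamma(G))$ is injective (respectively, surjective).
   Context: For a group $G$, $(x,y)=xyx^{-1}y^{-1}$, $\Gamma^1(G)=G$, $\Gamma^{s+1}(G)=(\Gamma^s(G),G)$, and $\mathrm{gr}_\Gamma(G)=\bigoplus_{s\ge1}\Gamma^s(G)/\Gamma^{s+1}(G)$ is the associated graded Lie algebra (over $\mathbb{Z}$), with bracket induced by the commutator. The Johnson filtration on $\mathrm{Aut}(G)$ (product = composition) is $F^s=\{\alpha\mid\alpha(x)x^{-1}\in\Gamma^{s+1}(G)\ \forall x\in G\}$, $s\ge0$; $(F^s,F^t)\subseteq F^{s+t}$. The Torelli group is $\mathcal{T}_G=F^1$, and $\mathrm{gr}_F(\mathcal{T}_G)=\bigoplus_{s\ge1}F^s/F^{s+1}$. Let $\pi\colon\mathrm{Aut}(G)\to\mathrm{Out}(G)=\mathrm{Aut}(G)/\mathrm{Inn}(G)$, $\widetilde F^s=\pi(F^s)$, $\widetilde{\mathcal{T}}_G=\widetilde F^1$, $\mathrm{gr}_{\widetilde F}(\widetilde{\mathcal{T}}_G)=\bigoplus_{s\ge1}\widetilde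 F^s/\widetilde F^{s+1}$, and let $\bar\pi\colon\mathrm{gr}_F(\mathcal{T}_G)\to\mathrm{gr}_{\widetilde F}(\widetilde{\mathcal{T}}_G)$ be induced by $\pi$. The inclusions $\Gamma^s(\mathcal{T}_G)\subseteq F^s$ and $\Gamma^s(\widetilde{\mathcal{T}}_G)\subseteq\widetilde F^s$ induce morphisms of graded Lie algebras $\iota_F\colon\mathrm{gr}_\Gamma(\mathcal{T}_G)\to\mathrm{gr}_F(\mathcal{T}_G)$ and $\iota_{\widetilde F}\colon\mathrm{gr}_\Gamma(\widetilde{\mathcal{T}}_G)\to\mathrm{gr}_{\widetilde F}(\widetilde{\mathcal{T}}_G)$. For a graded Lie algebra $\mathfrak{g}$, $\mathrm{Der}(\mathfrak{g})=\bigoplus_{s\ge1}\mathrm{Der}^s(\mathfrak{g})$, with $\mathrm{Der}^s(\mathfrak{g})$ the linear derivations raising degree by $s$; $\widetilde{\mathrm{Der}}(\mathfrak{g})=\mathrm{Der}(\mathfrak{g})/\mathrm{im}(\mathrm{ad})$, graded accordingly, with projection $q\colon\mathrm{Der}(\mathfrak g)\to\widetilde{\mathrm{Der}}(\mathfrak g)$. The Johnson homomorphism $J\colon\mathrm{gr}_F(\mathcal{T}_G)\to\mathrm{Der}(\mathrm{gr}_\Gamma(G))$ is the (well-defined, injective) morphism of graded Lie algebras $J(\bar\alpha)(\bar x)=\overline{\alpha(x)x^{-1}}\in\mathrm{gr}_\Gamma^{s+t}(G)$ for $\alpha\in F^s$, $x\in\Gamma^t(G)$. When $\mathrm{gr}_\Gamma(G)$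 is centerless, the outer Johnson homomorphism $\widetilde J\colon\mathrm{gr}_{\widetilde F}(\widetilde{\mathcal{T}}_G)\to\widetilde{\mathrm{Der}}(\mathrm{gr}_\Gamma(G))$ is the unique (injective) morphism of graded Lie algebras with $\widetilde J\circ\bar\pi=q\circ J$. *)

theory Defs
  imports "HOL-Algebra.Bij" "HOL-Algebra.Generated_Groups" "HOL-Algebra.Product_Groups"
    "HOL-Algebra.FiniteProduct"
begin

section \<open>Graded Lie algebras over the integers\<close>

text \<open>The additive group of a Lie algebra is written multiplicatively, so that the library's
  groups, homomorphisms and quotients apply to it: the product is the sum and \<open>\<one>\<close> is zero.
  Linear over the integers means additive. The carrier is the whole direct sum, and
  \<open>hcomp L s\<close> is the set of its homogeneous elements of degree \<open>s\<close>, including zero. All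
  gradings start in degree 1, so \<open>hcomp L 0\<close> is the zero subgroup.\<close>

record 'a graded_lie = "'a monoid" +
  lbr :: "'a \<Rightarrow> 'a \<Rightarrow> 'a"
  hcomp :: "nat \<Rightarrow> 'a set"

definition lie_center :: "('a, 'm) graded_lie_scheme \<Rightarrow> 'a set"
  where "lie_center L = {z \<in> carrier L. \<forall>x\<in>carrier L. lbr L z x = \<one>\<^bsub>L\<^esub>}"

subsection \<open>Derivations\<close>

definition additive_endos :: "('a, 'm) graded_lie_scheme \<Rightarrow> ('a \<Rightarrow> 'a) monoid"
  where "additive_endos L =
    \<lparr>carrier = hom L L \<inter> extensional (carrier L),
     monoid.mult = (\<lambda>D E. \<lambda>x\<in>carrier L. D x \<otimes>\<^bsub>L\<^esub> E x),
     one = (\<lambda>x\<in>carrier L. \<one>\<^bsub>L\<^esub>)\<rparr>"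

definition der_deg :: "('a, 'm) graded_lie_scheme \<Rightarrow> nat \<Rightarrow> ('a \<Rightarrow> 'a) set"
  where "der_deg L s = {D \<in> hom L L \<inter> extensional (carrier L).
    (\<forall>x\<in>carrier L. \<forall>y\<in>carrier L. D (lbr L x y) = lbr L (D x) y \<otimes>\<^bsub>L\<^esub> lbr L x (D y)) \<and>
    (\<forall>t. D ` hcomp L t \<subseteq> hcomp L (t + s))}"

text \<open>\<open>Der L\<close> is the sum of the groups \<open>der_deg L s\<close>, \<open>s \<ge> 1\<close>, inside the additive
  endomorphisms of \<open>L\<close>; this sum is direct because \<open>L\<close> is the direct sum of its
  homogeneous components.\<close>

definition Der :: "('a, 'm) graded_lie_scheme \<Rightarrow> ('a \<Rightarrow> 'a) graded_lie"
  where "Der L =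
    \<lparr>carrier = generate (additive_endos L) (\<Union>s\<in>{1..}. der_deg L s),
     monoid.mult = monoid.mult (additive_endos L),
     one = monoid.one (additive_endos L),
     lbr = (\<lambda>D E. \<lambda>x\<in>carrier L. D (E x) \<otimes>\<^bsub>L\<^esub> inv\<^bsub>L\<^esub> (E (D x))),
     hcomp = (\<lambda>s. if s = 0 then {\<one>\<^bsub>additive_endos L\<^esub>} else der_deg L s)\<rparr>"

definition inner_der :: "('a, 'm) graded_lie_scheme \<Rightarrow> ('a \<Rightarrow> 'a) set"
  where "inner_der L = (\<lambda>x. \<lambda>y\<in>carrier L. lbr L x y) ` carrier L"

definition outer_proj :: "('a, 'm) graded_lie_scheme \<Rightarrow> ('a \<Rightarrow> 'a) \<Rightarrow> ('a \<Rightarrow> 'a) set"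
  where "outer_proj L D = inner_der L #>\<^bsub>Der L\<^esub> D"

definition Outer_Der :: "('a, 'm) graded_lie_scheme \<Rightarrow> ('a \<Rightarrow> 'a) set graded_lie"
  where "Outer_Der L =
    \<lparr>carrier = carrier (Der L Mod inner_der L),
     monoid.mult = monoid.mult (Der L Mod inner_der L),
     one = monoid.one (Der L Mod inner_der L),
     lbr = (\<lambda>A B. the_elem ((\<lambda>(D, E). outer_proj L (lbr (Der L) D E)) ` (A \<times> B))),
     hcomp = (\<lambda>s. outer_proj L ` hcomp (Der L) s)\<rparr>"


section \<open>The graded Lie algebra of a filtered group\<close>

definition commutator :: "('a, 'm) monoid_scheme \<Rightarrow> 'a \<Rightarrow> 'a \<Rightarrow> 'a"
  where "commutator G x y = x \<otimes>\<^bsub>G\<^esub> y \<otimes>\<^bsub>G\<^esub> inv\<^bsub>G\<^esub> x \<otimes>\<^bsub>G\<^esub> inv\<^bsub>G\<^esub> y"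

text \<open>The lower central series is indexed from 1; the value at 0 is a convention and is never
  used in a graded object.\<close>

primrec lcs :: "('a, 'm) monoid_scheme \<Rightarrow> nat \<Rightarrow> 'a set"
  where
    "lcs G 0 = carrier G"
  | "lcs G (Suc s) = (if s = 0 then carrier G
       else generate G (\<Union>x\<in>lcs G s. \<Union>y\<in>carrier G. {commutator G x y}))"

definition gr_part :: "('a, 'm) monoid_scheme \<Rightarrow> (nat \<Rightarrow> 'a set) \<Rightarrow> nat \<Rightarrow> 'a set monoid"
  where "gr_part G N s = (G\<lparr>carrier := N s\<rparr>) Mod N (Suc s)"

text \<open>If \<open>c\<close> induces biadditive maps from the product of the degree \<open>s\<close> and the degree \<open>t\<close>
  part of two graded groups to \<open>N (s + t) / N (s + t + 1)\<close>, then \<open>gr_pairing G N c\<close> is the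
  resulting pairing of the direct sums. The image of which \<open>the_elem\<close> is taken is the set of
  values on all representatives of the two cosets; it is a singleton when the induced map is
  well defined.\<close>

definition gr_pairing ::
  "('a, 'm) monoid_scheme \<Rightarrow> (nat \<Rightarrow> 'a set) \<Rightarrow> ('b \<Rightarrow> 'c \<Rightarrow> 'a) \<Rightarrow>
    (nat \<Rightarrow> 'b set) \<Rightarrow> (nat \<Rightarrow> 'c set) \<Rightarrow> nat \<Rightarrow> 'a set"
  where "gr_pairing G N c X Y = (\<lambda>n\<in>{1..}.
    finprod (gr_part G N n)
      (\<lambda>s. the_elem ((\<lambda>(x, y). N (Suc n) #>\<^bsub>G\<^esub> c x y) ` (X s \<times> Y (n - s)))) {1..<n})"

definition gr :: "('a, 'm) monoid_scheme \<Rightarrow> (nat \<Rightarrow> 'a set) \<Rightarrow> (nat \<Rightarrow> 'a set) graded_lie"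
  where "gr G N =
    (let S = sum_group {1..} (gr_part G N) in
    \<lparr>carrier = carrier S,
     monoid.mult = monoid.mult S,
     one = monoid.one S,
     lbr = gr_pairing G N (commutator G),
     hcomp = (\<lambda>s. {X \<in> carrier S. \<forall>t\<in>{1..}. t \<noteq> s \<longrightarrow> X t = \<one>\<^bsub>gr_part G N t\<^esub>})\<rparr>)"

abbreviation gr_lcs :: "('a, 'm) monoid_scheme \<Rightarrow> (nat \<Rightarrow> 'a set) graded_lie"
  where "gr_lcs G \<equiv> gr G (lcs G)"

text \<open>The map into \<open>gr H M\<close> induced by a filtration-preserving homomorphism \<open>h\<close> to \<open>H\<close>.\<close>

definition gr_map ::
  "('b, 'm) monoid_scheme \<Rightarrow> (nat \<Rightarrow> 'b set) \<Rightarrow> ('a \<Rightarrow> 'b) \<Rightarrow> (nat \<Rightarrow> 'a set) \<Rightarrow> nat \<Rightarrow> 'b set"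
  where "gr_map H M h X = (\<lambda>s\<in>{1..}. the_elem ((\<lambda>x. M (Suc s) #>\<^bsub>H\<^esub> h x) ` X s))"


section \<open>Johnson filtrations and Torelli groups\<close>

definition johnson_filt :: "('a, 'm) monoid_scheme \<Rightarrow> nat \<Rightarrow> ('a \<Rightarrow> 'a) set"
  where "johnson_filt G s =
    {\<alpha> \<in> auto G. \<forall>x\<in>carrier G. \<alpha> x \<otimes>\<^bsub>G\<^esub> inv\<^bsub>G\<^esub> x \<in> lcs G (Suc s)}"

definition Torelli :: "('a, 'm) monoid_scheme \<Rightarrow> ('a \<Rightarrow> 'a) monoid"
  where "Torelli G = (AutoGroup G)\<lparr>carrier := johnson_filt G 1\<rparr>"

definition Inn :: "('a, 'm) monoid_scheme \<Rightarrow> ('a \<Rightarrow> 'a) set"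
  where "Inn G = (\<lambda>g. \<lambda>x\<in>carrier G. g \<otimes>\<^bsub>G\<^esub> x \<otimes>\<^bsub>G\<^esub> inv\<^bsub>G\<^esub> g) ` carrier G"

definition Out :: "('a, 'm) monoid_scheme \<Rightarrow> ('a \<Rightarrow> 'a) set monoid"
  where "Out G = AutoGroup G Mod Inn G"

definition out_proj :: "('a, 'm) monoid_scheme \<Rightarrow> ('a \<Rightarrow> 'a) \<Rightarrow> ('a \<Rightarrow> 'a) set"
  where "out_proj G \<alpha> = Inn G #>\<^bsub>AutoGroup G\<^esub> \<alpha>"

definition outer_johnson_filt :: "('a, 'm) monoid_scheme \<Rightarrow> nat \<Rightarrow> ('a \<Rightarrow> 'a) set set"
  where "outer_johnson_filt G s = out_proj G ` johnson_filt G s"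

definition Outer_Torelli :: "('a, 'm) monoid_scheme \<Rightarrow> ('a \<Rightarrow> 'a) set monoid"
  where "Outer_Torelli G = (Out G)\<lparr>carrier := outer_johnson_filt G 1\<rparr>"

abbreviation gr_johnson :: "('a, 'm) monoid_scheme \<Rightarrow> (nat \<Rightarrow> ('a \<Rightarrow> 'a) set) graded_lie"
  where "gr_johnson G \<equiv> gr (Torelli G) (johnson_filt G)"

abbreviation gr_outer_johnson ::
  "('a, 'm) monoid_scheme \<Rightarrow> (nat \<Rightarrow> ('a \<Rightarrow> 'a) set set) graded_lie"
  where "gr_outer_johnson G \<equiv> gr (Outer_Torelli G) (outer_johnson_filt G)"

definition gr_out_proj ::
  "('a, 'm) monoid_scheme \<Rightarrow> (nat \<Rightarrow> ('a \<Rightarrow> 'a) set) \<Rightarrow> nat \<Rightarrow> ('a \<Rightarrow> 'a) set set"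
  where "gr_out_proj G = gr_map (Outer_Torelli G) (outer_johnson_filt G) (out_proj G)"

definition iota ::
  "('a, 'm) monoid_scheme \<Rightarrow> (nat \<Rightarrow> ('a \<Rightarrow> 'a) set) \<Rightarrow> nat \<Rightarrow> ('a \<Rightarrow> 'a) set"
  where "iota G = gr_map (Torelli G) (johnson_filt G) (\<lambda>\<alpha>. \<alpha>)"

definition outer_iota ::
  "('a, 'm) monoid_scheme \<Rightarrow> (nat \<Rightarrow> ('a \<Rightarrow> 'a) set set) \<Rightarrow> nat \<Rightarrow> ('a \<Rightarrow> 'a) set set"
  where "outer_iota G = gr_map (Outer_Torelli G) (outer_johnson_filt G) (\<lambda>\<alpha>. \<alpha>)"


section \<open>Johnson homomorphisms\<close>

definition johnson_hom ::
  "('a, 'm) monoid_scheme \<Rightarrow> (nat \<Rightarrow> ('a \<Rightarrow> 'a) set) \<Rightarrow> (nat \<Rightarrow> 'a set) \<Rightarrow> nat \<Rightarrow> 'a set"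
  where "johnson_hom G = (\<lambda>A\<in>carrier (gr_johnson G). \<lambda>X\<in>carrier (gr_lcs G).
    gr_pairing G (lcs G) (\<lambda>\<alpha> x. \<alpha> x \<otimes>\<^bsub>G\<^esub> inv\<^bsub>G\<^esub> x) A X)"

text \<open>The outer Johnson homomorphism is determined by the requirement that its composition with
  \<open>gr_out_proj G\<close> is \<open>outer_proj (gr_lcs G) \<circ> johnson_hom G\<close>, since \<open>gr_out_proj G\<close>
  is onto: its value at \<open>B\<close> is the common value of the latter on the fibre over \<open>B\<close>. There is a
  common value when \<open>gr_lcs G\<close> is centerless.\<close>

definition outer_johnson_hom ::
  "('a, 'm) monoid_scheme \<Rightarrow> (nat \<Rightarrow> ('a \<Rightarrow> 'a) set set) \<Rightarrow> ((nat \<Rightarrow> 'a set) \<Rightarrow> nat \<Rightarrow> 'a set) set"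
  where "outer_johnson_hom G = (\<lambda>B\<in>carrier (gr_outer_johnson G).
    the_elem ((\<lambda>A. outer_proj (gr_lcs G) (johnson_hom G A)) `
      {A \<in> carrier (gr_johnson G). gr_out_proj G A = B}))"

end

(*
Conjugation c maps gr(G) to gr_Gamma(T) and to gr_F(T); J turns its image in gr_F(T) into the inner
derivations. If gr(G) is centerless, then c_g lies in F^s only for g in Gamma^s(G), so in degree s
the kernels of both gr_Gamma(T) -> gr_Gamma(T~) and gr_F(T) -> gr_F~(T~) consist of the classes of
c_g with g in Gamma^s(G), and an inner derivation of degree s is ad of an element of degree s.
Passing to outer automorphisms thus divides source and target of J o iota_F in degree s by
isomorphic copies of gr^s(G), so injectivity and surjectivity are both unaffected.
*)
theory Submission
  imports Defs
begin

section \<open>Commutators and the lower central series\<close>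

text \<open>Injectivity passes from the outer to the inner map only because two filtrations are
  played against each other. If \<open>J\<close> identifies two elements of Gamma^s(T), their
  quotient lies in F^(s+1) by injectivity of \<open>J\<close> on gr_F, and by outer injectivity it
  is c_g times an element of Gamma^(s+1)(T), which lies in F^(s+1) too. So c_g lies in F^(s+1),
  hence g in Gamma^(s+1)(G), and only then is c_g seen to lie in Gamma^(s+1)(T). The criterion for
  c_g comes from climbing: as long as c_g is deeper than g, the class of g is central. Brackets and
  Johnson maps are read off from arbitrary representatives, so well-definedness is a large part of
  the work. Pairings that are additive modulo deeper terms are treated once, for the commutator and
  for the displacement \<alpha>(x) x^-1; as the displacement of c_g is the commutator with g, the
  second instance yields the first. The outer Johnson map is defined by fibres over the whole direct
  sum, so the fibres have to be described for inhomogeneous elements, with control of finite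
  support.\<close>

context group
begin

lemma l_inv_assoc: "\<lbrakk>x \<in> carrier G; y \<in> carrier G\<rbrakk> \<Longrightarrow> inv x \<otimes> (x \<otimes> y) = y"
  by (simp flip: m_assoc)

lemma r_inv_assoc: "\<lbrakk>x \<in> carrier G; y \<in> carrier G\<rbrakk> \<Longrightarrow> x \<otimes> (inv x \<otimes> y) = y"
  by (simp flip: m_assoc)

text \<open>With the unit and inverse laws of the simplifier this is the complete rewrite system of
  free groups: associate to the right, push inverses to the letters, cancel neighbours. It decides
  the commutator identities below.\<close>

lemmas group_normalize = m_assoc inv_mult_group l_inv_assoc r_inv_assoc

lemma commutator_closed [simp, intro]:
  "\<lbrakk>x \<in> carrier G; y \<in> carrier G\<rbrakk> \<Longrightarrow> commutator G x y \<in> carrier G"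
  by (simp add: commutator_def)

lemma commutator_eq_one_iff:
  assumes "x \<in> carrier G" "y \<in> carrier G"
  shows "commutator G x y = \<one> \<longleftrightarrow> x \<otimes> y = y \<otimes> x"
proof -
  have "commutator G x y = (x \<otimes> y) \<otimes> inv (y \<otimes> x)"
    using assms by (simp add: commutator_def group_normalize)
  then show ?thesis
    using assms by (metis inv_closed inv_equality inv_inv m_closed r_inv)
qed

lemma commutator_mult_left:
  assumes "a \<in> carrier G" "b \<in> carrier G" "c \<in> carrier G"
  shows "commutator G (a \<otimes> b) c = a \<otimes> commutator G b c \<otimes> inv a \<otimes> commutator G a c"
  using assms by (simp add: commutator_def group_normalize)

lemma commutator_mult_right:
  assumes "a \<in> carrier G" "b \<in> carrier G" "c \<in> carrier G"
  shows "commutator G a (b \<otimes> c) = commutator G a b \<otimes> (b \<otimes> commutator G a c \<otimes> inv b)"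
  using assms by (simp add: commutator_def group_normalize)

lemma mult_inv_cancel: "\<lbrakk>x \<in> carrier G; y \<in> carrier G\<rbrakk> \<Longrightarrow> x \<otimes> y \<otimes> inv y = x"
  by (simp add: m_assoc)

text \<open>The infinitesimal Leibniz rule for the commutator under \<open>x \<mapsto> a x\<close>, \<open>y \<mapsto> b y\<close>.\<close>

lemma commutator_mult_mult:
  assumes c: "a \<in> carrier G" "b \<in> carrier G" "x \<in> carrier G" "y \<in> carrier G"
    and "a \<otimes> commutator G x (b \<otimes> y) = commutator G x (b \<otimes> y) \<otimes> a"
    and "b \<otimes> commutator G x y = commutator G x y \<otimes> b"
    and "a \<otimes> b = b \<otimes> a"
    and "b \<otimes> commutator G a y = commutator G a y \<otimes> b"
  shows "commutator G (a \<otimes> x) (b \<otimes> y) =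
    commutator G x b \<otimes> commutator G x y \<otimes> commutator G a y"
proof -
  have "commutator G (a \<otimes> x) (b \<otimes> y) =
      a \<otimes> commutator G x (b \<otimes> y) \<otimes> inv a \<otimes> commutator G a (b \<otimes> y)"
    using c by (simp add: commutator_mult_left)
  also have "\<dots> = commutator G x (b \<otimes> y) \<otimes> commutator G a (b \<otimes> y)"
    using assms by (simp add: mult_inv_cancel)
  also have "commutator G x (b \<otimes> y) = commutator G x b \<otimes> commutator G x y"
    using assms by (simp add: commutator_mult_right mult_inv_cancel)
  also have "commutator G a (b \<otimes> y) = commutator G a b \<otimes> commutator G a y"
    using assms by (simp add: commutator_mult_right mult_inv_cancel)
  also have "commutator G a b = \<one>"
    using assms by (simp add: commutator_eq_one_iff)
  finally show ?thesis
    using c by simp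
qed

end

lemma (in group_hom) hom_commutator:
  "\<lbrakk>x \<in> carrier G; y \<in> carrier G\<rbrakk> \<Longrightarrow> h (commutator G x y) = commutator H (h x) (h y)"
  by (simp add: commutator_def)

section \<open>Commutators in quotient groups\<close>

context normal
begin

lemma rcos_eq_iff:
  assumes "x \<in> carrier G" "y \<in> carrier G"
  shows "H #> x = H #> y \<longleftrightarrow> x \<otimes> inv y \<in> H"
  using assms by (metis rcos_module rcos_self repr_independence is_group subgroup_axioms)

lemma group_hom_Mod: "group_hom G (G Mod H) (\<lambda>x. H #> x)"
  by (simp add: group_hom_def group_hom_axioms_def factorgroup_is_group r_coset_hom_Mod is_group)

lemma rcos_carrier: "x \<in> carrier G \<Longrightarrow> H #> x \<in> carrier (G Mod H)"
  by (simp add: carrier_FactGroup)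

lemma rcos_mult:
  "\<lbrakk>x \<in> carrier G; y \<in> carrier G\<rbrakk> \<Longrightarrow> H #> (x \<otimes> y) = (H #> x) \<otimes>\<^bsub>G Mod H\<^esub> (H #> y)"
  using group_hom_Mod by (simp add: group_hom.hom_mult)

lemma rcos_commutator:
  "\<lbrakk>x \<in> carrier G; y \<in> carrier G\<rbrakk> \<Longrightarrow>
    H #> commutator G x y = commutator (G Mod H) (H #> x) (H #> y)"
  by (rule group_hom.hom_commutator[OF group_hom_Mod])

lemma rcos_eq_H_iff: "x \<in> carrier G \<Longrightarrow> H #> x = H \<longleftrightarrow> x \<in> H"
  by (meson coset_join1 coset_join2 subgroup_axioms subset is_group)

text \<open>Translates membership of a commutator in a filtration step into commutation in the
  quotient. There the hypotheses of \<open>commutator_mult_mult\<close> hold exactly, so the Leibniz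
  rule is applied in the quotient.\<close>

lemma rcos_commute_iff:
  assumes "x \<in> carrier G" "y \<in> carrier G"
  shows "(H #> x) \<otimes>\<^bsub>G Mod H\<^esub> (H #> y) = (H #> y) \<otimes>\<^bsub>G Mod H\<^esub> (H #> x) \<longleftrightarrow> commutator G x y \<in> H"
proof -
  have "commutator G x y \<in> H \<longleftrightarrow> commutator (G Mod H) (H #> x) (H #> y) = \<one>\<^bsub>G Mod H\<^esub>"
    using assms by (simp add: rcos_eq_H_iff flip: rcos_commutator)
  then show ?thesis
    using assms
    by (metis (no_types, lifting) group.commutator_eq_one_iff factorgroup_is_group rcos_carrier)
qed

end

section \<open>The lower central series and its degree shifts\<close>

context group
begin

lemma lcs_subset_carrier: "lcs G s \<subseteq> carrier G"
proof (induction s)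
  case (Suc s)
  then have "(\<Union>x\<in>lcs G s. \<Union>y\<in>carrier G. {commutator G x y}) \<subseteq> carrier G"
    by blast
  then show ?case
    by (simp add: generate_incl)
qed simp

lemma lcs_1 [simp]: "lcs G (Suc 0) = carrier G"
  by simp

declare lcs.simps [simp del]

text \<open>The conjugate of a generating commutator is the commutator of the conjugates, again a
  generator because the previous term is normal.\<close>

lemma lcs_normal: "lcs G s \<lhd> G"
proof (induction s)
  case 0
  then show ?case
    by (simp add: normal_self lcs.simps)
next
  case (Suc s)
  show ?case
  proof (cases "s = 0")
    case True
    then show ?thesis
      by (simp add: normal_self)
  next
    case False
    have "generate G (\<Union>x\<in>lcs G s. \<Union>y\<in>carrier G. {commutator G x y}) \<lhd> G"
    proof (rule normal_generateI)
      show "(\<Union>x\<in>lcs G s. \<Union>y\<in>carrier G. {commutator G x y}) \<subseteq> carrier G"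
        using lcs_subset_carrier by blast
    next
      fix h g
      assume "h \<in> (\<Union>x\<in>lcs G s. \<Union>y\<in>carrier G. {commutator G x y})" and g: "g \<in> carrier G"
      then obtain x y where xy: "x \<in> lcs G s" "y \<in> carrier G" "h = commutator G x y"
        by blast
      have x: "x \<in> carrier G"
        using xy lcs_subset_carrier by blast
      have "g \<otimes> h \<otimes> inv g = commutator G (g \<otimes> x \<otimes> inv g) (g \<otimes> y \<otimes> inv g)"
        using x xy g by (simp add: commutator_def group_normalize)
      moreover have "g \<otimes> x \<otimes> inv g \<in> lcs G s"
        using Suc g xy by (simp add: normal.inv_op_closed2)
      ultimately show "g \<otimes> h \<otimes> inv g \<in> (\<Union>x\<in>lcs G s. \<Union>y\<in>carrier G. {commutator G x y})"
        using xy g by blast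
    qed
    then show ?thesis
      using False by (simp add: lcs.simps)
  qed
qed

lemma lcs_subgroup: "subgroup (lcs G s) G"
  by (rule normal_imp_subgroup[OF lcs_normal])

lemma lcs_commutator:
  assumes "s \<ge> 1" "x \<in> lcs G s" "y \<in> carrier G"
  shows "commutator G x y \<in> lcs G (Suc s)"
  using assms by (auto simp: lcs.simps intro!: generate.incl)

lemma lcs_Suc_subset: "lcs G (Suc s) \<subseteq> lcs G s"
proof (cases "s = 0")
  case False
  interpret N: normal "lcs G s" G
    by (rule lcs_normal)
  have "commutator G x y \<in> lcs G s" if "x \<in> lcs G s" "y \<in> carrier G" for x y
  proof -
    have x: "x \<in> carrier G"
      using that lcs_subset_carrier by blast
    have "commutator G x y = x \<otimes> (y \<otimes> inv x \<otimes> inv y)"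
      using that x by (simp add: commutator_def group_normalize)
    then show ?thesis
      using that x by (simp add: N.inv_op_closed2)
  qed
  then have "(\<Union>x\<in>lcs G s. \<Union>y\<in>carrier G. {commutator G x y}) \<subseteq> lcs G s"
    by blast
  then show ?thesis
    using False generate_subgroup_incl[OF _ lcs_subgroup] by (simp add: lcs.simps)
qed (simp add: lcs.simps)

lemma lcs_mono: "s \<le> t \<Longrightarrow> lcs G t \<subseteq> lcs G s"
  by (rule lift_Suc_antimono_le) (rule lcs_Suc_subset)

lemma conj_in_hom: "g \<in> carrier G \<Longrightarrow> (\<lambda>x\<in>carrier G. g \<otimes> x \<otimes> inv g) \<in> hom G G"
  by (auto simp: hom_def group_normalize)

text \<open>The action of an endomorphism and the commutator with an element are treated at once: the
  induction step for \<open>h\<close> uses the induction hypothesis for conjugations, one degree higher.\<close>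

lemma lcs_shift:
  assumes "h \<in> hom G G" "\<And>x. x \<in> carrier G \<Longrightarrow> h x \<otimes> inv x \<in> lcs G (Suc s)"
    and "t \<ge> 1" "x \<in> lcs G t"
  shows "h x \<otimes> inv x \<in> lcs G (s + t)"
  using \<open>t \<ge> 1\<close> assms(1,2,4)
proof (induction t arbitrary: h s x rule: dec_induct)
  case base
  then show ?case
    by simp
next
  case (step t)
  interpret N: normal "lcs G (Suc (s + t))" G
    by (rule lcs_normal)
  interpret Q: group "G Mod lcs G (Suc (s + t))"
    by (rule N.factorgroup_is_group)
  interpret h: group_hom G G h
    using step.prems by (simp add: group_hom_def group_hom_axioms_def is_group)
  let ?r = "\<lambda>x. lcs G (Suc (s + t)) #> x"
  interpret r: group_hom G "G Mod lcs G (Suc (s + t))" ?r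
    by (rule N.group_hom_Mod)
  have comm: "commutator G b z \<in> lcs G (Suc (s + t))"
    if b: "b \<in> lcs G (Suc s)" and z: "z \<in> lcs G t" for b z
  proof -
    have bz: "b \<in> carrier G" "z \<in> carrier G"
      using that lcs_subset_carrier by blast+
    have "(\<lambda>x\<in>carrier G. b \<otimes> x \<otimes> inv b) z \<otimes> inv z \<in> lcs G (Suc s + t)"
      using b bz z lcs_commutator[OF _ b] 
      by (intro step.IH conj_in_hom) (simp_all add: commutator_def)
    then show ?thesis
      using bz by (simp add: commutator_def)
  qed
  \<comment> \<open>Put \<open>h x = a x\<close> and \<open>h y = b y\<close>. Modulo Gamma^(s+t+1),
    \<open>a\<close> is central and \<open>b\<close> commutes with Gamma^t, so the Leibniz rule
    applies, and its extra factors, the commutators of \<open>x\<close> with \<open>b\<close> and of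
    \<open>a\<close> with \<open>y\<close>, are trivial.\<close>
  have gens: "?r (h (commutator G x y)) = ?r (commutator G x y)"
    if x: "x \<in> lcs G t" and y: "y \<in> carrier G" for x y
  proof -
    define a where "a = h x \<otimes> inv x"
    define b where "b = h y \<otimes> inv y"
    have xc: "x \<in> carrier G"
      using x lcs_subset_carrier by blast
    have a: "a \<in> lcs G (s + t)"
      unfolding a_def using step.IH[OF step.prems(1,2)] x by blast
    have b: "b \<in> lcs G (Suc s)"
      unfolding b_def using step.prems(2) y by blast
    have ab: "a \<in> carrier G" "b \<in> carrier G"
      using a b lcs_subset_carrier by blast+
    have st: "s + t \<ge> 1"
      using step.hyps by simp
    have h: "h x = a \<otimes> x" "h y = b \<otimes> y"
      unfolding a_def b_def using xc y by (simp_all add: group_normalize)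
    have Acomm: "?r a \<otimes>\<^bsub>G Mod lcs G (Suc (s + t))\<^esub> ?r w = ?r w \<otimes>\<^bsub>G Mod lcs G (Suc (s + t))\<^esub> ?r a"
      if "w \<in> carrier G" for w
      using that ab lcs_commutator[OF st a] N.rcos_commute_iff by blast
    have Bcomm: "?r b \<otimes>\<^bsub>G Mod lcs G (Suc (s + t))\<^esub> ?r w = ?r w \<otimes>\<^bsub>G Mod lcs G (Suc (s + t))\<^esub> ?r b"
      if "w \<in> lcs G t" for w
      using that ab comm[OF b that] N.rcos_commute_iff lcs_subset_carrier by blast
    have xy: "commutator G x y \<in> lcs G t"
      using lcs_commutator[OF step.hyps(1) x y] lcs_Suc_subset by blast
    have "commutator G a y \<in> lcs G (Suc (s + t))"
      using lcs_commutator[OF st a y] .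
    then have "?r (commutator G a y) = \<one>\<^bsub>G Mod lcs G (Suc (s + t))\<^esub>"
      using ab y by (simp add: N.rcos_eq_H_iff)
    then have ay: "commutator (G Mod lcs G (Suc (s + t))) (?r a) (?r y) = \<one>\<^bsub>G Mod lcs G (Suc (s + t))\<^esub>"
      using ab y by (simp only: r.hom_commutator)
    have xb: "commutator (G Mod lcs G (Suc (s + t))) (?r x) (?r b) = \<one>\<^bsub>G Mod lcs G (Suc (s + t))\<^esub>"
      by (subst Q.commutator_eq_one_iff) (use xc ab Bcomm[OF x] r.hom_closed in auto)
    have "?r (h (commutator G x y)) = commutator (G Mod lcs G (Suc (s + t)))
        (?r a \<otimes>\<^bsub>G Mod lcs G (Suc (s + t))\<^esub> ?r x) (?r b \<otimes>\<^bsub>G Mod lcs G (Suc (s + t))\<^esub> ?r y)"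
      using xc y ab by (simp only: h.hom_commutator h r.hom_commutator r.hom_mult m_closed)
    also have "\<dots> = commutator (G Mod lcs G (Suc (s + t))) (?r x) (?r y)"
      using Acomm[of "commutator G x (b \<otimes> y)"] Acomm[of b] Bcomm[OF xy] xc y ab ay xb
      by (subst Q.commutator_mult_mult)
        (simp_all only: r.hom_closed r.hom_commutator r.hom_mult m_closed commutator_closed
          Q.r_one Q.l_one Q.one_closed Q.commutator_closed)
    finally show ?thesis
      using xc y by (simp only: r.hom_commutator)
  qed
  \<comment> \<open>The elements fixed by \<open>h\<close> modulo Gamma^(s+t+1) form a subgroup, so
    the generators of Gamma^(t+1) suffice.\<close>
  have "subgroup {z \<in> carrier G. ?r (h z) = ?r z} G"
  proof (rule subgroupI)
    have "\<one> \<in> {z \<in> carrier G. ?r (h z) = ?r z}"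
      by (simp only: mem_Collect_eq h.hom_one one_closed)
    then show "{z \<in> carrier G. ?r (h z) = ?r z} \<noteq> {}"
      by blast
    show "{z \<in> carrier G. ?r (h z) = ?r z} \<subseteq> carrier G"
      by blast
  qed (simp_all only: mem_Collect_eq h.hom_inv r.hom_inv h.hom_mult r.hom_mult h.hom_closed
      m_closed inv_closed)
  moreover have "(\<Union>x\<in>lcs G t. \<Union>y\<in>carrier G. {commutator G x y}) \<subseteq> {z \<in> carrier G. ?r (h z) = ?r z}"
    using gens lcs_subset_carrier by blast
  ultimately have "lcs G (Suc t) \<subseteq> {z \<in> carrier G. ?r (h z) = ?r z}"
    using generate_subgroup_incl step.hyps(1) by (simp add: lcs.simps)
  then have "x \<in> {z \<in> carrier G. ?r (h z) = ?r z}"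
    using step.prems(3) by (rule subsetD)
  then have "x \<in> carrier G" "?r (h x) = ?r x"
    by (simp_all only: mem_Collect_eq)
  then show ?case
    by (simp only: N.rcos_eq_iff h.hom_closed add_Suc_right)
qed

end

section \<open>Filtered groups and their graded groups\<close>

text \<open>The coset is formed in the whole group although \<open>gr_part\<close> restricts the
  carrier to \<open>N n\<close>: \<open>r_coset\<close> looks only at the multiplication, so both
  give the same set.\<close>

definition gr_coset :: "('a, 'm) monoid_scheme \<Rightarrow> (nat \<Rightarrow> 'a set) \<Rightarrow> nat \<Rightarrow> 'a \<Rightarrow> 'a set"
  where "gr_coset G N n x = N (Suc n) #>\<^bsub>G\<^esub> x"

definition gr_elem :: "('a, 'm) monoid_scheme \<Rightarrow> (nat \<Rightarrow> 'a set) \<Rightarrow> nat \<Rightarrow> 'a \<Rightarrow> nat \<Rightarrow> 'a set"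
  where "gr_elem G N s x = (\<lambda>n\<in>{1..}. if n = s then gr_coset G N s x else \<one>\<^bsub>gr_part G N n\<^esub>)"

text \<open>For infinite \<open>I\<close> both products default to the unit, which \<open>h\<close>
  preserves. The purpose is to move the Johnson pairing inside the sum that defines a component of a
  bracket.\<close>

lemma hom_finprod:
  assumes "comm_group A" "comm_group B" "h \<in> hom A B" "f \<in> I \<rightarrow> carrier A"
  shows "h (finprod A f I) = finprod B (\<lambda>i. h (f i)) I"
proof -
  interpret A: comm_group A by fact
  interpret B: comm_group B by fact
  interpret h: group_hom A B h
    using assms by (simp add: group_hom_def group_hom_axioms_def A.is_group B.is_group)
  show ?thesis
    using assms(4)
  proof (induction I rule: infinite_finite_induct)
    case (insert i I)
    moreover have "(\<lambda>i. h (f i)) \<in> I \<rightarrow> carrier B"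
      using insert.prems h.hom_closed by blast
    moreover have "finprod A f I \<in> carrier A"
      using insert.prems by (intro A.finprod_closed) auto
    ultimately show ?case
      by (simp add: A.finprod_insert B.finprod_insert Pi_def)
  qed simp_all
qed

text \<open>Bounding commutators with the whole group makes the terms normal and the quotients
  abelian, hence \<open>gr G N\<close> an abelian group. The instances are the lower central series,
  the Johnson filtration and its image in the outer Torelli group; how two degrees add up is left to
  \<open>graded_pairing\<close>.\<close>

locale central_filtration = group G for G (structure) +
  fixes N :: "nat \<Rightarrow> 'a set"
  assumes subgroup_filt: "s \<ge> 1 \<Longrightarrow> subgroup (N s) G"
    and filt_1: "N (Suc 0) = carrier G"
    and filt_Suc_subset: "s \<ge> 1 \<Longrightarrow> N (Suc s) \<subseteq> N s"
    and filt_commutator: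
      "\<lbrakk>s \<ge> 1; x \<in> N s; y \<in> carrier G\<rbrakk> \<Longrightarrow> commutator G x y \<in> N (Suc s)"
begin

lemma filt_carrier: "\<lbrakk>s \<ge> 1; x \<in> N s\<rbrakk> \<Longrightarrow> x \<in> carrier G"
  using subgroup_filt subgroup.subset by blast

text \<open>A conjugate of \<open>x\<close> is \<open>x\<close> times the inverse of a commutator
  with \<open>x\<close>, which lies one step deeper.\<close>

lemma normal_filt:
  assumes "s \<ge> 1"
  shows "N s \<lhd> G"
proof -
  have "g \<otimes> x \<otimes> inv g \<in> N s" if g: "g \<in> carrier G" and x: "x \<in> N s" for g x
  proof -
    have xc: "x \<in> carrier G"
      using assms x by (rule filt_carrier)
    have "inv (commutator G x g) \<in> N s"
      using filt_commutator[OF assms x g] filt_Suc_subset[OF assms] subgroup_filt[OF assms]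
      by (blast intro: subgroup.m_inv_closed)
    then have "inv (commutator G x g) \<otimes> x \<in> N s"
      using subgroup_filt[OF assms] x by (simp add: subgroup.m_closed)
    moreover have "inv (commutator G x g) \<otimes> x = g \<otimes> x \<otimes> inv g"
      using g xc by (simp add: commutator_def group_normalize)
    ultimately show ?thesis
      by simp
  qed
  then show ?thesis
    using subgroup_filt[OF assms] by (simp add: normal_inv_iff)
qed

lemma carrier_gr_part: "carrier (gr_part G N s) = gr_coset G N s ` N s"
  by (simp add: gr_part_def carrier_FactGroup gr_coset_def)

lemma one_gr_part: "\<one>\<^bsub>gr_part G N s\<^esub> = N (Suc s)"
  by (simp add: gr_part_def)

lemma gr_coset_closed: "x \<in> N s \<Longrightarrow> gr_coset G N s x \<in> carrier (gr_part G N s)"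
  by (simp add: carrier_gr_part)

lemma gr_coset_eq_iff:
  assumes "x \<in> carrier G" "y \<in> carrier G"
  shows "gr_coset G N s x = gr_coset G N s y \<longleftrightarrow> x \<otimes> inv y \<in> N (Suc s)"
  unfolding gr_coset_def using normal_filt assms by (simp add: normal.rcos_eq_iff)

lemma gr_coset_eq_one_iff:
  assumes "x \<in> carrier G"
  shows "gr_coset G N s x = \<one>\<^bsub>gr_part G N s\<^esub> \<longleftrightarrow> x \<in> N (Suc s)"
  unfolding gr_coset_def one_gr_part using normal_filt assms by (simp add: normal.rcos_eq_H_iff)

lemma gr_coset_one: "gr_coset G N s \<one> = \<one>\<^bsub>gr_part G N s\<^esub>"
  using subgroup_filt[of "Suc s"] by (simp add: gr_coset_eq_one_iff subgroup.one_closed)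

lemma gr_coset_mult:
  assumes "x \<in> carrier G" "y \<in> carrier G"
  shows "gr_coset G N s x \<otimes>\<^bsub>gr_part G N s\<^esub> gr_coset G N s y = gr_coset G N s (x \<otimes> y)"
  unfolding gr_coset_def gr_part_def using normal_filt[of "Suc s"] assms
  by (simp add: normal.rcos_sum)

lemma gr_coset_mult_left:
  assumes "x \<in> N (Suc s)" "y \<in> carrier G"
  shows "gr_coset G N s (x \<otimes> y) = gr_coset G N s y"
  using assms filt_carrier[of "Suc s" x] by (simp add: gr_coset_eq_iff group_normalize)

lemma mem_gr_coset:
  assumes "x \<in> carrier G"
  shows "z \<in> gr_coset G N s x \<longleftrightarrow> z \<in> carrier G \<and> gr_coset G N s z = gr_coset G N s x"
  unfolding gr_coset_def using assms subgroup_filt[of "Suc s"]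
  by (metis One_nat_def le_add1 plus_1_eq_Suc rcos_self repr_independence r_coset_subset_G subgroup.subset subsetD)

lemma gr_coset_self: "x \<in> carrier G \<Longrightarrow> x \<in> gr_coset G N s x"
  by (simp add: mem_gr_coset)

lemma gr_coset_commute:
  assumes "s \<ge> 1" "x \<in> N s" "y \<in> carrier G"
  shows "gr_coset G N s (x \<otimes> y) = gr_coset G N s (y \<otimes> x)"
proof -
  have x: "x \<in> carrier G"
    using assms filt_carrier by blast
  have "x \<otimes> y \<otimes> inv (y \<otimes> x) = commutator G x y"
    using x assms by (simp add: commutator_def group_normalize)
  then show ?thesis
    using x assms filt_commutator[OF assms] by (simp add: gr_coset_eq_iff)
qed

lemma gr_coset_conj:
  assumes "s \<ge> 1" "x \<in> N s" "y \<in> carrier G"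
  shows "gr_coset G N s (y \<otimes> x \<otimes> inv y) = gr_coset G N s x"
proof -
  have x: "x \<in> carrier G"
    using assms filt_carrier by blast
  have "gr_coset G N s (y \<otimes> x \<otimes> inv y) = gr_coset G N s (x \<otimes> y \<otimes> inv y)"
    using x assms(3) gr_coset_commute[OF assms]
    by (simp only: m_closed inv_closed flip: gr_coset_mult)
  then show ?thesis
    using x assms(3) by (simp add: m_assoc)
qed

lemma comm_group_gr_part:
  assumes "s \<ge> 1"
  shows "comm_group (gr_part G N s)"
proof -
  interpret S: group "G\<lparr>carrier := N s\<rparr>"
    using subgroup_filt[OF assms] by (rule subgroup_imp_group)
  have "N (Suc s) \<lhd> G\<lparr>carrier := N s\<rparr>"
    using assms by (intro normal_restrict_supergroup subgroup_filt normal_filt filt_Suc_subset) auto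
  then interpret Q: group "gr_part G N s"
    unfolding gr_part_def by (rule normal.factorgroup_is_group)
  show ?thesis
  proof (rule Q.group_comm_groupI)
    fix X Y
    assume "X \<in> carrier (gr_part G N s)" "Y \<in> carrier (gr_part G N s)"
    then obtain x y where xy: "x \<in> N s" "y \<in> N s" "X = gr_coset G N s x" "Y = gr_coset G N s y"
      by (auto simp: carrier_gr_part)
    then have c: "x \<in> carrier G" "y \<in> carrier G"
      using assms filt_carrier by blast+
    then show "X \<otimes>\<^bsub>gr_part G N s\<^esub> Y = Y \<otimes>\<^bsub>gr_part G N s\<^esub> X"
      using xy gr_coset_commute[OF assms] by (simp add: gr_coset_mult)
  qed
qed

lemma group_gr_part: "s \<ge> 1 \<Longrightarrow> group (gr_part G N s)"
  using comm_group_gr_part comm_group.axioms(2) by blast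

section \<open>The associated graded group as a direct sum\<close>

lemma carrier_gr:
  "carrier (gr G N) = {X \<in> \<Pi>\<^sub>E n\<in>{1..}. carrier (gr_part G N n).
    finite {n \<in> {1..}. X n \<noteq> \<one>\<^bsub>gr_part G N n\<^esub>}}"
proof -
  have "carrier (sum_group {1..} (gr_part G N)) = {X \<in> \<Pi>\<^sub>E n\<in>{1..}. carrier (gr_part G N n).
      finite {n \<in> {1..}. X n \<noteq> \<one>\<^bsub>gr_part G N n\<^esub>}}"
    by (rule carrier_sum_group) (use group_gr_part in auto)
  then show ?thesis
    by (simp add: gr_def Let_def)
qed

lemma mult_gr: "X \<otimes>\<^bsub>gr G N\<^esub> Y = (\<lambda>n\<in>{1..}. X n \<otimes>\<^bsub>gr_part G N n\<^esub> Y n)"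
  by (simp add: gr_def Let_def)

lemma one_gr: "\<one>\<^bsub>gr G N\<^esub> = (\<lambda>n\<in>{1..}. \<one>\<^bsub>gr_part G N n\<^esub>)"
  by (simp add: gr_def Let_def)

lemma lbr_gr: "lbr (gr G N) = gr_pairing G N (commutator G)"
  by (simp add: gr_def Let_def)

lemma hcomp_gr:
  "hcomp (gr G N) s = {X \<in> carrier (gr G N). \<forall>t\<in>{1..}. t \<noteq> s \<longrightarrow> X t = \<one>\<^bsub>gr_part G N t\<^esub>}"
  by (simp add: gr_def Let_def)

lemma gr_component_closed:
  "\<lbrakk>X \<in> carrier (gr G N); n \<ge> 1\<rbrakk> \<Longrightarrow> X n \<in> carrier (gr_part G N n)"
  by (auto simp: carrier_gr)

lemma gr_component_cases:
  assumes "X \<in> carrier (gr G N)" "n \<ge> 1"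
  obtains x where "x \<in> N n" "X n = gr_coset G N n x"
  using gr_component_closed[OF assms] that by (auto simp: carrier_gr_part)

lemma gr_ext:
  assumes "X \<in> carrier (gr G N)" "Y \<in> carrier (gr G N)" "\<And>n. n \<ge> 1 \<Longrightarrow> X n = Y n"
  shows "X = Y"
proof
  fix n
  show "X n = Y n"
    using assms by (cases "n \<ge> 1") (auto simp: carrier_gr PiE_def extensional_def)
qed

lemma comm_group_gr: "comm_group (gr G N)"
proof -
  let ?S = "sum_group {1..} (gr_part G N)"
  interpret S: group ?S
    by (rule sum_group) (use group_gr_part in auto)
  have eq: "carrier (gr G N) = carrier ?S" "monoid.mult (gr G N) = monoid.mult ?S"
    "\<one>\<^bsub>gr G N\<^esub> = \<one>\<^bsub>?S\<^esub>"
    by (simp_all add: gr_def Let_def)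
  show ?thesis
  proof (rule comm_groupI)
    fix X Y
    assume X: "X \<in> carrier (gr G N)" and Y: "Y \<in> carrier (gr G N)"
    have "X n \<otimes>\<^bsub>gr_part G N n\<^esub> Y n = Y n \<otimes>\<^bsub>gr_part G N n\<^esub> X n" if "n \<ge> 1" for n
      using gr_component_closed[OF X that] gr_component_closed[OF Y that] comm_group_gr_part[OF that]
      by (simp add: comm_groupE(4))
    then show "X \<otimes>\<^bsub>gr G N\<^esub> Y = Y \<otimes>\<^bsub>gr G N\<^esub> X"
      unfolding mult_gr by (intro restrict_ext) simp
  next
    fix X
    assume "X \<in> carrier (gr G N)"
    then show "\<exists>Y\<in>carrier (gr G N). Y \<otimes>\<^bsub>gr G N\<^esub> X = \<one>\<^bsub>gr G N\<^esub>"
      unfolding eq using S.l_inv_ex by blast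
  qed (use S.m_closed S.one_closed S.m_assoc S.l_one in \<open>simp_all only: eq\<close>)
qed

lemma gr_elem_apply: "s \<ge> 1 \<Longrightarrow> gr_elem G N s x s = gr_coset G N s x"
  by (simp add: gr_elem_def)

lemma gr_elem_closed:
  assumes "s \<ge> 1" "x \<in> N s"
  shows "gr_elem G N s x \<in> carrier (gr G N)"
proof -
  have "{n \<in> {1..}. gr_elem G N s x n \<noteq> \<one>\<^bsub>gr_part G N n\<^esub>} \<subseteq> {s}"
    by (auto simp: gr_elem_def)
  then have "finite {n \<in> {1..}. gr_elem G N s x n \<noteq> \<one>\<^bsub>gr_part G N n\<^esub>}"
    by (rule finite_subset) simp
  moreover have "gr_elem G N s x \<in> (\<Pi>\<^sub>E n\<in>{1..}. carrier (gr_part G N n))"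
    using assms group.is_monoid[OF group_gr_part] gr_coset_closed
    by (auto simp: gr_elem_def intro: monoid.one_closed)
  ultimately show ?thesis
    by (simp add: carrier_gr)
qed

text \<open>Reduces statements about one degree of the direct sum to statements about elements of
  the filtered group.\<close>

lemma hcomp_gr_eq:
  assumes "s \<ge> 1"
  shows "hcomp (gr G N) s = gr_elem G N s ` N s"
proof (intro equalityI subsetI)
  fix X
  assume X: "X \<in> hcomp (gr G N) s"
  then have Xc: "X \<in> carrier (gr G N)"
    by (simp add: hcomp_gr)
  then obtain x where x: "x \<in> N s" "X s = gr_coset G N s x"
    using assms by (rule gr_component_cases)
  have "X = gr_elem G N s x"
    by (rule gr_ext) (use X Xc x assms gr_elem_closed in \<open>auto simp: hcomp_gr gr_elem_def\<close>)
  then show "X \<in> gr_elem G N s ` N s"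
    using x by blast
next
  fix X
  assume "X \<in> gr_elem G N s ` N s"
  then show "X \<in> hcomp (gr G N) s"
    using assms gr_elem_closed by (auto simp: hcomp_gr) (auto simp: gr_elem_def)
qed

lemma gr_elem_eq_iff:
  assumes "s \<ge> 1" "x \<in> carrier G" "y \<in> carrier G"
  shows "gr_elem G N s x = gr_elem G N s y \<longleftrightarrow> x \<otimes> inv y \<in> N (Suc s)"
proof
  assume "gr_elem G N s x = gr_elem G N s y"
  then show "x \<otimes> inv y \<in> N (Suc s)"
    using assms by (metis gr_elem_apply gr_coset_eq_iff)
next
  assume "x \<otimes> inv y \<in> N (Suc s)"
  then have "gr_coset G N s x = gr_coset G N s y"
    using assms by (simp add: gr_coset_eq_iff)
  then show "gr_elem G N s x = gr_elem G N s y"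
    unfolding gr_elem_def by (simp cong: if_cong)
qed

lemma gr_elem_eq_one_iff:
  assumes "s \<ge> 1" "x \<in> carrier G"
  shows "gr_elem G N s x = \<one>\<^bsub>gr G N\<^esub> \<longleftrightarrow> x \<in> N (Suc s)"
proof
  assume "gr_elem G N s x = \<one>\<^bsub>gr G N\<^esub>"
  then have "gr_elem G N s x s = \<one>\<^bsub>gr G N\<^esub> s"
    by simp
  then show "x \<in> N (Suc s)"
    using assms by (simp add: gr_elem_apply one_gr gr_coset_eq_one_iff)
next
  assume "x \<in> N (Suc s)"
  then show "gr_elem G N s x = \<one>\<^bsub>gr G N\<^esub>"
    using assms gr_coset_eq_one_iff[of x s] unfolding gr_elem_def one_gr
    by (intro restrict_ext) simp
qed

lemma gr_elem_mult:
  assumes "x \<in> carrier G" "y \<in> carrier G"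
  shows "gr_elem G N s x \<otimes>\<^bsub>gr G N\<^esub> gr_elem G N s y = gr_elem G N s (x \<otimes> y)"
proof
  fix n
  show "(gr_elem G N s x \<otimes>\<^bsub>gr G N\<^esub> gr_elem G N s y) n = gr_elem G N s (x \<otimes> y) n"
    using assms group.is_monoid[OF group_gr_part]
    by (auto simp: gr_elem_def mult_gr gr_coset_mult intro: monoid.l_one monoid.one_closed)
qed

end

lemma (in group) central_filtration_lcs: "central_filtration G (lcs G)"
proof unfold_locales
  show "lcs G (Suc s) \<subseteq> lcs G s" for s
    by (rule lcs_Suc_subset)
qed (simp_all add: lcs_commutator subgroup.subset[OF lcs_subgroup] subgroup.m_closed[OF lcs_subgroup]
    subgroup.one_closed[OF lcs_subgroup] subgroup.m_inv_closed[OF lcs_subgroup])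

subsection \<open>Maps of graded groups induced by homomorphisms\<close>

locale filtration_hom = K: central_filtration K M + H: central_filtration H N + group_hom K H h
  for K (structure) and M and H (structure) and N and h +
  assumes filt_image: "\<lbrakk>s \<ge> 1; x \<in> M s\<rbrakk> \<Longrightarrow> h x \<in> N s"
begin

text \<open>Two representatives in degree \<open>n\<close> differ by an element of the next step,
  which \<open>h\<close> sends into the next step of the target; so \<open>the_elem\<close> is taken
  of a singleton.\<close>

lemma gr_map_apply:
  assumes n: "n \<ge> 1" and x: "x \<in> M n" "X n = gr_coset K M n x"
  shows "gr_map H N h X n = gr_coset H N n (h x)"
proof -
  have "the_elem ((\<lambda>x. N (Suc n) #>\<^bsub>H\<^esub> h x) ` X n) = gr_coset H N n (h x)"
  proof (rule the_elem_image_unique)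
    have xc: "x \<in> carrier K"
      using n x by (simp add: K.filt_carrier)
    then show "X n \<noteq> {}"
      using K.gr_coset_self[of x n] x by auto
    fix z
    assume "z \<in> X n"
    then have z: "z \<in> carrier K" "z \<otimes>\<^bsub>K\<^esub> inv\<^bsub>K\<^esub> x \<in> M (Suc n)"
      using x xc K.mem_gr_coset[of x z n] K.gr_coset_eq_iff[of z x n] by auto
    then have "h (z \<otimes>\<^bsub>K\<^esub> inv\<^bsub>K\<^esub> x) \<in> N (Suc n)"
      using filt_image by simp
    then have "h z \<otimes>\<^bsub>H\<^esub> inv\<^bsub>H\<^esub> h x \<in> N (Suc n)"
      using z xc by simp
    then show "N (Suc n) #>\<^bsub>H\<^esub> h z = gr_coset H N n (h x)"
      using z xc by (simp add: H.gr_coset_eq_iff flip: gr_coset_def)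
  qed
  then show ?thesis
    using n by (simp add: gr_map_def)
qed

lemma gr_map_one_apply:
  assumes "n \<ge> 1" "X n = \<one>\<^bsub>gr_part K M n\<^esub>"
  shows "gr_map H N h X n = \<one>\<^bsub>gr_part H N n\<^esub>"
proof -
  have "X n = gr_coset K M n \<one>\<^bsub>K\<^esub>" "\<one>\<^bsub>K\<^esub> \<in> M n"
    using assms by (simp_all add: K.gr_coset_one K.subgroup_filt subgroup.one_closed)
  then show ?thesis
    using assms(1) gr_map_apply[of n "\<one>\<^bsub>K\<^esub>" X] by (simp add: H.gr_coset_one)
qed

lemma gr_map_closed:
  assumes X: "X \<in> carrier (gr K M)"
  shows "gr_map H N h X \<in> carrier (gr H N)"
proof -
  have "gr_map H N h X n \<in> carrier (gr_part H N n)" if n: "n \<ge> 1" for n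
  proof -
    obtain x where "x \<in> M n" "X n = gr_coset K M n x"
      using X n by (rule K.gr_component_cases)
    then show ?thesis
      using n gr_map_apply filt_image H.gr_coset_closed by simp
  qed
  moreover have "{n \<in> {1..}. gr_map H N h X n \<noteq> \<one>\<^bsub>gr_part H N n\<^esub>} \<subseteq>
      {n \<in> {1..}. X n \<noteq> \<one>\<^bsub>gr_part K M n\<^esub>}"
    using gr_map_one_apply by auto
  then have "finite {n \<in> {1..}. gr_map H N h X n \<noteq> \<one>\<^bsub>gr_part H N n\<^esub>}"
    using X finite_subset by (auto simp: K.carrier_gr)
  ultimately show ?thesis
    by (auto simp: H.carrier_gr gr_map_def)
qed

lemma gr_map_gr_elem:
  assumes "s \<ge> 1" "x \<in> M s"
  shows "gr_map H N h (gr_elem K M s x) = gr_elem H N s (h x)"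
proof (rule H.gr_ext)
  fix n :: nat
  assume n: "n \<ge> 1"
  show "gr_map H N h (gr_elem K M s x) n = gr_elem H N s (h x) n"
  proof (cases "n = s")
    case True
    then show ?thesis
      using assms gr_map_apply[of s x] by (simp add: gr_elem_def)
  next
    case False
    then show ?thesis
      using n gr_map_one_apply[of n] by (simp add: gr_elem_def)
  qed
qed (use assms filt_image K.gr_elem_closed H.gr_elem_closed gr_map_closed in auto)

end

subsection \<open>Pairings\<close>

text \<open>One summand of \<open>gr_pairing\<close>, isolated so that additivity can be stated for
  one pair of degrees. The parameter is the total degree, which all summands of a component
  share.\<close>

definition part_pairing ::
  "('a, 'm) monoid_scheme \<Rightarrow> (nat \<Rightarrow> 'a set) \<Rightarrow> ('b \<Rightarrow> 'c \<Rightarrow> 'a) \<Rightarrow> nat \<Rightarrow> 'b set \<Rightarrow> 'c set \<Rightarrow> 'a set"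
  where "part_pairing G N c n A X = the_elem ((\<lambda>(a, x). N (Suc n) #>\<^bsub>G\<^esub> c a x) ` (A \<times> X))"

text \<open>Additivity is demanded modulo the next filtration step only, since neither commutators
  nor displacements are additive on the nose. The instances are \<open>commutator\<close> on
  \<open>G\<close>, which gives the bracket, and \<open>displacement\<close> from the Torelli group
  and \<open>G\<close>, which gives the Johnson homomorphism.\<close>

locale graded_pairing = K: central_filtration K M + G: central_filtration G N
  for K (structure) and M and G (structure) and N +
  fixes c :: "'b \<Rightarrow> 'a \<Rightarrow> 'a"
  assumes c_closed: "\<lbrakk>s \<ge> 1; t \<ge> 1; a \<in> M s; x \<in> N t\<rbrakk> \<Longrightarrow> c a x \<in> N (s + t)"
    and c_mult_left: "\<lbrakk>s \<ge> 1; t \<ge> 1; a \<in> M s; b \<in> M s; x \<in> N t\<rbrakk> \<Longrightarrow>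
      gr_coset G N (s + t) (c (a \<otimes>\<^bsub>K\<^esub> b) x) = gr_coset G N (s + t) (c a x \<otimes>\<^bsub>G\<^esub> c b x)"
    and c_mult_right: "\<lbrakk>s \<ge> 1; t \<ge> 1; a \<in> M s; x \<in> N t; y \<in> N t\<rbrakk> \<Longrightarrow>
      gr_coset G N (s + t) (c a (x \<otimes>\<^bsub>G\<^esub> y)) = gr_coset G N (s + t) (c a x \<otimes>\<^bsub>G\<^esub> c a y)"
begin

abbreviation "p \<equiv> part_pairing G N c"

lemma c_carrier: "\<lbrakk>s \<ge> 1; t \<ge> 1; a \<in> M s; x \<in> N t\<rbrakk> \<Longrightarrow> c a x \<in> carrier G"
  using c_closed[of s t a x] G.filt_carrier[of "s + t"] by simp

lemma part_pairing_gr_coset: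
  assumes st: "s \<ge> 1" "t \<ge> 1" and a: "a \<in> M s" and x: "x \<in> N t"
  shows "p (s + t) (gr_coset K M s a) (gr_coset G N t x) = gr_coset G N (s + t) (c a x)"
  unfolding part_pairing_def
proof (rule the_elem_image_unique)
  have ac: "a \<in> carrier K" and xc: "x \<in> carrier G"
    using st a x K.filt_carrier G.filt_carrier by blast+
  show "gr_coset K M s a \<times> gr_coset G N t x \<noteq> {}"
    using ac xc K.gr_coset_self G.gr_coset_self by blast
  fix z
  assume "z \<in> gr_coset K M s a \<times> gr_coset G N t x"
  then obtain b y where z: "z = (b, y)" "b \<in> gr_coset K M s a" "y \<in> gr_coset G N t x"
    by blast
  \<comment> \<open>The other representatives are \<open>u a\<close> and \<open>v x\<close> with
    \<open>u\<close> and \<open>v\<close> one step deeper. Changing one argument at a time,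
    additivity splits off the values on \<open>(u, y)\<close> and \<open>(a, v)\<close>; they have
    total degree \<open>s + t + 1\<close> and vanish in the target.\<close>
  define u where "u = b \<otimes>\<^bsub>K\<^esub> inv\<^bsub>K\<^esub> a"
  define v where "v = y \<otimes>\<^bsub>G\<^esub> inv\<^bsub>G\<^esub> x"
  have bc: "b \<in> carrier K" and yc: "y \<in> carrier G"
    and u: "u \<in> M (Suc s)" and v: "v \<in> N (Suc t)"
    using z ac xc K.mem_gr_coset[of a b s] K.gr_coset_eq_iff[of b a s]
      G.mem_gr_coset[of x y t] G.gr_coset_eq_iff[of y x t] by (auto simp: u_def v_def)
  have us: "u \<in> M s" and vt: "v \<in> N t"
    using u v st K.filt_Suc_subset G.filt_Suc_subset by blast+
  have b: "b = u \<otimes>\<^bsub>K\<^esub> a" and y: "y = v \<otimes>\<^bsub>G\<^esub> x"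
    using ac xc bc yc by (simp_all add: u_def v_def K.m_assoc G.m_assoc)
  have yt: "y \<in> N t"
    unfolding y using vt x G.subgroup_filt[OF st(2)] by (simp add: subgroup.m_closed)
  have "c u y \<in> N (Suc (s + t))"
    using c_closed[OF _ st(2) u yt] by simp
  moreover have "c a v \<in> N (Suc (s + t))"
    using c_closed[OF st(1) _ a v] by simp
  ultimately have "gr_coset G N (s + t) (c u y \<otimes>\<^bsub>G\<^esub> c a y) = gr_coset G N (s + t) (c a y)"
    "gr_coset G N (s + t) (c a v \<otimes>\<^bsub>G\<^esub> c a x) = gr_coset G N (s + t) (c a x)"
    using c_carrier[OF st a yt] c_carrier[OF st a x] G.gr_coset_mult_left by blast+
  moreover have "gr_coset G N (s + t) (c b y) = gr_coset G N (s + t) (c u y \<otimes>\<^bsub>G\<^esub> c a y)"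
    unfolding b by (rule c_mult_left[OF st us a yt])
  moreover have "gr_coset G N (s + t) (c a y) = gr_coset G N (s + t) (c a v \<otimes>\<^bsub>G\<^esub> c a x)"
    unfolding y by (rule c_mult_right[OF st a vt x])
  ultimately show "(case z of (a, x) \<Rightarrow> N (Suc (s + t)) #>\<^bsub>G\<^esub> c a x) = gr_coset G N (s + t) (c a x)"
    by (simp add: z(1) flip: gr_coset_def)
qed

lemma part_pairing_hom_right:
  assumes st: "s \<ge> 1" "t \<ge> 1" and A: "A \<in> carrier (gr_part K M s)"
  shows "p (s + t) A \<in> hom (gr_part G N t) (gr_part G N (s + t))"
proof -
  obtain a where a: "a \<in> M s" "A = gr_coset K M s a"
    using A by (auto simp: K.carrier_gr_part)
  have "p (s + t) A (gr_coset G N t x) = gr_coset G N (s + t) (c a x)" if "x \<in> N t" for x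
    using st a that part_pairing_gr_coset by simp
  moreover have "gr_coset G N (s + t) (c a x) \<in> carrier (gr_part G N (s + t))" if "x \<in> N t" for x
    using c_closed[OF st a(1) that] by (rule G.gr_coset_closed)
  moreover have "gr_coset G N t x \<otimes>\<^bsub>gr_part G N t\<^esub> gr_coset G N t y = gr_coset G N t (x \<otimes>\<^bsub>G\<^esub> y)"
      "x \<otimes>\<^bsub>G\<^esub> y \<in> N t"
      "gr_coset G N (s + t) (c a x) \<otimes>\<^bsub>gr_part G N (s + t)\<^esub> gr_coset G N (s + t) (c a y)
        = gr_coset G N (s + t) (c a (x \<otimes>\<^bsub>G\<^esub> y))"
    if "x \<in> N t" "y \<in> N t" for x y
    using that st G.filt_carrier G.subgroup_filt[OF st(2)] c_mult_right[OF st a(1) that]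
      c_carrier[OF st a(1)]
    by (auto simp: G.gr_coset_mult intro: subgroup.m_closed)
  ultimately show ?thesis
    by (auto simp: hom_def G.carrier_gr_part)
qed

lemma part_pairing_hom_left:
  assumes st: "s \<ge> 1" "t \<ge> 1" and X: "X \<in> carrier (gr_part G N t)"
  shows "(\<lambda>A. p (s + t) A X) \<in> hom (gr_part K M s) (gr_part G N (s + t))"
proof -
  obtain x where x: "x \<in> N t" "X = gr_coset G N t x"
    using X by (auto simp: G.carrier_gr_part)
  have "p (s + t) (gr_coset K M s a) X = gr_coset G N (s + t) (c a x)" if "a \<in> M s" for a
    using st x that part_pairing_gr_coset by simp
  moreover have "gr_coset G N (s + t) (c a x) \<in> carrier (gr_part G N (s + t))" if "a \<in> M s" for a
    using c_closed[OF st that x(1)] by (rule G.gr_coset_closed)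
  moreover have "gr_coset K M s a \<otimes>\<^bsub>gr_part K M s\<^esub> gr_coset K M s b = gr_coset K M s (a \<otimes>\<^bsub>K\<^esub> b)"
      "a \<otimes>\<^bsub>K\<^esub> b \<in> M s"
      "gr_coset G N (s + t) (c a x) \<otimes>\<^bsub>gr_part G N (s + t)\<^esub> gr_coset G N (s + t) (c b x)
        = gr_coset G N (s + t) (c (a \<otimes>\<^bsub>K\<^esub> b) x)"
    if "a \<in> M s" "b \<in> M s" for a b
    using that st K.filt_carrier K.subgroup_filt[OF st(1)] c_mult_left[OF st that x(1)]
      c_carrier[OF st _ x(1)]
    by (auto simp: K.gr_coset_mult G.gr_coset_mult intro: subgroup.m_closed)
  ultimately show ?thesis
    by (auto simp: hom_def K.carrier_gr_part)
qed

lemma part_pairing_closed: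
  assumes "1 \<le> s" "s < n" "A \<in> carrier (gr_part K M s)" "X \<in> carrier (gr_part G N (n - s))"
  shows "p n A X \<in> carrier (gr_part G N n)"
  using hom_in_carrier[OF part_pairing_hom_right[of s "n - s" A]] assms by simp

lemma part_pairing_one_left:
  assumes "1 \<le> s" "s < n" "X \<in> carrier (gr_part G N (n - s))"
  shows "p n \<one>\<^bsub>gr_part K M s\<^esub> X = \<one>\<^bsub>gr_part G N n\<^esub>"
  using hom_one[OF part_pairing_hom_left[of s "n - s" X] K.group_gr_part G.group_gr_part] assms
  by simp

lemma part_pairing_one_right:
  assumes "1 \<le> s" "s < n" "A \<in> carrier (gr_part K M s)"
  shows "p n A \<one>\<^bsub>gr_part G N (n - s)\<^esub> = \<one>\<^bsub>gr_part G N n\<^esub>"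
  using hom_one[OF part_pairing_hom_right[of s "n - s" A] G.group_gr_part G.group_gr_part] assms
  by simp

lemma part_pairing_mult_left:
  assumes "1 \<le> s" "s < n" "A \<in> carrier (gr_part K M s)" "B \<in> carrier (gr_part K M s)"
    "X \<in> carrier (gr_part G N (n - s))"
  shows "p n (A \<otimes>\<^bsub>gr_part K M s\<^esub> B) X = p n A X \<otimes>\<^bsub>gr_part G N n\<^esub> p n B X"
  using hom_mult[OF part_pairing_hom_left[of s "n - s" X]] assms by simp

lemma part_pairing_mult_right:
  assumes "1 \<le> s" "s < n" "A \<in> carrier (gr_part K M s)"
    "X \<in> carrier (gr_part G N (n - s))" "Y \<in> carrier (gr_part G N (n - s))"
  shows "p n A (X \<otimes>\<^bsub>gr_part G N (n - s)\<^esub> Y) = p n A X \<otimes>\<^bsub>gr_part G N n\<^esub> p n A Y"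
  using hom_mult[OF part_pairing_hom_right[of s "n - s" A]] assms by simp

lemma gr_pairing_apply:
  "n \<ge> 1 \<Longrightarrow> gr_pairing G N c A X n = finprod (gr_part G N n) (\<lambda>s. p n (A s) (X (n - s))) {1..<n}"
  by (simp add: gr_pairing_def part_pairing_def)

lemma gr_pairing_term_closed:
  assumes "A \<in> carrier (gr K M)" "X \<in> carrier (gr G N)" "s \<in> {1..<n}"
  shows "p n (A s) (X (n - s)) \<in> carrier (gr_part G N n)"
proof -
  have "n - s \<ge> 1"
    using assms(3) by auto
  then show ?thesis
    using assms(3) part_pairing_closed[of s n "A s" "X (n - s)"]
      K.gr_component_closed[OF assms(1), of s] G.gr_component_closed[OF assms(2), of "n - s"] by simp
qed

lemma gr_pairing_closed:
  assumes A: "A \<in> carrier (gr K M)" and X: "X \<in> carrier (gr G N)"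
  shows "gr_pairing G N c A X \<in> carrier (gr G N)"
proof -
  have "gr_pairing G N c A X n \<in> carrier (gr_part G N n)" if n: "n \<ge> 1" for n
  proof -
    interpret P: comm_group "gr_part G N n"
      using n by (rule G.comm_group_gr_part)
    show ?thesis
      unfolding gr_pairing_apply[OF n]
      using gr_pairing_term_closed[OF A X] by (intro P.finprod_closed) blast
  qed
  \<comment> \<open>A nontrivial component needs a nontrivial summand, hence degrees
    \<open>s\<close> and \<open>t\<close> with sum \<open>n\<close> at which both factors are
    nontrivial. So the support lies in the sumset of two finite sets.\<close>
  moreover have "{n \<in> {1..}. gr_pairing G N c A X n \<noteq> \<one>\<^bsub>gr_part G N n\<^esub>} \<subseteq>
    (\<lambda>(s, t). s + t) ` ({s \<in> {1..}. A s \<noteq> \<one>\<^bsub>gr_part K M s\<^esub>} \<times> {t \<in> {1..}. X t \<noteq> \<one>\<^bsub>gr_part G N t\<^esub>})"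
  proof (rule subsetI, rule ccontr)
    fix n
    assume "n \<in> {n \<in> {1..}. gr_pairing G N c A X n \<noteq> \<one>\<^bsub>gr_part G N n\<^esub>}"
    then have n: "n \<ge> 1" and ne: "gr_pairing G N c A X n \<noteq> \<one>\<^bsub>gr_part G N n\<^esub>"
      by auto
    assume notin: "n \<notin> (\<lambda>(s, t). s + t) `
      ({s \<in> {1..}. A s \<noteq> \<one>\<^bsub>gr_part K M s\<^esub>} \<times> {t \<in> {1..}. X t \<noteq> \<one>\<^bsub>gr_part G N t\<^esub>})"
    interpret P: comm_group "gr_part G N n"
      using n by (rule G.comm_group_gr_part)
    have "p n (A s) (X (n - s)) = \<one>\<^bsub>gr_part G N n\<^esub>" if s: "s \<in> {1..<n}" for s
    proof -
      have "A s = \<one>\<^bsub>gr_part K M s\<^esub> \<or> X (n - s) = \<one>\<^bsub>gr_part G N (n - s)\<^esub>"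
      proof (rule ccontr)
        assume "\<not> ?thesis"
        then have "n \<in> (\<lambda>(s, t). s + t) `
            ({s \<in> {1..}. A s \<noteq> \<one>\<^bsub>gr_part K M s\<^esub>} \<times> {t \<in> {1..}. X t \<noteq> \<one>\<^bsub>gr_part G N t\<^esub>})"
          using s by (intro image_eqI[of _ _ "(s, n - s)"]) auto
        with notin show False
          by contradiction
      qed
      then show ?thesis
        using s part_pairing_one_left[of s n "X (n - s)"] part_pairing_one_right[of s n "A s"]
          K.gr_component_closed[OF A, of s] G.gr_component_closed[OF X, of "n - s"] by auto
    qed
    then have "gr_pairing G N c A X n = \<one>\<^bsub>gr_part G N n\<^esub>"
      unfolding gr_pairing_apply[OF n] by (rule P.finprod_one_eqI)
    with ne show False
      by simp
  qed
  then have "finite {n \<in> {1..}. gr_pairing G N c A X n \<noteq> \<one>\<^bsub>gr_part G N n\<^esub>}"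
    by (rule finite_subset) (use A X in \<open>simp add: K.carrier_gr G.carrier_gr\<close>)
  ultimately show ?thesis
    by (auto simp: G.carrier_gr gr_pairing_def)
qed

lemma gr_pairing_mult_left:
  assumes A: "A \<in> carrier (gr K M)" and B: "B \<in> carrier (gr K M)" and X: "X \<in> carrier (gr G N)"
  shows "gr_pairing G N c (A \<otimes>\<^bsub>gr K M\<^esub> B) X =
    gr_pairing G N c A X \<otimes>\<^bsub>gr G N\<^esub> gr_pairing G N c B X"
proof (rule G.gr_ext)
  interpret gK: comm_group "gr K M"
    by (rule K.comm_group_gr)
  interpret gG: comm_group "gr G N"
    by (rule G.comm_group_gr)
  show "gr_pairing G N c (A \<otimes>\<^bsub>gr K M\<^esub> B) X \<in> carrier (gr G N)"
    "gr_pairing G N c A X \<otimes>\<^bsub>gr G N\<^esub> gr_pairing G N c B X \<in> carrier (gr G N)"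
    using A B X gr_pairing_closed by auto
  fix n :: nat
  assume n: "n \<ge> 1"
  interpret P: comm_group "gr_part G N n"
    using n by (rule G.comm_group_gr_part)
  have "gr_pairing G N c (A \<otimes>\<^bsub>gr K M\<^esub> B) X n = finprod (gr_part G N n)
      (\<lambda>s. p n (A s) (X (n - s)) \<otimes>\<^bsub>gr_part G N n\<^esub> p n (B s) (X (n - s))) {1..<n}"
    unfolding gr_pairing_apply[OF n]
  proof (rule P.finprod_cong'[OF refl])
    fix s
    assume s: "s \<in> {1..<n}"
    then have "n - s \<ge> 1"
      by auto
    with s show "p n ((A \<otimes>\<^bsub>gr K M\<^esub> B) s) (X (n - s)) =
        p n (A s) (X (n - s)) \<otimes>\<^bsub>gr_part G N n\<^esub> p n (B s) (X (n - s))"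
      using part_pairing_mult_left[of s n "A s" "B s" "X (n - s)"]
        K.gr_component_closed[OF A, of s] K.gr_component_closed[OF B, of s]
        G.gr_component_closed[OF X, of "n - s"]
      by (simp add: K.mult_gr)
  qed (use gr_pairing_term_closed[OF A X] gr_pairing_term_closed[OF B X] in blast)
  also have "\<dots> = (gr_pairing G N c A X \<otimes>\<^bsub>gr G N\<^esub> gr_pairing G N c B X) n"
    using n gr_pairing_term_closed[OF A X] gr_pairing_term_closed[OF B X]
    by (subst P.finprod_multf) (auto simp: G.mult_gr gr_pairing_apply)
  finally show "gr_pairing G N c (A \<otimes>\<^bsub>gr K M\<^esub> B) X n =
      (gr_pairing G N c A X \<otimes>\<^bsub>gr G N\<^esub> gr_pairing G N c B X) n" .
qed

lemma gr_pairing_mult_right: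
  assumes A: "A \<in> carrier (gr K M)" and X: "X \<in> carrier (gr G N)" and Y: "Y \<in> carrier (gr G N)"
  shows "gr_pairing G N c A (X \<otimes>\<^bsub>gr G N\<^esub> Y) =
    gr_pairing G N c A X \<otimes>\<^bsub>gr G N\<^esub> gr_pairing G N c A Y"
proof (rule G.gr_ext)
  interpret gG: comm_group "gr G N"
    by (rule G.comm_group_gr)
  show "gr_pairing G N c A (X \<otimes>\<^bsub>gr G N\<^esub> Y) \<in> carrier (gr G N)"
    "gr_pairing G N c A X \<otimes>\<^bsub>gr G N\<^esub> gr_pairing G N c A Y \<in> carrier (gr G N)"
    using A X Y gr_pairing_closed by auto
  fix n :: nat
  assume n: "n \<ge> 1"
  interpret P: comm_group "gr_part G N n"
    using n by (rule G.comm_group_gr_part)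
  have "gr_pairing G N c A (X \<otimes>\<^bsub>gr G N\<^esub> Y) n = finprod (gr_part G N n)
      (\<lambda>s. p n (A s) (X (n - s)) \<otimes>\<^bsub>gr_part G N n\<^esub> p n (A s) (Y (n - s))) {1..<n}"
    unfolding gr_pairing_apply[OF n]
  proof (rule P.finprod_cong'[OF refl])
    fix s
    assume s: "s \<in> {1..<n}"
    then have "n - s \<ge> 1"
      by auto
    with s show "p n (A s) ((X \<otimes>\<^bsub>gr G N\<^esub> Y) (n - s)) =
        p n (A s) (X (n - s)) \<otimes>\<^bsub>gr_part G N n\<^esub> p n (A s) (Y (n - s))"
      using part_pairing_mult_right[of s n "A s" "X (n - s)" "Y (n - s)"]
        K.gr_component_closed[OF A, of s]
        G.gr_component_closed[OF X, of "n - s"] G.gr_component_closed[OF Y, of "n - s"]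
      by (simp add: G.mult_gr)
  qed (use gr_pairing_term_closed[OF A X] gr_pairing_term_closed[OF A Y] in blast)
  also have "\<dots> = (gr_pairing G N c A X \<otimes>\<^bsub>gr G N\<^esub> gr_pairing G N c A Y) n"
    using n gr_pairing_term_closed[OF A X] gr_pairing_term_closed[OF A Y]
    by (subst P.finprod_multf) (auto simp: G.mult_gr gr_pairing_apply)
  finally show "gr_pairing G N c A (X \<otimes>\<^bsub>gr G N\<^esub> Y) n =
      (gr_pairing G N c A X \<otimes>\<^bsub>gr G N\<^esub> gr_pairing G N c A Y) n" .
qed

lemma gr_pairing_single_term:
  assumes A: "A \<in> carrier (gr K M)" and X: "X \<in> carrier (gr G N)" and s: "1 \<le> s" "s < n"
    and other: "\<And>k. \<lbrakk>1 \<le> k; k < n; k \<noteq> s\<rbrakk> \<Longrightarrow>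
      A k = \<one>\<^bsub>gr_part K M k\<^esub> \<or> X (n - k) = \<one>\<^bsub>gr_part G N (n - k)\<^esub>"
  shows "gr_pairing G N c A X n = p n (A s) (X (n - s))"
proof -
  have n: "n \<ge> 1"
    using s by simp
  interpret P: comm_group "gr_part G N n"
    using n by (rule G.comm_group_gr_part)
  have "gr_pairing G N c A X n = finprod (gr_part G N n)
      (\<lambda>k. if k = s then p n (A k) (X (n - k)) else \<one>\<^bsub>gr_part G N n\<^esub>) {1..<n}"
    unfolding gr_pairing_apply[OF n]
  proof (rule P.finprod_cong'[OF refl])
    fix k
    assume k: "k \<in> {1..<n}"
    show "p n (A k) (X (n - k)) =
        (if k = s then p n (A k) (X (n - k)) else \<one>\<^bsub>gr_part G N n\<^esub>)"
      using k other[of k] part_pairing_one_left[of k n "X (n - k)"] part_pairing_one_right[of k n "A k"]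
          K.gr_component_closed[OF A, of k] G.gr_component_closed[OF X, of "n - k"] by auto
  qed (use gr_pairing_term_closed[OF A X] in auto)
  also have "\<dots> = p n (A s) (X (n - s))"
    using s gr_pairing_term_closed[OF A X] by (intro P.finprod_singleton_swap) auto
  finally show ?thesis .
qed

lemma gr_pairing_eq_one:
  assumes A: "A \<in> carrier (gr K M)" and X: "X \<in> carrier (gr G N)" and n: "n \<ge> 1"
    and other: "\<And>k. \<lbrakk>1 \<le> k; k < n\<rbrakk> \<Longrightarrow>
      A k = \<one>\<^bsub>gr_part K M k\<^esub> \<or> X (n - k) = \<one>\<^bsub>gr_part G N (n - k)\<^esub>"
  shows "gr_pairing G N c A X n = \<one>\<^bsub>gr_part G N n\<^esub>"
proof -
  interpret P: comm_group "gr_part G N n"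
    using n by (rule G.comm_group_gr_part)
  show ?thesis
    unfolding gr_pairing_apply[OF n]
  proof (rule P.finprod_one_eqI)
    fix k
    assume k: "k \<in> {1..<n}"
    then show "p n (A k) (X (n - k)) = \<one>\<^bsub>gr_part G N n\<^esub>"
      using other[of k] part_pairing_one_left[of k n "X (n - k)"] part_pairing_one_right[of k n "A k"]
          K.gr_component_closed[OF A, of k] G.gr_component_closed[OF X, of "n - k"] by auto
  qed
qed

lemma gr_pairing_homogeneous_left:
  assumes A: "A \<in> hcomp (gr K M) s" and X: "X \<in> carrier (gr G N)" and "s \<ge> 1" "n \<ge> 1"
  shows "gr_pairing G N c A X n = (if s < n then p n (A s) (X (n - s)) else \<one>\<^bsub>gr_part G N n\<^esub>)"
  using assms gr_pairing_single_term[of A X s n] gr_pairing_eq_one[of A X n]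
  by (auto simp: K.hcomp_gr)

text \<open>Pairing with a class of degree \<open>t\<close> isolates \<open>A s\<close> in degree
  \<open>s + t\<close>, so the components of an inhomogeneous \<open>A\<close> can be tested
  separately.\<close>

lemma gr_pairing_gr_elem_right:
  assumes A: "A \<in> carrier (gr K M)" and st: "s \<ge> 1" "t \<ge> 1" and x: "x \<in> N t"
    and a: "a \<in> M s" "A s = gr_coset K M s a"
  shows "gr_pairing G N c A (gr_elem G N t x) (s + t) = gr_coset G N (s + t) (c a x)"
proof -
  have "gr_pairing G N c A (gr_elem G N t x) (s + t) = p (s + t) (A s) (gr_elem G N t x (s + t - s))"
    using st by (intro gr_pairing_single_term A G.gr_elem_closed x) (auto simp: gr_elem_def)
  then show ?thesis
    using st a x by (simp add: gr_elem_def part_pairing_gr_coset)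
qed

lemma gr_pairing_gr_elem:
  assumes st: "s \<ge> 1" "t \<ge> 1" and a: "a \<in> M s" and x: "x \<in> N t"
  shows "gr_pairing G N c (gr_elem K M s a) (gr_elem G N t x) = gr_elem G N (s + t) (c a x)"
proof (rule G.gr_ext)
  have A: "gr_elem K M s a \<in> carrier (gr K M)"
    using st a by (simp add: K.gr_elem_closed)
  show "gr_pairing G N c (gr_elem K M s a) (gr_elem G N t x) \<in> carrier (gr G N)"
    "gr_elem G N (s + t) (c a x) \<in> carrier (gr G N)"
    using assms c_closed by (auto intro!: gr_pairing_closed K.gr_elem_closed G.gr_elem_closed)
  fix n :: nat
  assume n: "n \<ge> 1"
  show "gr_pairing G N c (gr_elem K M s a) (gr_elem G N t x) n = gr_elem G N (s + t) (c a x) n"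
  proof (cases "n = s + t")
    case True
    then show ?thesis
      using gr_pairing_gr_elem_right[OF A st x a] st by (simp add: gr_elem_def)
  next
    case False
    have "gr_pairing G N c (gr_elem K M s a) (gr_elem G N t x) n = \<one>\<^bsub>gr_part G N n\<^esub>"
      using False st x n by (intro gr_pairing_eq_one A G.gr_elem_closed) (auto simp: gr_elem_def)
    then show ?thesis
      using False n by (simp add: gr_elem_def)
  qed
qed

end

section \<open>Surjective images of filtrations\<close>

context group_hom
begin

lemma central_filtration_image:
  assumes "central_filtration G N" and surj: "h ` carrier G = carrier H"
  shows "central_filtration H (\<lambda>s. h ` N s)"
proof -
  interpret N: central_filtration G N
    by fact
  show ?thesis
  proof (intro central_filtration.intro central_filtration_axioms.intro)
    show "h ` N (Suc 0) = carrier H"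
      by (simp add: N.filt_1 surj)
    show "subgroup (h ` N s) H" "h ` N (Suc s) \<subseteq> h ` N s" if "s \<ge> 1" for s
      using that N.subgroup_filt N.filt_Suc_subset by (simp_all add: subgroup_img_is_subgroup image_mono)
    show "commutator H x y \<in> h ` N (Suc s)"
      if s: "s \<ge> 1" and xy: "x \<in> h ` N s" "y \<in> carrier H" for s x y
    proof -
      obtain u v where uv: "u \<in> N s" "v \<in> carrier G" "x = h u" "y = h v"
        using xy surj by blast
      then have "commutator H x y = h (commutator G u v)"
        using N.filt_carrier[OF s] by (simp add: hom_commutator)
      then show ?thesis
        using N.filt_commutator[OF s uv(1,2)] by simp
    qed
  qed (rule H.is_group)
qed

lemma lcs_image:
  assumes surj: "h ` carrier G = carrier H"
  shows "lcs H s = h ` lcs G s"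
proof (induction s)
  case 0
  then show ?case
    by (simp add: lcs.simps surj)
next
  case (Suc s)
  show ?case
  proof (cases "s = 0")
    case True
    then show ?thesis
      by (simp add: surj)
  next
    case False
    have "commutator H (h x) (h y) = h (commutator G x y)" if "x \<in> lcs G s" "y \<in> carrier G" for x y
      using that G.lcs_subset_carrier by (subst hom_commutator) auto
    then have "(\<Union>x\<in>lcs H s. \<Union>y\<in>carrier H. {commutator H x y}) =
        h ` (\<Union>x\<in>lcs G s. \<Union>y\<in>carrier G. {commutator G x y})"
      unfolding Suc surj[symmetric] by (auto simp: image_UN)
    moreover have "(\<Union>x\<in>lcs G s. \<Union>y\<in>carrier G. {commutator G x y}) \<subseteq> carrier G"
      using G.lcs_subset_carrier by blast
    ultimately show ?thesis
      using False by (simp add: lcs.simps generate_img)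
  qed
qed

text \<open>Serves for conjugation from \<open>G\<close> to its Torelli group, which in general is
  not onto; \<open>lcs_image\<close> serves for the projection to outer automorphisms.\<close>

lemma lcs_image_subset: "h ` lcs G s \<subseteq> lcs H s"
proof (induction s)
  case 0
  then show ?case
    using hom_closed by (auto simp: lcs.simps)
next
  case (Suc s)
  show ?case
  proof (cases "s = 0")
    case True
    then show ?thesis
      using hom_closed by auto
  next
    case False
    have "h ` (\<Union>x\<in>lcs G s. \<Union>y\<in>carrier G. {commutator G x y}) \<subseteq> lcs H (Suc s)"
    proof clarsimp
      fix x y
      assume "x \<in> lcs G s" and y: "y \<in> carrier G"
      then have "x \<in> carrier G" "h x \<in> lcs H s"
        using G.lcs_subset_carrier Suc by blast+
      then show "h (commutator G x y) \<in> lcs H (Suc s)"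
        using False y by (simp add: hom_commutator H.lcs_commutator)
    qed
    then have "generate H (h ` (\<Union>x\<in>lcs G s. \<Union>y\<in>carrier G. {commutator G x y})) \<subseteq> lcs H (Suc s)"
      by (rule H.generate_subgroup_incl) (rule H.lcs_subgroup)
    moreover have "(\<Union>x\<in>lcs G s. \<Union>y\<in>carrier G. {commutator G x y}) \<subseteq> carrier G"
      using G.lcs_subset_carrier by blast
    ultimately show ?thesis
      using False by (simp add: generate_img lcs.simps(2)[of G])
  qed
qed

end

section \<open>Johnson filtrations\<close>

text \<open>Restricted to the carrier because the members of \<open>auto G\<close> are extensional
  functions.\<close>

definition conj_aut :: "('a, 'm) monoid_scheme \<Rightarrow> 'a \<Rightarrow> 'a \<Rightarrow> 'a"
  where "conj_aut G g = (\<lambda>x\<in>carrier G. g \<otimes>\<^bsub>G\<^esub> x \<otimes>\<^bsub>G\<^esub> inv\<^bsub>G\<^esub> g)"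

definition displacement :: "('a, 'm) monoid_scheme \<Rightarrow> ('a \<Rightarrow> 'a) \<Rightarrow> 'a \<Rightarrow> 'a"
  where "displacement G \<alpha> x = \<alpha> x \<otimes>\<^bsub>G\<^esub> inv\<^bsub>G\<^esub> x"

context group
begin

lemma carrier_AutoGroup: "carrier (AutoGroup G) = auto G"
  by (simp add: AutoGroup_def)

lemma auto_hom: "\<alpha> \<in> auto G \<Longrightarrow> group_hom G G \<alpha>"
  by (simp add: auto_def group_hom_def group_hom_axioms_def is_group)

lemma auto_closed: "\<lbrakk>\<alpha> \<in> auto G; x \<in> carrier G\<rbrakk> \<Longrightarrow> \<alpha> x \<in> carrier G"
  by (auto simp: auto_def hom_def)

lemma auto_surj:
  assumes "\<alpha> \<in> auto G" "x \<in> carrier G"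
  obtains y where "y \<in> carrier G" "\<alpha> y = x"
proof -
  have "\<alpha> ` carrier G = carrier G"
    using assms by (simp add: auto_def Bij_def bij_betw_def)
  then have "x \<in> \<alpha> ` carrier G"
    using assms(2) by simp
  then show ?thesis
    using that by (auto elim: imageE)
qed

lemma auto_ext:
  assumes "\<alpha> \<in> auto G" "\<beta> \<in> auto G" "\<And>x. x \<in> carrier G \<Longrightarrow> \<alpha> x = \<beta> x"
  shows "\<alpha> = \<beta>"
  using assms by (auto simp: auto_def Bij_def intro: extensionalityI)

lemma AutoGroup_mult_apply:
  "\<lbrakk>\<alpha> \<in> auto G; \<beta> \<in> auto G; x \<in> carrier G\<rbrakk> \<Longrightarrow> (\<alpha> \<otimes>\<^bsub>AutoGroup G\<^esub> \<beta>) x = \<alpha> (\<beta> x)"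
  by (simp add: AutoGroup_def BijGroup_def auto_def compose_def)

lemma AutoGroup_one_apply: "x \<in> carrier G \<Longrightarrow> \<one>\<^bsub>AutoGroup G\<^esub> x = x"
  by (simp add: AutoGroup_def BijGroup_def)

lemma AutoGroup_inv_apply:
  assumes "\<alpha> \<in> auto G" "x \<in> carrier G"
  shows "\<alpha> ((inv\<^bsub>AutoGroup G\<^esub> \<alpha>) x) = x"
proof -
  interpret A: group "AutoGroup G"
    by (rule AutoGroup)
  have "inv\<^bsub>AutoGroup G\<^esub> \<alpha> \<in> auto G" "\<alpha> \<otimes>\<^bsub>AutoGroup G\<^esub> inv\<^bsub>AutoGroup G\<^esub> \<alpha> = \<one>\<^bsub>AutoGroup G\<^esub>"
    using assms A.inv_closed[of \<alpha>] A.r_inv[of \<alpha>] by (simp_all add: carrier_AutoGroup)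
  then show ?thesis
    using assms AutoGroup_mult_apply AutoGroup_one_apply by metis
qed

lemma displacement_closed: "\<lbrakk>\<alpha> \<in> auto G; x \<in> carrier G\<rbrakk> \<Longrightarrow> displacement G \<alpha> x \<in> carrier G"
  by (simp add: displacement_def auto_closed)

lemma apply_eq_displacement:
  "\<lbrakk>\<alpha> \<in> auto G; x \<in> carrier G\<rbrakk> \<Longrightarrow> \<alpha> x = displacement G \<alpha> x \<otimes> x"
  by (simp add: displacement_def auto_closed m_assoc)

section \<open>The Johnson filtration\<close>

lemma johnson_filt_auto: "\<alpha> \<in> johnson_filt G s \<Longrightarrow> \<alpha> \<in> auto G"
  by (simp add: johnson_filt_def)

lemma johnson_filt_iff:
  "\<alpha> \<in> johnson_filt G s \<longleftrightarrow>
    \<alpha> \<in> auto G \<and> (\<forall>x\<in>carrier G. displacement G \<alpha> x \<in> lcs G (Suc s))"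
  by (simp add: johnson_filt_def displacement_def)

lemma johnson_filt_mono: "s \<le> t \<Longrightarrow> johnson_filt G t \<subseteq> johnson_filt G s"
  using lcs_mono[of "Suc s" "Suc t"] by (simp add: johnson_filt_iff subset_iff)

text \<open>Membership in \<open>johnson_filt G s\<close> is tested on Gamma^1 only;
  \<open>lcs_shift\<close> extends the shift by \<open>s\<close> to every Gamma^t, so that Johnson
  images have degree \<open>s\<close>.\<close>

lemma displacement_lcs:
  "\<lbrakk>\<alpha> \<in> johnson_filt G s; t \<ge> 1; x \<in> lcs G t\<rbrakk> \<Longrightarrow> displacement G \<alpha> x \<in> lcs G (s + t)"
  unfolding displacement_def by (rule lcs_shift) (auto simp: johnson_filt_def auto_def)

text \<open>Displacements obey a cocycle rule: that of the composite at \<open>x\<close> is the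
  displacement of \<alpha> at \<open>\<beta> x\<close> times that of \<beta> at \<open>x\<close>. As
  all points of \<open>G\<close> are tested, closure under products and inverses follows.\<close>

lemma subgroup_johnson_filt: "subgroup (johnson_filt G s) (AutoGroup G)"
proof -
  interpret A: group "AutoGroup G"
    by (rule AutoGroup)
  interpret N: normal "lcs G (Suc s)" G
    by (rule lcs_normal)
  show ?thesis
  proof (rule A.subgroupI)
    show "johnson_filt G s \<subseteq> carrier (AutoGroup G)"
      by (auto simp: carrier_AutoGroup johnson_filt_auto)
    have "\<one>\<^bsub>AutoGroup G\<^esub> \<in> johnson_filt G s"
      using A.one_closed by (simp add: johnson_filt_def carrier_AutoGroup AutoGroup_one_apply)
    then show "johnson_filt G s \<noteq> {}"
      by blast
  next
    fix \<alpha>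
    assume \<alpha>: "\<alpha> \<in> johnson_filt G s"
    let ?\<gamma> = "inv\<^bsub>AutoGroup G\<^esub> \<alpha>"
    have \<gamma>: "?\<gamma> \<in> auto G"
      using A.inv_closed[of \<alpha>] johnson_filt_auto[OF \<alpha>] by (simp add: carrier_AutoGroup)
    have "displacement G ?\<gamma> x \<in> lcs G (Suc s)" if x: "x \<in> carrier G" for x
    proof -
      have y: "?\<gamma> x \<in> carrier G" "\<alpha> (?\<gamma> x) = x"
        using auto_closed[OF \<gamma> x] AutoGroup_inv_apply johnson_filt_auto[OF \<alpha>] x by auto
      then have "displacement G ?\<gamma> x = inv (displacement G \<alpha> (?\<gamma> x))"
        using x by (simp add: displacement_def inv_mult_group)
      moreover have "displacement G \<alpha> (?\<gamma> x) \<in> lcs G (Suc s)"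
        using \<alpha> y(1) by (simp add: johnson_filt_iff)
      ultimately show ?thesis
        by simp
    qed
    then show "?\<gamma> \<in> johnson_filt G s"
      using \<gamma> by (simp add: johnson_filt_iff)
  next
    fix \<alpha> \<beta>
    assume \<alpha>: "\<alpha> \<in> johnson_filt G s" and \<beta>: "\<beta> \<in> johnson_filt G s"
    note au = johnson_filt_auto[OF \<alpha>] johnson_filt_auto[OF \<beta>]
    have "displacement G (\<alpha> \<otimes>\<^bsub>AutoGroup G\<^esub> \<beta>) x \<in> lcs G (Suc s)" if x: "x \<in> carrier G" for x
    proof -
      have "displacement G (\<alpha> \<otimes>\<^bsub>AutoGroup G\<^esub> \<beta>) x = displacement G \<alpha> (\<beta> x) \<otimes> displacement G \<beta> x"
        using au x by (simp add: displacement_def AutoGroup_mult_apply auto_closed group_normalize)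
      then show ?thesis
        using \<alpha> \<beta> x auto_closed[OF au(2) x] by (simp add: johnson_filt_iff)
    qed
    then show "\<alpha> \<otimes>\<^bsub>AutoGroup G\<^esub> \<beta> \<in> johnson_filt G s"
      using A.m_closed au by (simp add: johnson_filt_iff carrier_AutoGroup)
  qed
qed

lemma carrier_Torelli: "carrier (Torelli G) = johnson_filt G 1"
  by (simp add: Torelli_def)

lemma mult_Torelli: "monoid.mult (Torelli G) = monoid.mult (AutoGroup G)"
  by (simp add: Torelli_def)

lemma group_Torelli: "group (Torelli G)"
  unfolding Torelli_def
  by (rule group.subgroup_imp_group[OF AutoGroup subgroup_johnson_filt])

lemma Torelli_mult_apply:
  "\<lbrakk>\<alpha> \<in> auto G; \<beta> \<in> auto G; x \<in> carrier G\<rbrakk> \<Longrightarrow> (\<alpha> \<otimes>\<^bsub>Torelli G\<^esub> \<beta>) x = \<alpha> (\<beta> x)"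
  by (simp add: mult_Torelli AutoGroup_mult_apply)

lemma central_filtration_johnson: "central_filtration (Torelli G) (johnson_filt G)"
proof -
  interpret T: group "Torelli G"
    by (rule group_Torelli)
  show ?thesis
  proof (intro central_filtration.intro central_filtration_axioms.intro)
    show "group (Torelli G)"
      by (rule group_Torelli)
    show "johnson_filt G (Suc 0) = carrier (Torelli G)"
      by (simp add: carrier_Torelli)
    show "subgroup (johnson_filt G s) (Torelli G)" if "s \<ge> 1" for s
      unfolding Torelli_def using that
      by (intro group.subgroup_incl[OF AutoGroup] subgroup_johnson_filt johnson_filt_mono)
    show "johnson_filt G (Suc s) \<subseteq> johnson_filt G s" if "s \<ge> 1" for s
      by (simp add: johnson_filt_mono)
  next
    fix s \<alpha> \<beta>
    assume s: "1 \<le> s" and \<alpha>: "\<alpha> \<in> johnson_filt G s" and \<beta>: "\<beta> \<in> carrier (Torelli G)"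
    let ?\<kappa> = "commutator (Torelli G) \<alpha> \<beta>"
    have \<alpha>T: "\<alpha> \<in> carrier (Torelli G)"
      using \<alpha> s johnson_filt_mono by (auto simp: carrier_Torelli)
    have \<kappa>T: "?\<kappa> \<in> carrier (Torelli G)"
      using \<alpha>T \<beta> by simp
    have \<beta>1: "\<beta> \<in> johnson_filt G 1"
      using \<beta> by (simp add: carrier_Torelli)
    have au: "\<alpha> \<in> auto G" "\<beta> \<in> auto G" "?\<kappa> \<in> auto G"
      using \<alpha>T \<beta> \<kappa>T johnson_filt_auto by (auto simp: carrier_Torelli)
    \<comment> \<open>Evaluating at points \<open>\<beta> (\<alpha> z)\<close> removes the inverses
      from the commutator; these points exhaust \<open>G\<close> because both maps are onto.\<close>
    have \<kappa>: "?\<kappa> (\<beta> (\<alpha> z)) = \<alpha> (\<beta> z)" if z: "z \<in> carrier G" for z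
    proof -
      have "?\<kappa> \<otimes>\<^bsub>Torelli G\<^esub> (\<beta> \<otimes>\<^bsub>Torelli G\<^esub> \<alpha>) = \<alpha> \<otimes>\<^bsub>Torelli G\<^esub> \<beta>"
        using \<alpha>T \<beta> by (simp add: commutator_def T.group_normalize)
      then have "(?\<kappa> \<otimes>\<^bsub>Torelli G\<^esub> (\<beta> \<otimes>\<^bsub>Torelli G\<^esub> \<alpha>)) z = (\<alpha> \<otimes>\<^bsub>Torelli G\<^esub> \<beta>) z"
        by simp
      moreover have "\<beta> \<otimes>\<^bsub>Torelli G\<^esub> \<alpha> \<in> auto G"
        using T.m_closed[OF \<beta> \<alpha>T] johnson_filt_auto by (auto simp: carrier_Torelli)
      ultimately show ?thesis
        using au z by (simp add: Torelli_mult_apply)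
    qed
    interpret L: central_filtration G "lcs G"
      by (rule central_filtration_lcs)
    interpret N: normal "lcs G (Suc (Suc s))" G
      by (rule lcs_normal)
    have "displacement G ?\<kappa> x \<in> lcs G (Suc (Suc s))" if x: "x \<in> carrier G" for x
    proof -
      obtain y where y: "y \<in> carrier G" "\<beta> y = x"
        using auto_surj[OF au(2) x] .
      then obtain z where z: "z \<in> carrier G" "x = \<beta> (\<alpha> z)"
        using auto_surj[OF au(1) y(1)] by blast
      define a where "a = displacement G \<alpha> z"
      define b where "b = displacement G \<beta> z"
      have a: "a \<in> lcs G (Suc s)" and b: "b \<in> lcs G (Suc (Suc 0))"
        using \<alpha> \<beta>1 z by (simp_all add: a_def b_def johnson_filt_iff)
      have ab: "a \<in> carrier G" "b \<in> carrier G"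
        using a b lcs_subset_carrier by blast+
      have \<alpha>z: "\<alpha> z = a \<otimes> z" and \<beta>z: "\<beta> z = b \<otimes> z"
        using z au by (simp_all add: a_def b_def apply_eq_displacement)
      have c: "\<alpha> b \<in> carrier G" "\<beta> a \<in> carrier G"
        using ab au auto_closed by blast+
      have "\<alpha> (\<beta> z) = \<alpha> b \<otimes> (a \<otimes> z)" "\<beta> (\<alpha> z) = \<beta> a \<otimes> (b \<otimes> z)"
        using ab z auto_hom[OF au(1)] auto_hom[OF au(2)] \<alpha>z \<beta>z by (simp_all add: group_hom.hom_mult)
      then have "displacement G ?\<kappa> x = (\<alpha> b \<otimes> a) \<otimes> inv (\<beta> a \<otimes> b)"
        using ab c z \<kappa>[OF z(1)] unfolding displacement_def by (simp add: group_normalize)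
      \<comment> \<open>Modulo Gamma^(s+2), \<alpha> fixes \<open>b\<close>, which lies in Gamma^2,
        \<beta> fixes \<open>a\<close>, which lies in Gamma^(s+1), and \<open>a\<close> commutes
        with \<open>b\<close>.\<close>
      moreover have "gr_coset G (lcs G) (Suc s) (\<alpha> b \<otimes> a) = gr_coset G (lcs G) (Suc s) (\<beta> a \<otimes> b)"
      proof -
        have "displacement G \<alpha> b \<in> lcs G (Suc (Suc s))" "displacement G \<beta> a \<in> lcs G (Suc (Suc s))"
          using displacement_lcs[OF \<alpha> _ b] displacement_lcs[OF \<beta>1 _ a] by simp_all
        then have "gr_coset G (lcs G) (Suc s) (\<alpha> b) = gr_coset G (lcs G) (Suc s) b"
          "gr_coset G (lcs G) (Suc s) (\<beta> a) = gr_coset G (lcs G) (Suc s) a"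
          using ab c by (simp_all add: L.gr_coset_eq_iff displacement_def)
        then show ?thesis
          using ab c L.gr_coset_commute[OF _ a ab(2)] by (simp flip: L.gr_coset_mult)
      qed
      ultimately show ?thesis
        using ab c by (simp add: L.gr_coset_eq_iff)
    qed
    then show "?\<kappa> \<in> johnson_filt G (Suc s)"
      using au by (simp add: johnson_filt_iff)
  qed
qed

text \<open>Left additivity: a composite displaces \<open>x\<close> by \<alpha> of the displacement
  of \<beta>, times the displacement of \<alpha>; modulo Gamma^(s+t+1), \<alpha> fixes the former
  since 2s + t > s + t. Right additivity: the displacement of a product contains a conjugate, and
  conjugation acts trivially on graded pieces.\<close>

lemma graded_pairing_johnson:
  "graded_pairing (Torelli G) (johnson_filt G) G (lcs G) (displacement G)"
proof (intro graded_pairing.intro graded_pairing_axioms.intro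
    central_filtration_johnson central_filtration_lcs)
  interpret L: central_filtration G "lcs G"
    by (rule central_filtration_lcs)
  fix s t \<alpha> x
  assume s: "1 \<le> s" and t: "1 \<le> t" and \<alpha>: "\<alpha> \<in> johnson_filt G s" and x: "x \<in> lcs G t"
  have xc: "x \<in> carrier G"
    using x lcs_subset_carrier by blast
  have st: "s + t \<ge> 1"
    using s by simp
  note \<alpha>a = johnson_filt_auto[OF \<alpha>]
  show "displacement G \<alpha> x \<in> lcs G (s + t)"
    using displacement_lcs[OF \<alpha> t x] .
  then have a: "displacement G \<alpha> x \<in> lcs G (s + t)" "displacement G \<alpha> x \<in> carrier G"
    using lcs_subset_carrier by blast+
  show "gr_coset G (lcs G) (s + t) (displacement G (\<alpha> \<otimes>\<^bsub>Torelli G\<^esub> \<beta>) x) =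
      gr_coset G (lcs G) (s + t) (displacement G \<alpha> x \<otimes> displacement G \<beta> x)"
    if \<beta>: "\<beta> \<in> johnson_filt G s" for \<beta>
  proof -
    note \<beta>a = johnson_filt_auto[OF \<beta>]
    have b: "displacement G \<beta> x \<in> lcs G (s + t)"
      using displacement_lcs[OF \<beta> t x] .
    then have bc: "displacement G \<beta> x \<in> carrier G"
      using lcs_subset_carrier by blast
    have \<alpha>b: "\<alpha> (displacement G \<beta> x) \<in> carrier G"
      using \<alpha>a bc by (rule auto_closed)
    have "displacement G (\<alpha> \<otimes>\<^bsub>Torelli G\<^esub> \<beta>) x = \<alpha> (displacement G \<beta> x \<otimes> x) \<otimes> inv x"
      using \<alpha>a \<beta>a xc apply_eq_displacement[OF \<beta>a xc]
      by (simp add: displacement_def Torelli_mult_apply)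
    also have "\<dots> = \<alpha> (displacement G \<beta> x) \<otimes> displacement G \<alpha> x"
      using auto_hom[OF \<alpha>a] \<alpha>b bc xc auto_closed[OF \<alpha>a xc]
      by (simp add: group_hom.hom_mult m_assoc displacement_def[of G \<alpha>])
    finally have eq: "displacement G (\<alpha> \<otimes>\<^bsub>Torelli G\<^esub> \<beta>) x =
        \<alpha> (displacement G \<beta> x) \<otimes> displacement G \<alpha> x" .
    have "displacement G \<alpha> (displacement G \<beta> x) \<in> lcs G (s + (s + t))"
      using displacement_lcs[OF \<alpha> st b] .
    then have "displacement G \<alpha> (displacement G \<beta> x) \<in> lcs G (Suc (s + t))"
      using lcs_mono[of "Suc (s + t)" "s + (s + t)"] s by auto
    then have "gr_coset G (lcs G) (s + t) (\<alpha> (displacement G \<beta> x)) =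
        gr_coset G (lcs G) (s + t) (displacement G \<beta> x)"
      using bc \<alpha>b by (simp add: L.gr_coset_eq_iff displacement_def[of G \<alpha>])
    then show ?thesis
      unfolding eq using a bc \<alpha>b L.gr_coset_commute[OF st b a(2)] by (simp flip: L.gr_coset_mult)
  qed
  show "gr_coset G (lcs G) (s + t) (displacement G \<alpha> (x \<otimes> y)) =
      gr_coset G (lcs G) (s + t) (displacement G \<alpha> x \<otimes> displacement G \<alpha> y)"
    if y: "y \<in> lcs G t" for y
  proof -
    have yc: "y \<in> carrier G"
      using y lcs_subset_carrier by blast
    have b: "displacement G \<alpha> y \<in> lcs G (s + t)"
      using displacement_lcs[OF \<alpha> t y] .
    have bc: "displacement G \<alpha> y \<in> carrier G"
      using b lcs_subset_carrier by blast
    have "displacement G \<alpha> (x \<otimes> y) = displacement G \<alpha> x \<otimes> (x \<otimes> displacement G \<alpha> y \<otimes> inv x)"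
      using auto_hom[OF \<alpha>a] xc yc auto_closed[OF \<alpha>a]
      by (simp add: displacement_def group_hom.hom_mult group_normalize)
    then show ?thesis
      using a bc xc L.gr_coset_conj[OF st b xc] by (simp flip: L.gr_coset_mult)
  qed
qed

section \<open>Conjugations\<close>

lemma conj_aut_apply: "x \<in> carrier G \<Longrightarrow> conj_aut G g x = g \<otimes> x \<otimes> inv g"
  by (simp add: conj_aut_def)

lemma conj_aut_auto:
  assumes g: "g \<in> carrier G"
  shows "conj_aut G g \<in> auto G"
proof -
  have "bij_betw (conj_aut G g) (carrier G) (carrier G)"
    by (rule bij_betw_byWitness[where f' = "conj_aut G (inv g)"])
      (use g in \<open>auto simp: conj_aut_def group_normalize\<close>)
  then show ?thesis
    using conj_in_hom[OF g] by (auto simp: auto_def Bij_def conj_aut_def)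
qed

lemma displacement_conj_aut:
  "x \<in> carrier G \<Longrightarrow> displacement G (conj_aut G g) x = commutator G g x"
  by (simp add: displacement_def conj_aut_def commutator_def)

text \<open>The index shift in the Johnson filtration, where F^s displaces into Gamma^(s+1), is what
  makes \<open>conj_aut\<close> preserve degrees.\<close>

lemma conj_aut_johnson_filt:
  assumes "s \<ge> 1" "g \<in> lcs G s"
  shows "conj_aut G g \<in> johnson_filt G s"
  using assms conj_aut_auto lcs_subset_carrier
  by (auto simp: johnson_filt_iff displacement_conj_aut intro!: lcs_commutator)

lemma conj_aut_mult:
  assumes "g \<in> carrier G" "h \<in> carrier G"
  shows "conj_aut G (g \<otimes> h) = conj_aut G g \<otimes>\<^bsub>AutoGroup G\<^esub> conj_aut G h"
proof (rule auto_ext)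
  interpret A: group "AutoGroup G"
    by (rule AutoGroup)
  show "conj_aut G g \<otimes>\<^bsub>AutoGroup G\<^esub> conj_aut G h \<in> auto G"
    using A.m_closed assms conj_aut_auto by (simp add: carrier_AutoGroup)
qed (use assms conj_aut_auto in
    \<open>simp_all add: AutoGroup_mult_apply conj_aut_apply group_normalize\<close>)

lemma group_hom_conj_aut: "group_hom G (AutoGroup G) (conj_aut G)"
  by (simp add: group_hom_def group_hom_axioms_def is_group AutoGroup hom_def conj_aut_mult
      conj_aut_auto carrier_AutoGroup)

lemma filtration_hom_conj_aut:
  "filtration_hom G (lcs G) (Torelli G) (johnson_filt G) (conj_aut G)"
proof -
  have "conj_aut G \<in> hom G (Torelli G)"
    using conj_aut_johnson_filt[of 1] by (simp add: hom_def carrier_Torelli mult_Torelli conj_aut_mult)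
  then show ?thesis
    by (intro filtration_hom.intro filtration_hom_axioms.intro central_filtration_lcs
        central_filtration_johnson group_hom.intro group_hom_axioms.intro is_group group_Torelli
        conj_aut_johnson_filt)
qed

text \<open>The displacement of conjugation by \<open>g\<close> is the commutator with
  \<open>g\<close>, so the Johnson pairing, restricted to conjugations, is the bracket. In
  particular (Gamma^s, Gamma^t) lies in Gamma^(s+t), a consequence of
  \<open>lcs_shift\<close>.\<close>

lemma graded_pairing_commutator: "graded_pairing G (lcs G) G (lcs G) (commutator G)"
proof -
  interpret P: graded_pairing "Torelli G" "johnson_filt G" G "lcs G" "displacement G"
    by (rule graded_pairing_johnson)
  interpret C: filtration_hom G "lcs G" "Torelli G" "johnson_filt G" "conj_aut G"
    by (rule filtration_hom_conj_aut)
  have car: "x \<in> carrier G" if "x \<in> lcs G t" for x t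
    using that lcs_subset_carrier by blast
  show ?thesis
  proof (intro graded_pairing.intro graded_pairing_axioms.intro central_filtration_lcs)
    fix s t g x
    assume s: "1 \<le> s" and t: "1 \<le> t" and g: "g \<in> lcs G s" and x: "x \<in> lcs G t"
    note \<alpha> = conj_aut_johnson_filt[OF s g]
    show "commutator G g x \<in> lcs G (s + t)"
      using P.c_closed[OF s t \<alpha> x] car[OF x] by (simp add: displacement_conj_aut)
    show "gr_coset G (lcs G) (s + t) (commutator G (g \<otimes> h) x) =
        gr_coset G (lcs G) (s + t) (commutator G g x \<otimes> commutator G h x)" if h: "h \<in> lcs G s" for h
      using P.c_mult_left[OF s t \<alpha> conj_aut_johnson_filt[OF s h] x] car[OF g] car[OF h] car[OF x]
      by (simp add: displacement_conj_aut flip: C.hom_mult)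
    show "gr_coset G (lcs G) (s + t) (commutator G g (x \<otimes> y)) =
        gr_coset G (lcs G) (s + t) (commutator G g x \<otimes> commutator G g y)" if y: "y \<in> lcs G t" for y
      using P.c_mult_right[OF s t \<alpha> x y] car[OF x] car[OF y] by (simp add: displacement_conj_aut)
  qed
qed

section \<open>Outer automorphisms\<close>

lemma Inn_eq: "Inn G = conj_aut G ` carrier G"
  by (simp add: Inn_def conj_aut_def)

lemma normal_Inn: "Inn G \<lhd> AutoGroup G"
proof -
  interpret A: group "AutoGroup G"
    by (rule AutoGroup)
  interpret C: group_hom G "AutoGroup G" "conj_aut G"
    by (rule group_hom_conj_aut)
  have "\<alpha> \<otimes>\<^bsub>AutoGroup G\<^esub> conj_aut G g \<otimes>\<^bsub>AutoGroup G\<^esub> inv\<^bsub>AutoGroup G\<^esub> \<alpha> \<in> Inn G"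
    if \<alpha>: "\<alpha> \<in> auto G" and g: "g \<in> carrier G" for \<alpha> g
  proof -
    have \<alpha>g: "\<alpha> g \<in> carrier G"
      using \<alpha> g by (rule auto_closed)
    have "\<alpha> \<otimes>\<^bsub>AutoGroup G\<^esub> conj_aut G g = conj_aut G (\<alpha> g) \<otimes>\<^bsub>AutoGroup G\<^esub> \<alpha>"
      using \<alpha> g \<alpha>g conj_aut_auto A.m_closed auto_hom[OF \<alpha>]
      by (intro auto_ext)
        (auto simp: AutoGroup_mult_apply conj_aut_apply carrier_AutoGroup auto_closed
          group_hom.hom_mult group_hom.hom_inv)
    then have "\<alpha> \<otimes>\<^bsub>AutoGroup G\<^esub> conj_aut G g \<otimes>\<^bsub>AutoGroup G\<^esub> inv\<^bsub>AutoGroup G\<^esub> \<alpha> = conj_aut G (\<alpha> g)"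
      using \<alpha> conj_aut_auto[OF \<alpha>g] by (simp add: A.mult_inv_cancel carrier_AutoGroup)
    then show ?thesis
      using \<alpha>g by (simp add: Inn_eq)
  qed
  then show ?thesis
    unfolding A.normal_inv_iff using C.img_is_subgroup by (auto simp: Inn_eq carrier_AutoGroup)
qed

lemma group_hom_out_proj: "group_hom (AutoGroup G) (Out G) (out_proj G)"
  unfolding Out_def out_proj_def by (rule normal.group_hom_Mod[OF normal_Inn])

lemma carrier_Outer_Torelli: "carrier (Outer_Torelli G) = out_proj G ` johnson_filt G 1"
  by (simp add: Outer_Torelli_def outer_johnson_filt_def)

lemma group_hom_out_proj_Torelli: "group_hom (Torelli G) (Outer_Torelli G) (out_proj G)"
proof -
  interpret P: group_hom "AutoGroup G" "Out G" "out_proj G"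
    by (rule group_hom_out_proj)
  have "group (Outer_Torelli G)"
    unfolding Outer_Torelli_def outer_johnson_filt_def
    by (intro P.H.subgroup_imp_group P.subgroup_img_is_subgroup subgroup_johnson_filt)
  moreover have "out_proj G (\<alpha> \<otimes>\<^bsub>Torelli G\<^esub> \<beta>) = out_proj G \<alpha> \<otimes>\<^bsub>Outer_Torelli G\<^esub> out_proj G \<beta>"
    if "\<alpha> \<in> carrier (Torelli G)" "\<beta> \<in> carrier (Torelli G)" for \<alpha> \<beta>
    using that johnson_filt_auto
    by (auto simp: Outer_Torelli_def Torelli_def carrier_AutoGroup intro!: P.hom_mult)
  ultimately show ?thesis
    using group_Torelli
    by (auto simp: group_hom_def group_hom_axioms_def hom_def carrier_Torelli carrier_Outer_Torelli)
qed

lemma out_proj_surj: "out_proj G ` carrier (Torelli G) = carrier (Outer_Torelli G)"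
  by (simp add: carrier_Torelli carrier_Outer_Torelli)

text \<open>Keeps the conjugation as an explicit left factor, the form in which it is later absorbed
  into a representative.\<close>

lemma out_proj_eq_iff:
  assumes "\<alpha> \<in> carrier (Torelli G)" "\<beta> \<in> carrier (Torelli G)"
  shows "out_proj G \<alpha> = out_proj G \<beta> \<longleftrightarrow> (\<exists>g\<in>carrier G. \<alpha> = conj_aut G g \<otimes>\<^bsub>Torelli G\<^esub> \<beta>)"
proof -
  interpret A: group "AutoGroup G"
    by (rule AutoGroup)
  have c: "\<alpha> \<in> carrier (AutoGroup G)" "\<beta> \<in> carrier (AutoGroup G)"
    using assms johnson_filt_auto by (auto simp: carrier_Torelli carrier_AutoGroup)
  have "out_proj G \<alpha> = out_proj G \<beta> \<longleftrightarrow> \<alpha> \<otimes>\<^bsub>AutoGroup G\<^esub> inv\<^bsub>AutoGroup G\<^esub> \<beta> \<in> Inn G"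
    unfolding out_proj_def using c by (rule normal.rcos_eq_iff[OF normal_Inn])
  also have "\<dots> \<longleftrightarrow> (\<exists>g\<in>carrier G. \<alpha> \<otimes>\<^bsub>AutoGroup G\<^esub> inv\<^bsub>AutoGroup G\<^esub> \<beta> = conj_aut G g)"
    by (auto simp: Inn_eq)
  also have "\<dots> \<longleftrightarrow> (\<exists>g\<in>carrier G. \<alpha> = conj_aut G g \<otimes>\<^bsub>AutoGroup G\<^esub> \<beta>)"
    using c conj_aut_auto A.inv_solve_right' carrier_AutoGroup A.mult_inv_cancel
    by (metis A.inv_closed A.inv_inv)
  finally show ?thesis
    by (simp add: mult_Torelli)
qed

lemma filtration_hom_out_proj:
  "filtration_hom (Torelli G) (johnson_filt G) (Outer_Torelli G) (outer_johnson_filt G) (out_proj G)"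
proof -
  interpret P: group_hom "Torelli G" "Outer_Torelli G" "out_proj G"
    by (rule group_hom_out_proj_Torelli)
  have "outer_johnson_filt G = (\<lambda>s. out_proj G ` johnson_filt G s)"
    by (simp add: outer_johnson_filt_def fun_eq_iff)
  then have "central_filtration (Outer_Torelli G) (outer_johnson_filt G)"
    using P.central_filtration_image[OF central_filtration_johnson out_proj_surj] by simp
  then show ?thesis
    by (intro filtration_hom.intro filtration_hom_axioms.intro central_filtration_johnson
        group_hom_out_proj_Torelli) (simp_all add: outer_johnson_filt_def)
qed

end

section \<open>The Johnson homomorphism\<close>

text \<open>The lower central series is the fastest descending central filtration. Its inclusion in
  \<open>N\<close> is the filtered map behind both \<open>iota\<close> and
  \<open>outer_iota\<close>.\<close>

lemma (in central_filtration) lcs_subset_filt: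
  assumes "s \<ge> 1"
  shows "lcs G s \<subseteq> N s"
  using assms
proof (induction s rule: dec_induct)
  case base
  then show ?case
    by (simp add: filt_1)
next
  case (step s)
  have "(\<Union>x\<in>lcs G s. \<Union>y\<in>carrier G. {commutator G x y}) \<subseteq> N (Suc s)"
    using step filt_commutator by blast
  then have "generate G (\<Union>x\<in>lcs G s. \<Union>y\<in>carrier G. {commutator G x y}) \<subseteq> N (Suc s)"
    by (rule generate_subgroup_incl) (simp add: subgroup_filt)
  then show ?case
    using step.hyps by (simp add: lcs.simps)
qed

lemma (in central_filtration) filtration_hom_lcs:
  "filtration_hom G (lcs G) G N (\<lambda>x. x)"
  using lcs_subset_filt
  by (intro filtration_hom.intro filtration_hom_axioms.intro central_filtration_lcs
      central_filtration_axioms group_hom.intro group_hom_axioms.intro is_group)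
    (auto simp: hom_def)

context group
begin

text \<open>The Leibniz rule behind the derivation property. With m = s + k + l, the commutations
  that \<open>commutator_mult_mult\<close> asks for hold modulo Gamma^(m+1), because in each case
  the two degrees add up to more than m.\<close>

lemma displacement_commutator:
  assumes s: "s \<ge> 1" and k: "k \<ge> 1" and l: "l \<ge> 1"
    and \<alpha>: "\<alpha> \<in> johnson_filt G s" and g: "g \<in> lcs G k" and h: "h \<in> lcs G l"
  shows "gr_coset G (lcs G) (s + k + l) (displacement G \<alpha> (commutator G g h)) =
    gr_coset G (lcs G) (s + k + l)
      (commutator G (displacement G \<alpha> g) h \<otimes> commutator G g (displacement G \<alpha> h))"
proof -
  interpret B: graded_pairing G "lcs G" G "lcs G" "commutator G"
    by (rule graded_pairing_commutator)
  define m where "m = s + k + l"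
  let ?Q = "G Mod lcs G (Suc m)"
  let ?r = "\<lambda>x. lcs G (Suc m) #> x"
  interpret N: normal "lcs G (Suc m)" G
    by (rule lcs_normal)
  interpret Q: group ?Q
    by (rule N.factorgroup_is_group)
  interpret r: group_hom G ?Q ?r
    by (rule N.group_hom_Mod)
  have car: "x \<in> carrier G" if "x \<in> lcs G t" for x t
    using that lcs_subset_carrier by blast
  have comm: "?r x \<otimes>\<^bsub>?Q\<^esub> ?r y = ?r y \<otimes>\<^bsub>?Q\<^esub> ?r x"
    if "x \<in> lcs G i" "y \<in> lcs G j" "i \<ge> 1" "j \<ge> 1" "i + j > m" for x y i j
  proof -
    have "commutator G x y \<in> lcs G (i + j)"
      using that by (intro B.c_closed)
    then have "commutator G x y \<in> lcs G (Suc m)"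
      using lcs_mono[of "Suc m" "i + j"] that by auto
    then show ?thesis
      using that car N.rcos_commute_iff by blast
  qed
  define a where "a = displacement G \<alpha> g"
  define b where "b = displacement G \<alpha> h"
  have a: "a \<in> lcs G (s + k)" and b: "b \<in> lcs G (s + l)"
    using displacement_lcs[OF \<alpha> k g] displacement_lcs[OF \<alpha> l h] by (simp_all add: a_def b_def)
  note c = car[OF a] car[OF b] car[OF g] car[OF h]
  note \<alpha>a = johnson_filt_auto[OF \<alpha>]
  have \<alpha>g: "\<alpha> g = a \<otimes> g" and \<alpha>h: "\<alpha> h = b \<otimes> h"
    using c \<alpha>a by (simp_all add: a_def b_def apply_eq_displacement)
  have "b \<in> lcs G l"
    using b lcs_mono[of l "s + l"] by auto
  then have "b \<otimes> h \<in> lcs G l"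
    using h by (rule subgroup.m_closed[OF lcs_subgroup])
  then have gbh: "commutator G g (b \<otimes> h) \<in> lcs G (k + l)"
    by (rule B.c_closed[OF k l g])
  have gh: "commutator G g h \<in> lcs G (k + l)"
    by (rule B.c_closed[OF k l g h])
  have ah: "commutator G a h \<in> lcs G (s + k + l)"
    by (rule B.c_closed[OF _ l a h]) (use s in simp)
  have e1: "?r a \<otimes>\<^bsub>?Q\<^esub> ?r (commutator G g (b \<otimes> h)) = ?r (commutator G g (b \<otimes> h)) \<otimes>\<^bsub>?Q\<^esub> ?r a"
    by (rule comm[OF a gbh]) (use s k l in \<open>simp_all add: m_def\<close>)
  have e2: "?r b \<otimes>\<^bsub>?Q\<^esub> ?r (commutator G g h) = ?r (commutator G g h) \<otimes>\<^bsub>?Q\<^esub> ?r b"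
    by (rule comm[OF b gh]) (use s k l in \<open>simp_all add: m_def\<close>)
  have e3: "?r a \<otimes>\<^bsub>?Q\<^esub> ?r b = ?r b \<otimes>\<^bsub>?Q\<^esub> ?r a"
    by (rule comm[OF a b]) (use s k l in \<open>simp_all add: m_def\<close>)
  have e4: "?r b \<otimes>\<^bsub>?Q\<^esub> ?r (commutator G a h) = ?r (commutator G a h) \<otimes>\<^bsub>?Q\<^esub> ?r b"
    by (rule comm[OF b ah]) (use s k l in \<open>simp_all add: m_def\<close>)
  \<comment> \<open>The commutator of \<open>a\<close> and \<open>h\<close> has degree m and is
    central modulo Gamma^(m+1), so degree 1 for the other factor is enough. Moving it to the front
    puts the commutator of \<open>g\<close> and \<open>h\<close> last, where the inverse in the
    displacement cancels it.\<close>
  have e5: "?r (commutator G a h) \<otimes>\<^bsub>?Q\<^esub> ?r (commutator G g b \<otimes> commutator G g h) =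
      ?r (commutator G g b \<otimes> commutator G g h) \<otimes>\<^bsub>?Q\<^esub> ?r (commutator G a h)"
    by (rule comm[OF ah, of _ 1]) (use s k l c in \<open>simp_all add: m_def\<close>)
  have "?r (commutator G (a \<otimes> g) (b \<otimes> h)) = commutator ?Q (?r a \<otimes>\<^bsub>?Q\<^esub> ?r g) (?r b \<otimes>\<^bsub>?Q\<^esub> ?r h)"
    by (simp only: r.hom_commutator r.hom_mult m_closed c)
  also have "\<dots> = commutator ?Q (?r g) (?r b) \<otimes>\<^bsub>?Q\<^esub> commutator ?Q (?r g) (?r h) \<otimes>\<^bsub>?Q\<^esub> commutator ?Q (?r a) (?r h)"
    by (rule Q.commutator_mult_mult)
      (use e1 e2 e3 e4 c in \<open>simp_all only: r.hom_closed r.hom_commutator r.hom_mult m_closed\<close>)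
  also have "\<dots> = ?r (commutator G g b \<otimes> commutator G g h) \<otimes>\<^bsub>?Q\<^esub> ?r (commutator G a h)"
    by (simp only: r.hom_commutator r.hom_mult m_closed commutator_closed c)
  also have "\<dots> = ?r (commutator G a h \<otimes> (commutator G g b \<otimes> commutator G g h))"
    using e5 by (simp only: r.hom_mult m_closed commutator_closed c)
  also have "\<dots> = ?r (commutator G a h \<otimes> commutator G g b \<otimes> commutator G g h)"
    by (simp only: m_assoc commutator_closed c)
  finally have "?r (\<alpha> (commutator G g h)) = ?r (commutator G a h \<otimes> commutator G g b \<otimes> commutator G g h)"
    using c auto_hom[OF \<alpha>a] \<alpha>g \<alpha>h by (simp add: group_hom.hom_commutator)
  moreover have "\<alpha> (commutator G g h) \<in> carrier G"
    using c \<alpha>a by (simp add: auto_closed)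
  ultimately have "?r (displacement G \<alpha> (commutator G g h)) =
      ?r (commutator G a h \<otimes> commutator G g b \<otimes> commutator G g h \<otimes> inv (commutator G g h))"
    using c unfolding displacement_def[of G \<alpha> "commutator G g h"]
    by (simp only: N.rcos_mult[of _ "inv (commutator G g h)"] inv_closed commutator_closed m_closed)
  then show ?thesis
    using c by (simp add: gr_coset_def m_def a_def b_def mult_inv_cancel)
qed

section \<open>Additivity, derivation property and injectivity of the Johnson homomorphism\<close>

lemma johnson_hom_eq:
  assumes "A \<in> carrier (gr_johnson G)"
  shows "johnson_hom G A = (\<lambda>X\<in>carrier (gr_lcs G). gr_pairing G (lcs G) (displacement G) A X)"
proof -
  have "(\<lambda>\<alpha> x. \<alpha> x \<otimes> inv x) = displacement G"
    by (simp add: displacement_def fun_eq_iff)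
  then show ?thesis
    using assms by (simp add: johnson_hom_def)
qed

lemma johnson_hom_apply:
  "\<lbrakk>A \<in> carrier (gr_johnson G); X \<in> carrier (gr_lcs G)\<rbrakk> \<Longrightarrow>
    johnson_hom G A X = gr_pairing G (lcs G) (displacement G) A X"
  by (simp add: johnson_hom_eq)

lemma johnson_hom_hom:
  assumes A: "A \<in> carrier (gr_johnson G)"
  shows "johnson_hom G A \<in> hom (gr_lcs G) (gr_lcs G) \<inter> extensional (carrier (gr_lcs G))"
proof -
  interpret P: graded_pairing "Torelli G" "johnson_filt G" G "lcs G" "displacement G"
    by (rule graded_pairing_johnson)
  interpret gG: comm_group "gr_lcs G"
    by (rule P.G.comm_group_gr)
  show ?thesis
    using A P.gr_pairing_closed P.gr_pairing_mult_right by (simp add: johnson_hom_eq hom_def)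
qed

lemma johnson_hom_mult:
  assumes A: "A \<in> carrier (gr_johnson G)" and B: "B \<in> carrier (gr_johnson G)"
    and X: "X \<in> carrier (gr_lcs G)"
  shows "johnson_hom G (A \<otimes>\<^bsub>gr_johnson G\<^esub> B) X = johnson_hom G A X \<otimes>\<^bsub>gr_lcs G\<^esub> johnson_hom G B X"
proof -
  interpret P: graded_pairing "Torelli G" "johnson_filt G" G "lcs G" "displacement G"
    by (rule graded_pairing_johnson)
  interpret gT: comm_group "gr_johnson G"
    by (rule P.K.comm_group_gr)
  show ?thesis
    using A B X P.gr_pairing_mult_left by (simp add: johnson_hom_apply)
qed

lemma johnson_hom_derivation:
  assumes s: "s \<ge> 1" and A: "A \<in> hcomp (gr_johnson G) s"
    and x: "x \<in> carrier (gr_lcs G)" and y: "y \<in> carrier (gr_lcs G)"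
  shows "johnson_hom G A (lbr (gr_lcs G) x y) =
    lbr (gr_lcs G) (johnson_hom G A x) y \<otimes>\<^bsub>gr_lcs G\<^esub> lbr (gr_lcs G) x (johnson_hom G A y)"
proof -
  interpret P: graded_pairing "Torelli G" "johnson_filt G" G "lcs G" "displacement G"
    by (rule graded_pairing_johnson)
  interpret B: graded_pairing G "lcs G" G "lcs G" "commutator G"
    by (rule graded_pairing_commutator)
  interpret gG: comm_group "gr_lcs G"
    by (rule P.G.comm_group_gr)
  have Ac: "A \<in> carrier (gr_johnson G)"
    using A by (simp add: P.K.hcomp_gr)
  obtain \<alpha> where \<alpha>: "\<alpha> \<in> johnson_filt G s" "A s = gr_coset (Torelli G) (johnson_filt G) s \<alpha>"
    using Ac s by (rule P.K.gr_component_cases)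
  have As: "A s \<in> carrier (gr_part (Torelli G) (johnson_filt G) s)"
    using Ac s by (rule P.K.gr_component_closed)
  define Jx where "Jx = johnson_hom G A x"
  define Jy where "Jy = johnson_hom G A y"
  have J: "johnson_hom G A z n = (if s < n then P.p n (A s) (z (n - s)) else \<one>\<^bsub>gr_part G (lcs G) n\<^esub>)"
    if "z \<in> carrier (gr_lcs G)" "n \<ge> 1" for z n
    using that s Ac by (simp add: johnson_hom_apply P.gr_pairing_homogeneous_left[OF A])
  have Jc: "Jx \<in> carrier (gr_lcs G)" "Jy \<in> carrier (gr_lcs G)"
    using x y johnson_hom_hom[OF Ac] by (auto simp: Jx_def Jy_def hom_def)
  have xy: "lbr (gr_lcs G) x y \<in> carrier (gr_lcs G)" "lbr (gr_lcs G) Jx y \<in> carrier (gr_lcs G)"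
    "lbr (gr_lcs G) x Jy \<in> carrier (gr_lcs G)"
    using x y Jc B.gr_pairing_closed by (simp_all add: P.G.lbr_gr)
  have "johnson_hom G A (lbr (gr_lcs G) x y) = lbr (gr_lcs G) Jx y \<otimes>\<^bsub>gr_lcs G\<^esub> lbr (gr_lcs G) x Jy"
  proof (rule P.G.gr_ext)
    show "johnson_hom G A (lbr (gr_lcs G) x y) \<in> carrier (gr_lcs G)"
      using johnson_hom_hom[OF Ac] xy by (auto simp: hom_def)
    show "lbr (gr_lcs G) Jx y \<otimes>\<^bsub>gr_lcs G\<^esub> lbr (gr_lcs G) x Jy \<in> carrier (gr_lcs G)"
      using xy by simp
    fix n :: nat
    assume n: "n \<ge> 1"
    let ?P = "gr_part G (lcs G) n"
    interpret Pn: comm_group ?P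
      using n by (rule P.G.comm_group_gr_part)
    \<comment> \<open>In degree \<open>n\<close> all three expressions become sums over the degree
      \<open>k\<close> of the component of \<open>x\<close>. In \<open>f k\<close> the image of
      \<open>x k\<close>, of degree \<open>s + k\<close>, is bracketed with \<open>y\<close>; in
      \<open>g k\<close>, \<open>x k\<close> is bracketed with the image of a component of
      \<open>y\<close>, of degree \<open>n - k\<close>.\<close>
    define f where "f k = B.p n (P.p (s + k) (A s) (x k)) (y (n - s - k))" for k
    define g where "g k = B.p n (x k) (P.p (n - k) (A s) (y (n - s - k)))" for k
    have terms: "f k \<in> carrier ?P \<and> g k \<in> carrier ?P \<and>
        P.p n (A s) (B.p (n - s) (x k) (y (n - s - k))) = f k \<otimes>\<^bsub>?P\<^esub> g k"
      if k: "k \<in> {1..<n - s}" for k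
    proof -
      define l where "l = n - s - k"
      have kl: "k \<ge> 1" "l \<ge> 1" "n = s + k + l"
        using k by (auto simp: l_def)
      obtain u where u: "u \<in> lcs G k" "x k = gr_coset G (lcs G) k u"
        using x kl(1) by (rule P.G.gr_component_cases)
      obtain v where v: "v \<in> lcs G l" "y l = gr_coset G (lcs G) l v"
        using y kl(2) by (rule P.G.gr_component_cases)
      have du: "displacement G \<alpha> u \<in> lcs G (s + k)" and dv: "displacement G \<alpha> v \<in> lcs G (s + l)"
        using displacement_lcs \<alpha>(1) kl u v by blast+
      have uv: "commutator G u v \<in> lcs G (k + l)"
        using B.c_closed kl u v by blast
      have sk: "s + k \<ge> 1" "s + l \<ge> 1" "k + l \<ge> 1"
        using s kl by auto
      have "f k = gr_coset G (lcs G) n (commutator G (displacement G \<alpha> u) v)"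
        using P.part_pairing_gr_coset[OF s kl(1) \<alpha>(1) u(1)]
          B.part_pairing_gr_coset[OF sk(1) kl(2) du v(1)] u v \<alpha> kl
        by (simp add: f_def flip: l_def)
      moreover have "g k = gr_coset G (lcs G) n (commutator G u (displacement G \<alpha> v))"
        using P.part_pairing_gr_coset[OF s kl(2) \<alpha>(1) v(1)]
          B.part_pairing_gr_coset[OF kl(1) sk(2) u(1) dv] u v \<alpha> kl
        by (simp add: g_def add.assoc add.left_commute flip: l_def)
      moreover have "P.p n (A s) (B.p (n - s) (x k) (y (n - s - k))) =
          gr_coset G (lcs G) n (displacement G \<alpha> (commutator G u v))"
        using P.part_pairing_gr_coset[OF s sk(3) \<alpha>(1) uv]
          B.part_pairing_gr_coset[OF kl(1,2) u(1) v(1)] u v \<alpha> kl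
        by (simp add: add.assoc flip: l_def)
      moreover have "commutator G (displacement G \<alpha> u) v \<in> lcs G n"
        "commutator G u (displacement G \<alpha> v) \<in> lcs G n"
        using B.c_closed[OF sk(1) kl(2) du v(1)] B.c_closed[OF kl(1) sk(2) u(1) dv] kl
        by (simp_all add: ac_simps)
      ultimately show ?thesis
        using displacement_commutator[OF s kl(1,2) \<alpha>(1) u(1) v(1)] lcs_subset_carrier
        by (auto simp: P.G.gr_coset_closed P.G.gr_coset_mult subset_iff kl(3))
    qed
    have f: "f \<in> {1..<n - s} \<rightarrow> carrier ?P" and g: "g \<in> {1..<n - s} \<rightarrow> carrier ?P"
      using terms by blast+
    have lhs: "johnson_hom G A (lbr (gr_lcs G) x y) n =
        finprod ?P (\<lambda>k. P.p n (A s) (B.p (n - s) (x k) (y (n - s - k)))) {1..<n - s}"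
    proof (cases "s < n")
      case True
      then have ns: "n - s \<ge> 1"
        by simp
      have "johnson_hom G A (lbr (gr_lcs G) x y) n =
          P.p n (A s) (finprod (gr_part G (lcs G) (n - s)) (\<lambda>k. B.p (n - s) (x k) (y (n - s - k))) {1..<n - s})"
        using J[OF xy(1) n] True by (simp add: P.G.lbr_gr B.gr_pairing_apply[OF ns])
      also have "\<dots> = finprod ?P (\<lambda>k. P.p n (A s) (B.p (n - s) (x k) (y (n - s - k)))) {1..<n - s}"
      proof (rule hom_finprod)
        show "P.p n (A s) \<in> hom (gr_part G (lcs G) (n - s)) ?P"
          using P.part_pairing_hom_right[OF s ns As] True by simp
        show "(\<lambda>k. B.p (n - s) (x k) (y (n - s - k))) \<in> {1..<n - s} \<rightarrow> carrier (gr_part G (lcs G) (n - s))"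
          using B.gr_pairing_term_closed[OF x y] by blast
      qed (use ns n in \<open>auto intro!: P.G.comm_group_gr_part\<close>)
      finally show ?thesis .
    next
      case False
      then show ?thesis
        using J[OF xy(1) n] by simp
    qed
    \<comment> \<open>Shifting the index by \<open>s\<close> gives the sum for the bracket of
      \<open>Jx\<close> and \<open>y\<close>; the additional terms have index at most
      \<open>s\<close>, where \<open>Jx\<close> vanishes.\<close>
    have fin1: "finprod ?P f {1..<n - s} = lbr (gr_lcs G) Jx y n"
    proof -
      have "finprod ?P f {1..<n - s} = finprod ?P (\<lambda>k. B.p n (Jx (s + k)) (y (n - (s + k)))) {1..<n - s}"
        using J[OF x] f by (intro Pn.finprod_cong') (auto simp: f_def Jx_def Pi_def)
      also have "\<dots> = finprod ?P (\<lambda>m. B.p n (Jx m) (y (n - m))) ((+) s ` {1..<n - s})"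
        using B.gr_pairing_term_closed[OF Jc(1) y] by (intro Pn.finprod_reindex[symmetric]) auto
      also have "\<dots> = finprod ?P (\<lambda>m. B.p n (Jx m) (y (n - m))) {1..<n}"
      proof (rule Pn.finprod_mono_neutral_cong_left)
        fix m
        assume m: "m \<in> {1..<n} - (+) s ` {1..<n - s}"
        have "m \<le> s"
        proof (rule ccontr)
          assume "\<not> m \<le> s"
          then have "m \<in> (+) s ` {1..<n - s}"
            using m by (intro image_eqI[of _ _ "m - s"]) auto
          then show False
            using m by blast
        qed
        then show "B.p n (Jx m) (y (n - m)) = \<one>\<^bsub>?P\<^esub>"
          using m J[OF x, of m] P.G.gr_component_closed[OF y, of "n - m"]
            B.part_pairing_one_left[of m n "y (n - m)"] by (auto simp: Jx_def Suc_le_eq)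
      qed (use B.gr_pairing_term_closed[OF Jc(1) y] in auto)
      finally show ?thesis
        using n by (simp add: P.G.lbr_gr B.gr_pairing_apply)
    qed
    \<comment> \<open>Here the index stays. The additional terms have index at least
      \<open>n - s\<close>, so \<open>Jy\<close> is evaluated in degree at most \<open>s\<close>,
      where it vanishes.\<close>
    have fin2: "finprod ?P g {1..<n - s} = lbr (gr_lcs G) x Jy n"
    proof -
      have "finprod ?P g {1..<n - s} = finprod ?P (\<lambda>k. B.p n (x k) (Jy (n - k))) {1..<n}"
      proof (rule Pn.finprod_mono_neutral_cong_left)
        fix m
        assume m: "m \<in> {1..<n} - {1..<n - s}"
        then have "n - m \<ge> 1" "\<not> s < n - m"
          by auto
        then have "Jy (n - m) = \<one>\<^bsub>gr_part G (lcs G) (n - m)\<^esub>"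
          using J[OF y, of "n - m"] by (simp add: Jy_def)
        then show "B.p n (x m) (Jy (n - m)) = \<one>\<^bsub>?P\<^esub>"
          using m P.G.gr_component_closed[OF x, of m] B.part_pairing_one_right[of m n "x m"] by simp
      next
        fix k
        assume k: "k \<in> {1..<n - s}"
        then have "n - k - s = n - s - k" "n - k \<ge> 1" "s < n - k"
          by auto
        then show "g k = B.p n (x k) (Jy (n - k))"
          using J[OF y, of "n - k"] by (simp add: g_def Jy_def)
      qed (use B.gr_pairing_term_closed[OF x Jc(2)] in auto)
      then show ?thesis
        using n by (simp add: P.G.lbr_gr B.gr_pairing_apply)
    qed
    have "johnson_hom G A (lbr (gr_lcs G) x y) n = finprod ?P (\<lambda>k. f k \<otimes>\<^bsub>?P\<^esub> g k) {1..<n - s}"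
      unfolding lhs using terms by (intro Pn.finprod_cong') auto
    also have "\<dots> = finprod ?P f {1..<n - s} \<otimes>\<^bsub>?P\<^esub> finprod ?P g {1..<n - s}"
      using f g by (rule Pn.finprod_multf)
    finally show "johnson_hom G A (lbr (gr_lcs G) x y) n =
        (lbr (gr_lcs G) Jx y \<otimes>\<^bsub>gr_lcs G\<^esub> lbr (gr_lcs G) x Jy) n"
      unfolding fin1 fin2 using n by (simp add: P.G.mult_gr)
  qed
  then show ?thesis
    by (simp add: Jx_def Jy_def)
qed

lemma johnson_hom_der_deg:
  assumes s: "s \<ge> 1" and A: "A \<in> hcomp (gr_johnson G) s"
  shows "johnson_hom G A \<in> der_deg (gr_lcs G) s"
proof -
  interpret P: graded_pairing "Torelli G" "johnson_filt G" G "lcs G" "displacement G"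
    by (rule graded_pairing_johnson)
  have Ac: "A \<in> carrier (gr_johnson G)"
    using A by (simp add: P.K.hcomp_gr)
  have As: "A s \<in> carrier (gr_part (Torelli G) (johnson_filt G) s)"
    using Ac s by (rule P.K.gr_component_closed)
  have "johnson_hom G A X \<in> hcomp (gr_lcs G) (t + s)" if X: "X \<in> hcomp (gr_lcs G) t" for X t
  proof -
    have Xc: "X \<in> carrier (gr_lcs G)"
      using X by (simp add: P.G.hcomp_gr)
    have "johnson_hom G A X n = \<one>\<^bsub>gr_part G (lcs G) n\<^esub>" if n: "n \<ge> 1" "n \<noteq> t + s" for n
    proof (cases "s < n")
      case True
      then have "X (n - s) = \<one>\<^bsub>gr_part G (lcs G) (n - s)\<^esub>"
        using X n by (auto simp: P.G.hcomp_gr)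
      then show ?thesis
        using True n s Ac Xc P.part_pairing_one_right[OF s True As]
        by (simp add: johnson_hom_apply P.gr_pairing_homogeneous_left[OF A])
    next
      case False
      then show ?thesis
        using n s Ac Xc by (simp add: johnson_hom_apply P.gr_pairing_homogeneous_left[OF A])
    qed
    then show ?thesis
      using johnson_hom_hom[OF Ac] Xc by (auto simp: P.G.hcomp_gr hom_def)
  qed
  then show ?thesis
    using johnson_hom_hom[OF Ac] johnson_hom_derivation[OF s A] by (auto simp: der_deg_def)
qed

lemma johnson_hom_gr_elem:
  assumes "s \<ge> 1" "t \<ge> 1" "\<alpha> \<in> johnson_filt G s" "x \<in> lcs G t"
  shows "johnson_hom G (gr_elem (Torelli G) (johnson_filt G) s \<alpha>) (gr_elem G (lcs G) t x) =
    gr_elem G (lcs G) (s + t) (displacement G \<alpha> x)"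
proof -
  interpret P: graded_pairing "Torelli G" "johnson_filt G" G "lcs G" "displacement G"
    by (rule graded_pairing_johnson)
  show ?thesis
    using assms
    by (simp add: johnson_hom_apply P.K.gr_elem_closed P.G.gr_elem_closed P.gr_pairing_gr_elem)
qed

text \<open>Classes of degree 1 suffice as test elements, since
  \<open>johnson_filt G (Suc s)\<close> is defined by the displacements of arbitrary elements of
  \<open>G\<close>.\<close>

lemma johnson_hom_injective:
  assumes s: "s \<ge> 1" and \<alpha>: "\<alpha> \<in> johnson_filt G s" and \<beta>: "\<beta> \<in> johnson_filt G s"
    and eq: "johnson_hom G (gr_elem (Torelli G) (johnson_filt G) s \<alpha>) =
      johnson_hom G (gr_elem (Torelli G) (johnson_filt G) s \<beta>)"
  shows "\<alpha> \<otimes>\<^bsub>Torelli G\<^esub> inv\<^bsub>Torelli G\<^esub> \<beta> \<in> johnson_filt G (Suc s)"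
proof -
  interpret P: graded_pairing "Torelli G" "johnson_filt G" G "lcs G" "displacement G"
    by (rule graded_pairing_johnson)
  interpret gG: comm_group "gr_lcs G"
    by (rule P.G.comm_group_gr)
  let ?e = "gr_elem (Torelli G) (johnson_filt G) s"
  define \<delta> where "\<delta> = \<alpha> \<otimes>\<^bsub>Torelli G\<^esub> inv\<^bsub>Torelli G\<^esub> \<beta>"
  have \<delta>: "\<delta> \<in> johnson_filt G s"
    unfolding \<delta>_def using \<alpha> \<beta> P.K.subgroup_filt[OF s]
    by (simp add: subgroup.m_closed subgroup.m_inv_closed)
  have T: "\<alpha> \<in> carrier (Torelli G)" "\<beta> \<in> carrier (Torelli G)" "\<delta> \<in> carrier (Torelli G)"
    using \<alpha> \<beta> \<delta> P.K.filt_carrier[OF s] by blast+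
  have "\<alpha> = \<delta> \<otimes>\<^bsub>Torelli G\<^esub> \<beta>"
    using T by (simp add: \<delta>_def P.K.m_assoc)
  then have e: "?e \<alpha> = ?e \<delta> \<otimes>\<^bsub>gr_johnson G\<^esub> ?e \<beta>"
    using T by (simp add: P.K.gr_elem_mult)
  have "displacement G \<delta> x \<in> lcs G (Suc (Suc s))" if x: "x \<in> carrier G" for x
  proof -
    let ?x = "gr_elem G (lcs G) 1 x"
    have xc: "?x \<in> carrier (gr_lcs G)"
      using x by (simp add: P.G.gr_elem_closed)
    have ec: "?e \<delta> \<in> carrier (gr_johnson G)" "?e \<beta> \<in> carrier (gr_johnson G)"
      using s \<delta> \<beta> by (simp_all add: P.K.gr_elem_closed)
    have c: "johnson_hom G (?e \<delta>) ?x \<in> carrier (gr_lcs G)" "johnson_hom G (?e \<beta>) ?x \<in> carrier (gr_lcs G)"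
      using johnson_hom_hom[OF ec(1)] johnson_hom_hom[OF ec(2)] xc by (auto simp: hom_def)
    have "johnson_hom G (?e \<delta>) ?x \<otimes>\<^bsub>gr_lcs G\<^esub> johnson_hom G (?e \<beta>) ?x = johnson_hom G (?e \<beta>) ?x"
      using johnson_hom_mult[OF ec xc] eq e by simp
    then have "johnson_hom G (?e \<delta>) ?x = \<one>\<^bsub>gr_lcs G\<^esub>"
      using c gG.r_cancel_one by blast
    then have "gr_elem G (lcs G) (s + 1) (displacement G \<delta> x) = \<one>\<^bsub>gr_lcs G\<^esub>"
      using johnson_hom_gr_elem[OF s _ \<delta>, of 1 x] x by simp
    then show ?thesis
      using x \<delta> displacement_closed[OF johnson_filt_auto[OF \<delta>] x] by (simp add: P.G.gr_elem_eq_one_iff)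
  qed
  then show ?thesis
    using johnson_filt_auto[OF \<delta>] by (simp add: johnson_filt_iff flip: \<delta>_def)
qed

section \<open>Inner derivations\<close>

text \<open>Summand by summand this is the formula for the displacement of a conjugation.
  \<open>X\<close> is inhomogeneous because the fibres behind \<open>outer_johnson_hom\<close> and
  the cosets of inner derivations involve arbitrary elements.\<close>

lemma inner_derivation_eq:
  assumes X: "X \<in> carrier (gr_lcs G)"
  shows "(\<lambda>Y\<in>carrier (gr_lcs G). lbr (gr_lcs G) X Y) =
    johnson_hom G (gr_map (Torelli G) (johnson_filt G) (conj_aut G) X)"
proof -
  interpret P: graded_pairing "Torelli G" "johnson_filt G" G "lcs G" "displacement G"
    by (rule graded_pairing_johnson)
  interpret B: graded_pairing G "lcs G" G "lcs G" "commutator G"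
    by (rule graded_pairing_commutator)
  interpret C: filtration_hom G "lcs G" "Torelli G" "johnson_filt G" "conj_aut G"
    by (rule filtration_hom_conj_aut)
  let ?X = "gr_map (Torelli G) (johnson_filt G) (conj_aut G) X"
  have Xc: "?X \<in> carrier (gr_johnson G)"
    using X by (rule C.gr_map_closed)
  have "gr_pairing G (lcs G) (commutator G) X Y = gr_pairing G (lcs G) (displacement G) ?X Y"
    if Y: "Y \<in> carrier (gr_lcs G)" for Y
  proof (rule P.G.gr_ext[OF B.gr_pairing_closed[OF X Y] P.gr_pairing_closed[OF Xc Y]])
    fix n :: nat
    assume n: "n \<ge> 1"
    interpret Pn: comm_group "gr_part G (lcs G) n"
      using n by (rule P.G.comm_group_gr_part)
    show "gr_pairing G (lcs G) (commutator G) X Y n = gr_pairing G (lcs G) (displacement G) ?X Y n"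
      unfolding P.gr_pairing_apply[OF n] B.gr_pairing_apply[OF n]
    proof (rule Pn.finprod_cong'[OF refl])
      fix s
      assume s: "s \<in> {1..<n}"
      then have st: "s \<ge> 1" "n - s \<ge> 1" "s + (n - s) = n"
        by auto
      obtain g where g: "g \<in> lcs G s" "X s = gr_coset G (lcs G) s g"
        using X st(1) by (rule P.G.gr_component_cases)
      obtain y where y: "y \<in> lcs G (n - s)" "Y (n - s) = gr_coset G (lcs G) (n - s) y"
        using Y st(2) by (rule P.G.gr_component_cases)
      have "y \<in> carrier G"
        using y lcs_subset_carrier by blast
      then show "B.p n (X s) (Y (n - s)) = P.p n (?X s) (Y (n - s))"
        using B.part_pairing_gr_coset[OF st(1,2) g(1) y(1)] st g y
          P.part_pairing_gr_coset[OF st(1,2) conj_aut_johnson_filt[OF st(1) g(1)] y(1)]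
          C.gr_map_apply[of s g X, OF st(1) g]
        by (simp add: displacement_conj_aut)
    qed (use P.gr_pairing_term_closed[OF Xc Y] in blast)
  qed
  then show ?thesis
    unfolding johnson_hom_eq[OF Xc] P.G.lbr_gr by (intro restrict_ext) simp
qed

text \<open>The adjoint map is additive by left additivity of the bracket, hence a homomorphism into
  the group of all functions from the carrier to itself. Its image is a subgroup there, which gives
  the usual criterion for equality of cosets.\<close>

lemma subgroup_inner_der:
  "subgroup (inner_der (gr_lcs G)) (product_group (carrier (gr_lcs G)) (\<lambda>_. gr_lcs G))"
proof -
  interpret L: central_filtration G "lcs G"
    by (rule central_filtration_lcs)
  interpret B: graded_pairing G "lcs G" G "lcs G" "commutator G"
    by (rule graded_pairing_commutator)
  interpret gG: comm_group "gr_lcs G"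
    by (rule L.comm_group_gr)
  let ?E = "product_group (carrier (gr_lcs G)) (\<lambda>_. gr_lcs G)"
  have "(\<lambda>X. \<lambda>Y\<in>carrier (gr_lcs G). lbr (gr_lcs G) X Y) \<in> hom (gr_lcs G) ?E"
    unfolding hom_def L.lbr_gr using B.gr_pairing_closed B.gr_pairing_mult_left
    by (auto intro!: restrict_ext)
  then interpret h: group_hom "gr_lcs G" ?E "\<lambda>X. \<lambda>Y\<in>carrier (gr_lcs G). lbr (gr_lcs G) X Y"
    by (intro group_hom.intro group_hom_axioms.intro gG.is_group product_group)
  show ?thesis
    unfolding inner_der_def by (rule h.img_is_subgroup)
qed

text \<open>\<open>outer_proj\<close> only uses the multiplication of \<open>Der\<close>, which is that of the group of all
  functions from the carrier to itself.\<close>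

lemma outer_proj_eq_iff:
  assumes D: "D \<in> carrier (gr_lcs G) \<rightarrow>\<^sub>E carrier (gr_lcs G)"
    and D': "D' \<in> carrier (gr_lcs G) \<rightarrow>\<^sub>E carrier (gr_lcs G)"
  shows "outer_proj (gr_lcs G) D = outer_proj (gr_lcs G) D' \<longleftrightarrow>
    (\<exists>X\<in>carrier (gr_lcs G). D = (\<lambda>Y\<in>carrier (gr_lcs G). lbr (gr_lcs G) X Y \<otimes>\<^bsub>gr_lcs G\<^esub> D' Y))"
proof -
  interpret L: central_filtration G "lcs G"
    by (rule central_filtration_lcs)
  interpret gG: comm_group "gr_lcs G"
    by (rule L.comm_group_gr)
  let ?E = "product_group (carrier (gr_lcs G)) (\<lambda>_. gr_lcs G)"
  interpret E: group ?E
    by (rule product_group) (rule gG.is_group)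
  note sub = subgroup_inner_der
  have op: "outer_proj (gr_lcs G) F = inner_der (gr_lcs G) #>\<^bsub>?E\<^esub> F" for F
    by (simp add: outer_proj_def Der_def additive_endos_def r_coset_def)
  have "outer_proj (gr_lcs G) D = outer_proj (gr_lcs G) D' \<longleftrightarrow> D \<in> inner_der (gr_lcs G) #>\<^bsub>?E\<^esub> D'"
    unfolding op using E.rcos_self[OF _ sub, of D] E.repr_independence[OF _ _ sub, of D D'] D D'
    by auto
  also have "\<dots> \<longleftrightarrow> (\<exists>X\<in>carrier (gr_lcs G).
      D = (\<lambda>Y\<in>carrier (gr_lcs G). lbr (gr_lcs G) X Y \<otimes>\<^bsub>gr_lcs G\<^esub> D' Y))"
    by (simp add: r_coset_def inner_der_def cong: restrict_cong)
  finally show ?thesis .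
qed

end

section \<open>Consequences of the triviality of the center\<close>

locale centerless_gr = group +
  assumes centerless: "lie_center (gr_lcs G) = {\<one>\<^bsub>gr_lcs G\<^esub>}"
begin

text \<open>The one place where the center is evaluated: the class of \<open>g\<close> in degree
  \<open>k\<close> brackets trivially with homogeneous classes, hence, component by component, with
  everything, so it is zero.\<close>

lemma lcs_Suc_if_central:
  assumes k: "k \<ge> 1" and g: "g \<in> lcs G k"
    and central: "\<And>t x. \<lbrakk>t \<ge> 1; x \<in> lcs G t\<rbrakk> \<Longrightarrow> commutator G g x \<in> lcs G (Suc (k + t))"
  shows "g \<in> lcs G (Suc k)"
proof -
  interpret L: central_filtration G "lcs G"
    by (rule central_filtration_lcs)
  interpret B: graded_pairing G "lcs G" G "lcs G" "commutator G"
    by (rule graded_pairing_commutator)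
  interpret gG: comm_group "gr_lcs G"
    by (rule L.comm_group_gr)
  let ?g = "gr_elem G (lcs G) k g"
  have gc: "?g \<in> carrier (gr_lcs G)" and gh: "?g \<in> hcomp (gr_lcs G) k"
    using L.gr_elem_closed[OF k g] L.hcomp_gr_eq[OF k] g by auto
  have "lbr (gr_lcs G) ?g Y = \<one>\<^bsub>gr_lcs G\<^esub>" if Y: "Y \<in> carrier (gr_lcs G)" for Y
  proof (rule L.gr_ext)
    show "lbr (gr_lcs G) ?g Y \<in> carrier (gr_lcs G)"
      unfolding L.lbr_gr using gc Y by (rule B.gr_pairing_closed)
    fix n :: nat
    assume n: "n \<ge> 1"
    show "lbr (gr_lcs G) ?g Y n = \<one>\<^bsub>gr_lcs G\<^esub> n"
    proof (cases "k < n")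
      case True
      then have nk: "n - k \<ge> 1" "k + (n - k) = n"
        by auto
      obtain y where y: "y \<in> lcs G (n - k)" "Y (n - k) = gr_coset G (lcs G) (n - k) y"
        using Y nk(1) by (rule L.gr_component_cases)
      have "lbr (gr_lcs G) ?g Y n = gr_coset G (lcs G) n (commutator G g y)"
        using B.gr_pairing_homogeneous_left[OF gh Y k n] B.part_pairing_gr_coset[OF k nk(1) g y(1)]
          True nk y k by (simp add: L.lbr_gr L.gr_elem_apply)
      moreover have "commutator G g y \<in> lcs G (Suc n)"
        using central[OF nk(1) y(1)] nk by simp
      ultimately show ?thesis
        using n L.filt_carrier[of "Suc n"] by (simp add: L.one_gr L.gr_coset_eq_one_iff)
    next
      case False
      then show ?thesis
        using B.gr_pairing_homogeneous_left[OF gh Y k n] n by (simp add: L.lbr_gr L.one_gr)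
    qed
  qed simp
  then have "?g \<in> lie_center (gr_lcs G)"
    using gc by (simp add: lie_center_def)
  then show ?thesis
    using k L.filt_carrier[OF k g] by (simp add: centerless L.gr_elem_eq_one_iff)
qed

lemma conj_aut_johnson_filt_iff:
  assumes s: "s \<ge> 1" and g: "g \<in> carrier G"
  shows "conj_aut G g \<in> johnson_filt G s \<longleftrightarrow> g \<in> lcs G s"
proof
  assume conj: "conj_aut G g \<in> johnson_filt G s"
  \<comment> \<open>Climb one degree at a time. For \<open>k < s\<close>, the commutator of
    \<open>g\<close> with an element of Gamma^t lies in Gamma^(s+t), deeper than degree
    \<open>k + t\<close>, so the class of \<open>g\<close> in degree \<open>k\<close> is central and
    \<open>g\<close> lies in Gamma^(k+1).\<close>
  have "k \<le> s \<longrightarrow> g \<in> lcs G k" if "k \<ge> 1" for k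
    using that
  proof (induction k rule: dec_induct)
    case base
    then show ?case
      using g by simp
  next
    case (step k)
    have "commutator G g x \<in> lcs G (Suc (k + t))" if k: "Suc k \<le> s" and t: "t \<ge> 1" "x \<in> lcs G t" for t x
    proof -
      have "commutator G g x \<in> lcs G (s + t)"
        using displacement_lcs[OF conj t] displacement_conj_aut[of x g] lcs_subset_carrier[of t] t(2)
        by auto
      then show ?thesis
        using lcs_mono[of "Suc (k + t)" "s + t"] k by auto
    qed
    then show ?case
      using step lcs_Suc_if_central[of k g] by auto
  qed
  then show "g \<in> lcs G s"
    using s by simp
qed (rule conj_aut_johnson_filt[OF s])

text \<open>For \<open>k \<noteq> s\<close>, the component \<open>X k\<close> brackets elements of
  degree \<open>t\<close> into degree \<open>k + t\<close>, which differs from \<open>t + s\<close>;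
  these brackets are therefore zero, and the triviality of the center removes
  \<open>X k\<close>.\<close>

lemma inner_derivation_homogeneous:
  assumes X: "X \<in> carrier (gr_lcs G)" and s: "s \<ge> 1"
    and deg: "\<And>t x. \<lbrakk>t \<ge> 1; x \<in> lcs G t\<rbrakk> \<Longrightarrow>
      lbr (gr_lcs G) X (gr_elem G (lcs G) t x) \<in> hcomp (gr_lcs G) (t + s)"
  shows "X \<in> hcomp (gr_lcs G) s"
proof -
  interpret L: central_filtration G "lcs G"
    by (rule central_filtration_lcs)
  interpret B: graded_pairing G "lcs G" G "lcs G" "commutator G"
    by (rule graded_pairing_commutator)
  have "X k = \<one>\<^bsub>gr_part G (lcs G) k\<^esub>" if k: "k \<ge> 1" "k \<noteq> s" for k
  proof -
    obtain g where g: "g \<in> lcs G k" "X k = gr_coset G (lcs G) k g"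
      using X k(1) by (rule L.gr_component_cases)
    have "commutator G g x \<in> lcs G (Suc (k + t))" if t: "t \<ge> 1" and x: "x \<in> lcs G t" for t x
    proof -
      have "lbr (gr_lcs G) X (gr_elem G (lcs G) t x) (k + t) = \<one>\<^bsub>gr_part G (lcs G) (k + t)\<^esub>"
        using deg[OF t x] k by (auto simp: L.hcomp_gr)
      moreover have "lbr (gr_lcs G) X (gr_elem G (lcs G) t x) (k + t) =
          gr_coset G (lcs G) (k + t) (commutator G g x)"
        unfolding L.lbr_gr by (rule B.gr_pairing_gr_elem_right[OF X k(1) t x g])
      ultimately show ?thesis
        using L.filt_carrier[OF k(1) g(1)] L.filt_carrier[OF t x] by (simp add: L.gr_coset_eq_one_iff)
    qed
    then have "g \<in> lcs G (Suc k)"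
      by (rule lcs_Suc_if_central[OF k(1) g(1)])
    then show ?thesis
      using g L.filt_carrier[OF k(1) g(1)] by (simp add: L.gr_coset_eq_one_iff)
  qed
  then show ?thesis
    using X by (auto simp: L.hcomp_gr)
qed

text \<open>An inner derivation that is homogeneous of degree \<open>s\<close> comes from the degree \<open>s\<close> part, hence
  is the Johnson image of a conjugation.\<close>

lemma outer_proj_eq_der_deg:
  assumes s: "s \<ge> 1" and D: "D \<in> der_deg (gr_lcs G) s" and \<beta>: "\<beta> \<in> johnson_filt G s"
    and eq: "outer_proj (gr_lcs G) D =
      outer_proj (gr_lcs G) (johnson_hom G (gr_elem (Torelli G) (johnson_filt G) s \<beta>))"
  obtains g where "g \<in> lcs G s"
    "D = johnson_hom G (gr_elem (Torelli G) (johnson_filt G) s (conj_aut G g \<otimes>\<^bsub>Torelli G\<^esub> \<beta>))"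
proof -
  interpret P: graded_pairing "Torelli G" "johnson_filt G" G "lcs G" "displacement G"
    by (rule graded_pairing_johnson)
  interpret C: filtration_hom G "lcs G" "Torelli G" "johnson_filt G" "conj_aut G"
    by (rule filtration_hom_conj_aut)
  interpret L: comm_group "gr_lcs G"
    by (rule P.G.comm_group_gr)
  interpret gT: comm_group "gr_johnson G"
    by (rule P.K.comm_group_gr)
  let ?e = "gr_elem (Torelli G) (johnson_filt G) s"
  let ?D' = "johnson_hom G (?e \<beta>)"
  have \<beta>h: "?e \<beta> \<in> hcomp (gr_johnson G) s"
    using s \<beta> P.K.hcomp_gr_eq by blast
  have D': "?D' \<in> der_deg (gr_lcs G) s"
    by (rule johnson_hom_der_deg[OF s \<beta>h])
  have PiE: "F \<in> carrier (gr_lcs G) \<rightarrow>\<^sub>E carrier (gr_lcs G)" if "F \<in> der_deg (gr_lcs G) s" for F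
    using that by (auto simp: der_deg_def hom_def PiE_def)
  obtain X where X: "X \<in> carrier (gr_lcs G)"
    and DX: "D = (\<lambda>Y\<in>carrier (gr_lcs G). lbr (gr_lcs G) X Y \<otimes>\<^bsub>gr_lcs G\<^esub> ?D' Y)"
    using eq outer_proj_eq_iff[OF PiE[OF D] PiE[OF D']] by auto
  let ?CX = "gr_map (Torelli G) (johnson_filt G) (conj_aut G) X"
  have CX: "?CX \<in> carrier (gr_johnson G)"
    using X by (rule C.gr_map_closed)
  have lbr: "lbr (gr_lcs G) X Y = johnson_hom G ?CX Y" if "Y \<in> carrier (gr_lcs G)" for Y
    using inner_derivation_eq[OF X] that by (metis restrict_apply')
  have lbr_closed: "lbr (gr_lcs G) X Y \<in> carrier (gr_lcs G)" if "Y \<in> carrier (gr_lcs G)" for Y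
    using lbr[OF that] johnson_hom_hom[OF CX] that by (auto simp: hom_def)
  \<comment> \<open>The inner derivation of \<open>X\<close> is the difference of \<open>D\<close>
    and \<open>?D'\<close>, both of degree \<open>s\<close>. As \<open>X\<close> is not yet known to
    be homogeneous, this is compared in each component.\<close>
  have deg: "lbr (gr_lcs G) X Y \<in> hcomp (gr_lcs G) (t + s)" if Y: "Y \<in> hcomp (gr_lcs G) t" for t Y
  proof -
    have Yc: "Y \<in> carrier (gr_lcs G)"
      using Y by (simp add: P.G.hcomp_gr)
    have DY: "D Y \<in> hcomp (gr_lcs G) (t + s)" "?D' Y \<in> hcomp (gr_lcs G) (t + s)"
      using D D' Y unfolding der_deg_def by blast+
    have "lbr (gr_lcs G) X Y n = \<one>\<^bsub>gr_part G (lcs G) n\<^esub>" if n: "n \<ge> 1" "n \<noteq> t + s" for n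
    proof -
      interpret Pn: comm_group "gr_part G (lcs G) n"
        using n(1) by (rule P.G.comm_group_gr_part)
      have "D Y n = lbr (gr_lcs G) X Y n \<otimes>\<^bsub>gr_part G (lcs G) n\<^esub> ?D' Y n"
        using DX Yc n by (simp add: P.G.mult_gr)
      then show ?thesis
        using DY n P.G.gr_component_closed[OF lbr_closed[OF Yc] n(1)] by (simp add: P.G.hcomp_gr)
    qed
    then show ?thesis
      using lbr_closed[OF Yc] by (auto simp: P.G.hcomp_gr)
  qed
  have "X \<in> hcomp (gr_lcs G) s"
    by (rule inner_derivation_homogeneous[OF X s], rule deg) (simp add: P.G.hcomp_gr_eq)
  then obtain g where g: "g \<in> lcs G s" "X = gr_elem G (lcs G) s g"
    using P.G.hcomp_gr_eq[OF s] by blast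
  have CXe: "?CX = ?e (conj_aut G g)"
    using C.gr_map_gr_elem[OF s g(1)] g(2) by simp
  have "?CX \<otimes>\<^bsub>gr_johnson G\<^esub> ?e \<beta> = ?e (conj_aut G g \<otimes>\<^bsub>Torelli G\<^esub> \<beta>)"
    unfolding CXe using conj_aut_johnson_filt[OF s g(1)] \<beta> P.K.filt_carrier[OF s]
    by (simp add: P.K.gr_elem_mult)
  moreover have \<beta>c: "?e \<beta> \<in> carrier (gr_johnson G)"
    using s \<beta> by (rule P.K.gr_elem_closed)
  have "D = johnson_hom G (?CX \<otimes>\<^bsub>gr_johnson G\<^esub> ?e \<beta>)"
  proof
    fix Y
    show "D Y = johnson_hom G (?CX \<otimes>\<^bsub>gr_johnson G\<^esub> ?e \<beta>) Y"
      using CX \<beta>c lbr johnson_hom_mult[OF CX \<beta>c]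
      by (cases "Y \<in> carrier (gr_lcs G)") (simp_all add: DX johnson_hom_eq)
  qed
  ultimately show ?thesis
    using that[OF g(1)] by simp
qed

section \<open>Fibres of the projection to outer automorphisms\<close>

lemma gr_out_proj_eq_component:
  assumes n: "n \<ge> 1" and A: "A \<in> carrier (gr_johnson G)" and B: "B \<in> carrier (gr_johnson G)"
    and eq: "gr_out_proj G A n = gr_out_proj G B n"
  obtains g where "g \<in> lcs G n" "A n = B n \<Longrightarrow> g = \<one>"
    "A n = gr_coset (Torelli G) (johnson_filt G) n (conj_aut G g)
      \<otimes>\<^bsub>gr_part (Torelli G) (johnson_filt G) n\<^esub> B n"
proof -
  interpret O: filtration_hom "Torelli G" "johnson_filt G" "Outer_Torelli G" "outer_johnson_filt G"
    "out_proj G"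
    by (rule filtration_hom_out_proj)
  interpret C: group_hom G "AutoGroup G" "conj_aut G"
    by (rule group_hom_conj_aut)
  interpret Pn: comm_group "gr_part (Torelli G) (johnson_filt G) n"
    using n by (rule O.K.comm_group_gr_part)
  let ?c = "gr_coset (Torelli G) (johnson_filt G) n"
  show ?thesis
  proof (cases "A n = B n")
    \<comment> \<open>Choosing \<open>g = \<one>\<close> where the components agree makes the finite
      support of the element assembled in \<open>gr_out_proj_eq\<close> immediate.\<close>
    case True
    have "conj_aut G \<one> = \<one>\<^bsub>Torelli G\<^esub>"
      by (simp add: Torelli_def)
    then show ?thesis
      using True that[of \<one>] O.K.gr_component_closed[OF B n]
      by (simp add: O.K.gr_coset_one subgroup.one_closed[OF lcs_subgroup])
  next
    case False
    obtain \<alpha> where \<alpha>: "\<alpha> \<in> johnson_filt G n" "A n = ?c \<alpha>"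
      using A n by (rule O.K.gr_component_cases)
    obtain \<beta> where \<beta>: "\<beta> \<in> johnson_filt G n" "B n = ?c \<beta>"
      using B n by (rule O.K.gr_component_cases)
    have T: "\<alpha> \<in> carrier (Torelli G)" "\<beta> \<in> carrier (Torelli G)"
      using \<alpha> \<beta> O.K.filt_carrier[OF n] by blast+
    have "gr_coset (Outer_Torelli G) (outer_johnson_filt G) n (out_proj G \<alpha>) =
        gr_coset (Outer_Torelli G) (outer_johnson_filt G) n (out_proj G \<beta>)"
      using eq O.gr_map_apply[of n \<alpha> A, OF n \<alpha>] O.gr_map_apply[of n \<beta> B, OF n \<beta>]
      by (simp add: gr_out_proj_def)
    then have "out_proj G (\<alpha> \<otimes>\<^bsub>Torelli G\<^esub> inv\<^bsub>Torelli G\<^esub> \<beta>) \<in> outer_johnson_filt G (Suc n)"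
      using T by (simp add: O.H.gr_coset_eq_iff)
    then obtain \<gamma> where \<gamma>: "\<gamma> \<in> johnson_filt G (Suc n)"
      "out_proj G (\<alpha> \<otimes>\<^bsub>Torelli G\<^esub> inv\<^bsub>Torelli G\<^esub> \<beta>) = out_proj G \<gamma>"
      by (auto simp: outer_johnson_filt_def)
    have \<gamma>T: "\<gamma> \<in> carrier (Torelli G)"
      using \<gamma>(1) O.K.filt_carrier[of "Suc n"] by simp
    have "\<alpha> \<otimes>\<^bsub>Torelli G\<^esub> inv\<^bsub>Torelli G\<^esub> \<beta> \<in> carrier (Torelli G)"
      using T by simp
    then obtain g where g: "g \<in> carrier G"
      "\<alpha> \<otimes>\<^bsub>Torelli G\<^esub> inv\<^bsub>Torelli G\<^esub> \<beta> = conj_aut G g \<otimes>\<^bsub>Torelli G\<^esub> \<gamma>"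
      using \<gamma>(2) out_proj_eq_iff[OF _ \<gamma>T] by blast
    have gT: "conj_aut G g \<in> carrier (Torelli G)"
      using conj_aut_johnson_filt[of 1 g] g(1) by (simp add: carrier_Torelli)
    have gc: "conj_aut G g = \<alpha> \<otimes>\<^bsub>Torelli G\<^esub> inv\<^bsub>Torelli G\<^esub> \<beta> \<otimes>\<^bsub>Torelli G\<^esub> inv\<^bsub>Torelli G\<^esub> \<gamma>"
      using gT \<gamma>T by (simp add: g(2) O.K.mult_inv_cancel)
    \<comment> \<open>So far \<open>g\<close> is any element of \<open>G\<close>. As \<gamma> and
      the quotient of \<alpha> by \<beta> lie in F^n, so does the conjugation, and the triviality of
      the center places \<open>g\<close> in Gamma^n(G).\<close>
    have "\<gamma> \<in> johnson_filt G n"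
      using \<gamma>(1) O.K.filt_Suc_subset[OF n] by blast
    then have "conj_aut G g \<in> johnson_filt G n"
      unfolding gc using \<alpha>(1) \<beta>(1) O.K.subgroup_filt[OF n]
      by (simp add: subgroup.m_closed subgroup.m_inv_closed)
    then have gl: "g \<in> lcs G n"
      using conj_aut_johnson_filt_iff[OF n g(1)] by simp
    have "\<alpha> = \<alpha> \<otimes>\<^bsub>Torelli G\<^esub> inv\<^bsub>Torelli G\<^esub> \<beta> \<otimes>\<^bsub>Torelli G\<^esub> \<beta>"
      using T by (simp add: O.K.m_assoc)
    also have "\<dots> = conj_aut G g \<otimes>\<^bsub>Torelli G\<^esub> (\<gamma> \<otimes>\<^bsub>Torelli G\<^esub> \<beta>)"
      using gT \<gamma>T T unfolding g(2) by (simp add: O.K.m_assoc)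
    finally have "\<alpha> = conj_aut G g \<otimes>\<^bsub>Torelli G\<^esub> (\<gamma> \<otimes>\<^bsub>Torelli G\<^esub> \<beta>)" .
    then have "A n = ?c (conj_aut G g) \<otimes>\<^bsub>gr_part (Torelli G) (johnson_filt G) n\<^esub> ?c (\<gamma> \<otimes>\<^bsub>Torelli G\<^esub> \<beta>)"
      using gT \<gamma>T T \<alpha> by (simp add: O.K.gr_coset_mult)
    also have "?c (\<gamma> \<otimes>\<^bsub>Torelli G\<^esub> \<beta>) = B n"
      using O.K.gr_coset_mult_left[OF \<gamma>(1) T(2)] \<beta> by simp
    finally show ?thesis
      using that[OF gl] False by blast
  qed
qed

lemma gr_out_proj_eq:
  assumes A: "A \<in> carrier (gr_johnson G)" and B: "B \<in> carrier (gr_johnson G)"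
    and eq: "gr_out_proj G A = gr_out_proj G B"
  obtains X where "X \<in> carrier (gr_lcs G)"
    "A = gr_map (Torelli G) (johnson_filt G) (conj_aut G) X \<otimes>\<^bsub>gr_johnson G\<^esub> B"
proof -
  interpret C: filtration_hom G "lcs G" "Torelli G" "johnson_filt G" "conj_aut G"
    by (rule filtration_hom_conj_aut)
  interpret gT: comm_group "gr_johnson G"
    by (rule C.H.comm_group_gr)
  have "\<forall>n\<in>{1..}. \<exists>g. g \<in> lcs G n \<and> (A n = B n \<longrightarrow> g = \<one>) \<and>
      A n = gr_coset (Torelli G) (johnson_filt G) n (conj_aut G g)
        \<otimes>\<^bsub>gr_part (Torelli G) (johnson_filt G) n\<^esub> B n"
  proof
    fix n :: nat
    assume "n \<in> {1..}"
    then obtain g where "g \<in> lcs G n" "A n = B n \<Longrightarrow> g = \<one>"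
      "A n = gr_coset (Torelli G) (johnson_filt G) n (conj_aut G g)
        \<otimes>\<^bsub>gr_part (Torelli G) (johnson_filt G) n\<^esub> B n"
      using gr_out_proj_eq_component[OF _ A B, of n] eq by auto
    then show "\<exists>g. g \<in> lcs G n \<and> (A n = B n \<longrightarrow> g = \<one>) \<and>
      A n = gr_coset (Torelli G) (johnson_filt G) n (conj_aut G g)
        \<otimes>\<^bsub>gr_part (Torelli G) (johnson_filt G) n\<^esub> B n"
      by blast
  qed
  from bchoice[OF this] obtain g where "\<forall>n\<in>{1..}. g n \<in> lcs G n \<and> (A n = B n \<longrightarrow> g n = \<one>) \<and>
      A n = gr_coset (Torelli G) (johnson_filt G) n (conj_aut G (g n))
        \<otimes>\<^bsub>gr_part (Torelli G) (johnson_filt G) n\<^esub> B n"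
    by blast
  then have g: "g n \<in> lcs G n" "A n = B n \<Longrightarrow> g n = \<one>"
      "A n = gr_coset (Torelli G) (johnson_filt G) n (conj_aut G (g n))
        \<otimes>\<^bsub>gr_part (Torelli G) (johnson_filt G) n\<^esub> B n"
    if "n \<ge> 1" for n
    using that by (meson atLeast_iff)+
  define X where "X = (\<lambda>n\<in>{1..}. gr_coset G (lcs G) n (g n))"
  \<comment> \<open>Outside the supports of \<open>A\<close> and \<open>B\<close> both components
    are trivial, hence equal, and \<open>g n = \<one>\<close>.\<close>
  have "{n \<in> {1..}. X n \<noteq> \<one>\<^bsub>gr_part G (lcs G) n\<^esub>} \<subseteq>
      {n \<in> {1..}. A n \<noteq> \<one>\<^bsub>gr_part (Torelli G) (johnson_filt G) n\<^esub>} \<union>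
      {n \<in> {1..}. B n \<noteq> \<one>\<^bsub>gr_part (Torelli G) (johnson_filt G) n\<^esub>}"
    using g(2) C.K.gr_coset_one by (fastforce simp: X_def)
  then have "finite {n \<in> {1..}. X n \<noteq> \<one>\<^bsub>gr_part G (lcs G) n\<^esub>}"
    by (rule finite_subset) (use A B in \<open>simp add: C.H.carrier_gr\<close>)
  then have X: "X \<in> carrier (gr_lcs G)"
    using g(1) C.K.gr_coset_closed by (auto simp: C.K.carrier_gr X_def)
  moreover have "A = gr_map (Torelli G) (johnson_filt G) (conj_aut G) X \<otimes>\<^bsub>gr_johnson G\<^esub> B"
  proof (rule C.H.gr_ext[OF A])
    show "gr_map (Torelli G) (johnson_filt G) (conj_aut G) X \<otimes>\<^bsub>gr_johnson G\<^esub> B \<in> carrier (gr_johnson G)"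
      using C.gr_map_closed[OF X] B by simp
    fix n :: nat
    assume n: "n \<ge> 1"
    then have "gr_map (Torelli G) (johnson_filt G) (conj_aut G) X n =
        gr_coset (Torelli G) (johnson_filt G) n (conj_aut G (g n))"
      using g(1) by (intro C.gr_map_apply) (simp_all add: X_def)
    then show "A n = (gr_map (Torelli G) (johnson_filt G) (conj_aut G) X \<otimes>\<^bsub>gr_johnson G\<^esub> B) n"
      using g(3)[OF n] n by (simp add: C.H.mult_gr)
  qed
  ultimately show ?thesis
    using that by blast
qed

text \<open>Two points of a fibre differ by the image of some \<open>X\<close> under conjugation,
  whose Johnson image is the inner derivation of \<open>X\<close>. So the value in outer derivations
  is constant on the fibre, and \<open>the_elem\<close> returns it.\<close>

lemma outer_johnson_hom_gr_out_proj:
  assumes A: "A \<in> carrier (gr_johnson G)"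
  shows "outer_johnson_hom G (gr_out_proj G A) = outer_proj (gr_lcs G) (johnson_hom G A)"
proof -
  interpret O: filtration_hom "Torelli G" "johnson_filt G" "Outer_Torelli G" "outer_johnson_filt G"
    "out_proj G"
    by (rule filtration_hom_out_proj)
  interpret C: filtration_hom G "lcs G" "Torelli G" "johnson_filt G" "conj_aut G"
    by (rule filtration_hom_conj_aut)
  have PiE: "johnson_hom G B \<in> carrier (gr_lcs G) \<rightarrow>\<^sub>E carrier (gr_lcs G)"
    if "B \<in> carrier (gr_johnson G)" for B
    using johnson_hom_hom[OF that] by (auto simp: hom_def PiE_def)
  have fibre: "outer_proj (gr_lcs G) (johnson_hom G B) = outer_proj (gr_lcs G) (johnson_hom G A)"
    if B: "B \<in> carrier (gr_johnson G)" "gr_out_proj G B = gr_out_proj G A" for B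
  proof -
    obtain X where X: "X \<in> carrier (gr_lcs G)"
      and BX: "B = gr_map (Torelli G) (johnson_filt G) (conj_aut G) X \<otimes>\<^bsub>gr_johnson G\<^esub> A"
      using gr_out_proj_eq[OF B(1) A B(2)] by blast
    have CX: "gr_map (Torelli G) (johnson_filt G) (conj_aut G) X \<in> carrier (gr_johnson G)"
      using X by (rule C.gr_map_closed)
    have "johnson_hom G B Y = lbr (gr_lcs G) X Y \<otimes>\<^bsub>gr_lcs G\<^esub> johnson_hom G A Y"
      if "Y \<in> carrier (gr_lcs G)" for Y
      using johnson_hom_mult[OF CX A that] inner_derivation_eq[OF X] that BX
      by (metis restrict_apply')
    then have "johnson_hom G B =
        (\<lambda>Y\<in>carrier (gr_lcs G). lbr (gr_lcs G) X Y \<otimes>\<^bsub>gr_lcs G\<^esub> johnson_hom G A Y)"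
      using PiE[OF B(1)] by (auto simp: PiE_def intro: extensionalityI)
    then show ?thesis
      using X outer_proj_eq_iff[OF PiE[OF B(1)] PiE[OF A]] by blast
  qed
  have "gr_out_proj G A \<in> carrier (gr_outer_johnson G)"
    unfolding gr_out_proj_def using A by (rule O.gr_map_closed)
  moreover have "the_elem ((\<lambda>B. outer_proj (gr_lcs G) (johnson_hom G B)) `
      {B \<in> carrier (gr_johnson G). gr_out_proj G B = gr_out_proj G A}) =
      outer_proj (gr_lcs G) (johnson_hom G A)"
  proof (rule the_elem_image_unique)
    show "{B \<in> carrier (gr_johnson G). gr_out_proj G B = gr_out_proj G A} \<noteq> {}"
      using A by blast
  qed (rule fibre, simp_all)
  ultimately show ?thesis
    by (simp add: outer_johnson_hom_def)
qed

end

section \<open>Comparison of the two maps in degree s, on representatives\<close>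

lemma inj_on_image_alt:
  "inj_on f (e ` A) \<longleftrightarrow> (\<forall>x\<in>A. \<forall>y\<in>A. f (e x) = f (e y) \<longrightarrow> e x = e y)"
  by (auto simp: inj_on_def)

theorem lemma4p4:
  fixes G :: "('a, 'm) monoid_scheme" and s :: nat
  assumes "group G"
    and "lie_center (gr_lcs G) = {\<one>\<^bsub>gr_lcs G\<^esub>}"
    and "s \<ge> 1"
  shows "(inj_on (johnson_hom G \<circ> iota G) (hcomp (gr_lcs (Torelli G)) s)
      \<longleftrightarrow> inj_on (outer_johnson_hom G \<circ> outer_iota G) (hcomp (gr_lcs (Outer_Torelli G)) s))
    \<and> ((johnson_hom G \<circ> iota G) ` hcomp (gr_lcs (Torelli G)) s = hcomp (Der (gr_lcs G)) s
      \<longleftrightarrow> (outer_johnson_hom G \<circ> outer_iota G) ` hcomp (gr_lcs (Outer_Torelli G)) s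
          = hcomp (Outer_Der (gr_lcs G)) s)"
proof -
  interpret centerless_gr G
    using assms by (simp add: centerless_gr_def centerless_gr_axioms_def)
  interpret O: filtration_hom "Torelli G" "johnson_filt G" "Outer_Torelli G" "outer_johnson_filt G"
    "out_proj G"
    by (rule filtration_hom_out_proj)
  interpret C: filtration_hom G "lcs G" "Torelli G" "johnson_filt G" "conj_aut G"
    by (rule filtration_hom_conj_aut)
  interpret LT: central_filtration "Torelli G" "lcs (Torelli G)"
    by (rule O.K.central_filtration_lcs)
  interpret LO: central_filtration "Outer_Torelli G" "lcs (Outer_Torelli G)"
    by (rule O.H.central_filtration_lcs)
  note s = assms(3)
  let ?T = "Torelli G" and ?O = "Outer_Torelli G"
  define J where "J \<alpha> = johnson_hom G (gr_elem ?T (johnson_filt G) s \<alpha>)" for \<alpha>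
  have lcs_F: "\<alpha> \<in> johnson_filt G s" if "\<alpha> \<in> lcs ?T s" for \<alpha>
    using that O.K.lcs_subset_filt[OF s] by blast
  have lcs_T: "\<alpha> \<in> carrier ?T" if "\<alpha> \<in> lcs ?T k" for \<alpha> k
    using that O.K.lcs_subset_carrier by blast
  have lcs_O: "lcs ?O k = out_proj G ` lcs ?T k" for k
    by (rule O.lcs_image[OF out_proj_surj])
  \<comment> \<open>Conjugations by Gamma^k(G) lie in the lower central series of the Torelli group,
    not only in its Johnson filtration; representatives can thus be corrected inside
    Gamma^s(T).\<close>
  have conj_lcs: "conj_aut G g \<in> lcs ?T k" if "g \<in> lcs G k" for g k
    using C.lcs_image_subset that by blast
  have f: "(johnson_hom G \<circ> iota G) (gr_elem ?T (lcs ?T) s \<alpha>) = J \<alpha>" if "\<alpha> \<in> lcs ?T s" for \<alpha>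
    using filtration_hom.gr_map_gr_elem[OF O.K.filtration_hom_lcs s that] by (simp add: J_def iota_def)
  \<comment> \<open>The inclusions commute with the projection to outer automorphisms, so the outer
    map can be evaluated on a representative in Gamma^s(T).\<close>
  have fO: "(outer_johnson_hom G \<circ> outer_iota G) (gr_elem ?O (lcs ?O) s (out_proj G \<alpha>)) =
      outer_proj (gr_lcs G) (J \<alpha>)" if \<alpha>: "\<alpha> \<in> lcs ?T s" for \<alpha>
  proof -
    have "outer_iota G (gr_elem ?O (lcs ?O) s (out_proj G \<alpha>)) =
        gr_elem ?O (outer_johnson_filt G) s (out_proj G \<alpha>)"
      unfolding outer_iota_def using \<alpha> lcs_O by (intro filtration_hom.gr_map_gr_elem[OF O.H.filtration_hom_lcs s]) blast
    also have "\<dots> = gr_out_proj G (gr_elem ?T (johnson_filt G) s \<alpha>)"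
      unfolding gr_out_proj_def using O.gr_map_gr_elem[OF s lcs_F[OF \<alpha>]] by simp
    finally show ?thesis
      using outer_johnson_hom_gr_out_proj[OF O.K.gr_elem_closed[OF s lcs_F[OF \<alpha>]]]
      by (simp add: J_def)
  qed
  have dom: "hcomp (gr_lcs ?T) s = gr_elem ?T (lcs ?T) s ` lcs ?T s"
    "hcomp (gr_lcs ?O) s = (\<lambda>\<alpha>. gr_elem ?O (lcs ?O) s (out_proj G \<alpha>)) ` lcs ?T s"
    using LT.hcomp_gr_eq[OF s] LO.hcomp_gr_eq[OF s] lcs_O[of s] by (simp_all add: image_image)
  have J_der: "J \<alpha> \<in> der_deg (gr_lcs G) s" if "\<alpha> \<in> lcs ?T s" for \<alpha>
    unfolding J_def using O.K.hcomp_gr_eq[OF s] lcs_F[OF that] by (intro johnson_hom_der_deg[OF s]) blast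
  have J_eq: "\<exists>g\<in>lcs G s. D = J (conj_aut G g \<otimes>\<^bsub>?T\<^esub> \<beta>)"
    if "D \<in> der_deg (gr_lcs G) s" "\<beta> \<in> lcs ?T s"
      "outer_proj (gr_lcs G) D = outer_proj (gr_lcs G) (J \<beta>)" for D \<beta>
    using outer_proj_eq_der_deg[OF s that(1) lcs_F[OF that(2)]] that(3) unfolding J_def by blast
  have conj_mult: "conj_aut G g \<otimes>\<^bsub>?T\<^esub> \<beta> \<in> lcs ?T s" if "g \<in> lcs G s" "\<beta> \<in> lcs ?T s" for g \<beta>
    using conj_lcs[OF that(1)] that(2) by (rule subgroup.m_closed[OF O.K.lcs_subgroup])
  have inj: "inj_on (johnson_hom G \<circ> iota G) (hcomp (gr_lcs ?T) s) \<longleftrightarrow>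
      (\<forall>\<alpha>\<in>lcs ?T s. \<forall>\<beta>\<in>lcs ?T s. J \<alpha> = J \<beta> \<longrightarrow> \<alpha> \<otimes>\<^bsub>?T\<^esub> inv\<^bsub>?T\<^esub> \<beta> \<in> lcs ?T (Suc s))"
    unfolding dom inj_on_image_alt
    by (intro ball_cong refl) (simp only: f LT.gr_elem_eq_iff[OF s lcs_T lcs_T])
  have out_mult: "out_proj G \<alpha> \<otimes>\<^bsub>?O\<^esub> inv\<^bsub>?O\<^esub> out_proj G \<beta> = out_proj G (\<alpha> \<otimes>\<^bsub>?T\<^esub> inv\<^bsub>?T\<^esub> \<beta>)"
    if "\<alpha> \<in> lcs ?T s" "\<beta> \<in> lcs ?T s" for \<alpha> \<beta>
    using that lcs_T by simp
  have injO: "inj_on (outer_johnson_hom G \<circ> outer_iota G) (hcomp (gr_lcs ?O) s) \<longleftrightarrow>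
      (\<forall>\<alpha>\<in>lcs ?T s. \<forall>\<beta>\<in>lcs ?T s. outer_proj (gr_lcs G) (J \<alpha>) = outer_proj (gr_lcs G) (J \<beta>) \<longrightarrow>
        out_proj G (\<alpha> \<otimes>\<^bsub>?T\<^esub> inv\<^bsub>?T\<^esub> \<beta>) \<in> out_proj G ` lcs ?T (Suc s))"
    unfolding dom inj_on_image_alt
    by (intro ball_cong refl)
      (simp only: fO LO.gr_elem_eq_iff[OF s O.hom_closed[OF lcs_T] O.hom_closed[OF lcs_T]]
        out_mult lcs_O)
  have "inj_on (johnson_hom G \<circ> iota G) (hcomp (gr_lcs ?T) s) \<longleftrightarrow>
      inj_on (outer_johnson_hom G \<circ> outer_iota G) (hcomp (gr_lcs ?O) s)"
    unfolding inj injO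
  proof (intro iffI ballI impI)
    fix \<alpha> \<beta>
    assume inj: "\<forall>\<alpha>\<in>lcs ?T s. \<forall>\<beta>\<in>lcs ?T s. J \<alpha> = J \<beta> \<longrightarrow> \<alpha> \<otimes>\<^bsub>?T\<^esub> inv\<^bsub>?T\<^esub> \<beta> \<in> lcs ?T (Suc s)"
      and \<alpha>: "\<alpha> \<in> lcs ?T s" and \<beta>: "\<beta> \<in> lcs ?T s"
      and eq: "outer_proj (gr_lcs G) (J \<alpha>) = outer_proj (gr_lcs G) (J \<beta>)"
    \<comment> \<open>The inner derivation that separates the two images is absorbed into \<beta> as
      a conjugation, which is invisible in Out; the assumed injectivity then applies to \<alpha> and
      the corrected \<beta>.\<close>
    obtain g where g: "g \<in> lcs G s" "J \<alpha> = J (conj_aut G g \<otimes>\<^bsub>?T\<^esub> \<beta>)"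
      using J_eq[OF J_der[OF \<alpha>] \<beta> eq] by blast
    let ?\<beta> = "conj_aut G g \<otimes>\<^bsub>?T\<^esub> \<beta>"
    have \<beta>': "?\<beta> \<in> lcs ?T s"
      using g(1) \<beta> by (rule conj_mult)
    have "out_proj G ?\<beta> = out_proj G \<beta>"
      using out_proj_eq_iff[OF lcs_T[OF \<beta>'] lcs_T[OF \<beta>]] g(1) lcs_subset_carrier by blast
    then have "out_proj G (\<alpha> \<otimes>\<^bsub>?T\<^esub> inv\<^bsub>?T\<^esub> \<beta>) = out_proj G (\<alpha> \<otimes>\<^bsub>?T\<^esub> inv\<^bsub>?T\<^esub> ?\<beta>)"
      using out_mult[OF \<alpha> \<beta>] out_mult[OF \<alpha> \<beta>'] by simp
    moreover have "\<alpha> \<otimes>\<^bsub>?T\<^esub> inv\<^bsub>?T\<^esub> ?\<beta> \<in> lcs ?T (Suc s)"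
      using inj \<alpha> \<beta>' g(2) by blast
    ultimately show "out_proj G (\<alpha> \<otimes>\<^bsub>?T\<^esub> inv\<^bsub>?T\<^esub> \<beta>) \<in> out_proj G ` lcs ?T (Suc s)"
      by blast
  next
    fix \<alpha> \<beta>
    assume injO: "\<forall>\<alpha>\<in>lcs ?T s. \<forall>\<beta>\<in>lcs ?T s.
        outer_proj (gr_lcs G) (J \<alpha>) = outer_proj (gr_lcs G) (J \<beta>) \<longrightarrow>
        out_proj G (\<alpha> \<otimes>\<^bsub>?T\<^esub> inv\<^bsub>?T\<^esub> \<beta>) \<in> out_proj G ` lcs ?T (Suc s)"
      and \<alpha>: "\<alpha> \<in> lcs ?T s" and \<beta>: "\<beta> \<in> lcs ?T s" and eq: "J \<alpha> = J \<beta>"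
    let ?\<delta> = "\<alpha> \<otimes>\<^bsub>?T\<^esub> inv\<^bsub>?T\<^esub> \<beta>"
    obtain \<gamma> where \<gamma>: "\<gamma> \<in> lcs ?T (Suc s)" "out_proj G ?\<delta> = out_proj G \<gamma>"
      using injO \<alpha> \<beta> eq by (metis (no_types, lifting) imageE)
    have \<delta>T: "?\<delta> \<in> carrier ?T"
      using lcs_T[OF \<alpha>] lcs_T[OF \<beta>] by simp
    obtain g where g: "g \<in> carrier G" "?\<delta> = conj_aut G g \<otimes>\<^bsub>?T\<^esub> \<gamma>"
      using out_proj_eq_iff[OF \<delta>T lcs_T[OF \<gamma>(1)]] \<gamma>(2) by blast
    have gT: "conj_aut G g \<in> carrier ?T"
      using g(1) by simp
    \<comment> \<open>A detour through the Johnson filtration, in which the depth of a conjugation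
      determines that of \<open>g\<close>; \<open>conj_lcs\<close> then leads back to the lower
      central series.\<close>
    have "?\<delta> \<in> johnson_filt G (Suc s)"
      using johnson_hom_injective[OF s lcs_F[OF \<alpha>] lcs_F[OF \<beta>]] eq by (simp add: J_def)
    moreover have "\<gamma> \<in> johnson_filt G (Suc s)"
      using \<gamma>(1) O.K.lcs_subset_filt[of "Suc s"] by auto
    ultimately have "?\<delta> \<otimes>\<^bsub>?T\<^esub> inv\<^bsub>?T\<^esub> \<gamma> \<in> johnson_filt G (Suc s)"
      using O.K.subgroup_filt[of "Suc s"] by (simp add: subgroup.m_closed subgroup.m_inv_closed)
    moreover have "?\<delta> \<otimes>\<^bsub>?T\<^esub> inv\<^bsub>?T\<^esub> \<gamma> = conj_aut G g"
      unfolding g(2) by (rule O.K.mult_inv_cancel[OF gT lcs_T[OF \<gamma>(1)]])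
    ultimately have "g \<in> lcs G (Suc s)"
      using conj_aut_johnson_filt_iff[of "Suc s" g] g(1) by simp
    then have "conj_aut G g \<in> lcs ?T (Suc s)"
      by (rule conj_lcs)
    then show "?\<delta> \<in> lcs ?T (Suc s)"
      unfolding g(2) using \<gamma>(1) by (rule subgroup.m_closed[OF O.K.lcs_subgroup])
  qed
  moreover have "(johnson_hom G \<circ> iota G) ` hcomp (gr_lcs ?T) s = hcomp (Der (gr_lcs G)) s \<longleftrightarrow>
      (outer_johnson_hom G \<circ> outer_iota G) ` hcomp (gr_lcs ?O) s = hcomp (Outer_Der (gr_lcs G)) s"
  proof -
    have im: "(johnson_hom G \<circ> iota G) ` hcomp (gr_lcs ?T) s = J ` lcs ?T s"
      unfolding dom image_image using f by (intro image_cong) auto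
    have imO: "(outer_johnson_hom G \<circ> outer_iota G) ` hcomp (gr_lcs ?O) s =
        outer_proj (gr_lcs G) ` J ` lcs ?T s"
      unfolding dom image_image using fO by (intro image_cong) auto
    have der: "hcomp (Der (gr_lcs G)) s = der_deg (gr_lcs G) s"
      "hcomp (Outer_Der (gr_lcs G)) s = outer_proj (gr_lcs G) ` der_deg (gr_lcs G) s"
      using s by (simp_all add: Der_def Outer_Der_def)
    \<comment> \<open>The direction with content: \<open>D\<close> agrees with some
      \<open>J \<beta>\<close> up to an inner derivation, which is the Johnson image of a
      conjugation from Gamma^s(T), so correcting \<beta> attains \<open>D\<close> itself. The
      converse applies \<open>outer_proj\<close> to both sides.\<close>
    have "D \<in> J ` lcs ?T s"
      if onto: "outer_proj (gr_lcs G) ` J ` lcs ?T s = outer_proj (gr_lcs G) ` der_deg (gr_lcs G) s"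
        and D: "D \<in> der_deg (gr_lcs G) s" for D
    proof -
      have "outer_proj (gr_lcs G) D \<in> outer_proj (gr_lcs G) ` J ` lcs ?T s"
        unfolding onto using D by (rule imageI)
      then obtain \<beta> where \<beta>: "\<beta> \<in> lcs ?T s" "outer_proj (gr_lcs G) D = outer_proj (gr_lcs G) (J \<beta>)"
        by blast
      then show ?thesis
        using J_eq[OF D \<beta>] conj_mult by blast
    qed
    then show ?thesis
      unfolding im imO der using J_der by blast
  qed
  ultimately show ?thesis
    by (rule conjI)
qed

end
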